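(* Let $n\ge2$ and $s\in(1/2,1)$. Assume that $U_0\in C^\infty_{\mathrm b}(\mathbb{R})$ is nondecreasing, and let $u_0\in C_{\mathrm b}^\infty(\mathbb{R}^n)$ be defined by $u_0(x):=U_0(x_1)$, where $x=(x_1,\dots,x_n)$. Then there exists a classical solution $u\in C^\infty_{\mathrm b}(\mathbb{R}^n\times[0,\infty))$ of $$\partial_tu=\Delta_\infty^su\ \text{ in }\mathbb{R}^n\times(0,\infty),\qquad u(\cdot,0)=u_0 .$$ Moreover, for all $x\in\mathbb{R}^n$ and $t>0$, $$u(x,t)=(P_s(\cdot,t)*U_0)(x_1)=\int_{-\infty}^\infty P_s(x_1-\sigma,t)\,U_0(\sigma)\,d\sigma .$$
   Context: $C^\infty_{\mathrm b}(U)$: functions on $U$ with bounded continuous derivatives of all orders. $C_s=\frac{4^s s\,\Gamma(\frac12+s)}{\pi^{1/2}\Gamma(1-s)}$. For $\phi$ bounded on $\mathbb{R}^n$ and $C^{1,1}$ at $x$ (i.e. $|\phi(x+y)-\phi(x)-\nabla\phi(x)\cdot y|\le C_x|y|^2$ for $|y|<\eta_x$, for some $C_x,\eta_x>0$): if $\nabla\phi(x)\ne0$, with $\zeta=\nabla\phi(x)/|\nabla\phi(x)|$, $$\Delta^s_\infty\phi(x)=C_s\int_0^\infty(\phi(x+\eta\zeta)+\phi(x-\eta\zeta)-2\phi(x))\frac{d\eta}{\eta^{1+2s}};$$ if $\nabla\phi(x)=0$, $$\Delta^s_\infty\phi(x)=C_s\sup_{|y|=1}\int_0^\infty(\phi(x+\eta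 y)-\phi(x))\frac{d\eta}{\eta^{1+2s}}+C_s\inf_{|y|=1}\int_0^\infty(\phi(x-\eta y)-\phi(x))\frac{d\eta}{\eta^{1+2s}}.$$ The operator acts in the space variable; a classical solution satisfies the equation and the initial condition pointwise. $P_s(x,t)=\mathcal{F}^{-1}(e^{-|\xi|^{2s}t})(x)$, $x\in\mathbb{R}$, $t>0$, is the fundamental solution of the one-dimensional fractional heat equation $\partial_tv+(-\partial_{xx}^2)^sv=0$ (heat kernel with total mass $1$), where $(-\partial^2_{xx})^s\Phi(x)=-C_s\int_0^\infty(\Phi(x+\eta)+\Phi(x-\eta)-2\Phi(x))\frac{d\eta}{\eta^{1+2s}}$. *)

theory Defs
  imports "HOL-Analysis.Analysis"
begin

text \<open>Derivatives are taken relative to \<^term>\<open>S\<close>, hence one-sided at boundary points of \<^term>\<open>S\<close>;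
  they are unique if \<^term>\<open>S\<close> is open or a closed half space. The function \<^term>\<open>g b\<close> is the partial
  derivative in the direction of the basis vector \<^term>\<open>b\<close>.\<close>

primrec C_bdd :: "nat \<Rightarrow> 'a::euclidean_space set \<Rightarrow> ('a \<Rightarrow> real) \<Rightarrow> bool" where
  "C_bdd 0 S f \<longleftrightarrow> continuous_on S f \<and> bounded (f ` S)"
| "C_bdd (Suc m) S f \<longleftrightarrow> continuous_on S f \<and> bounded (f ` S) \<and>
     (\<exists>g. (\<forall>x\<in>S. (f has_derivative (\<lambda>h. \<Sum>b\<in>Basis. (h \<bullet> b) * g b x)) (at x within S)) \<and>
          (\<forall>b\<in>Basis. C_bdd m S (g b)))"

definition C_bdd_inf :: "'a::euclidean_space set \<Rightarrow> ('a \<Rightarrow> real) set" where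
  "C_bdd_inf S = {f. \<forall>m. C_bdd m S f}"

definition grad :: "('a::euclidean_space \<Rightarrow> real) \<Rightarrow> 'a \<Rightarrow> 'a" where
  "grad \<phi> x = (THE D. GDERIV \<phi> x :> D)"

definition C11_at :: "('a::euclidean_space \<Rightarrow> real) \<Rightarrow> 'a \<Rightarrow> bool" where
  "C11_at \<phi> x \<longleftrightarrow> \<phi> differentiable (at x) \<and>
     (\<exists>C>0. \<exists>r>0. \<forall>y. norm y < r \<longrightarrow>
        \<bar>\<phi> (x + y) - \<phi> x - grad \<phi> x \<bullet> y\<bar> \<le> C * (norm y)\<^sup>2)"

definition frac_const :: "real \<Rightarrow> real" where
  "frac_const s = 4 powr s * s * Gamma (1/2 + s) / (sqrt pi * Gamma (1 - s))"

text \<open>Only meaningful when \<^term>\<open>\<phi>\<close> is bounded (and measurable along lines) and satisfies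
  \<^term>\<open>C11_at \<phi> x\<close>; then all integrals converge absolutely, and the supremum and the infimum are finite.\<close>

definition inf_frac_laplacian :: "real \<Rightarrow> ('a::euclidean_space \<Rightarrow> real) \<Rightarrow> 'a \<Rightarrow> real" where
  "inf_frac_laplacian s \<phi> x =
     (if grad \<phi> x \<noteq> 0 then
        (let \<zeta> = grad \<phi> x /\<^sub>R norm (grad \<phi> x) in
          frac_const s * (LBINT \<eta>:{0<..}.
            (\<phi> (x + \<eta> *\<^sub>R \<zeta>) + \<phi> (x - \<eta> *\<^sub>R \<zeta>) - 2 * \<phi> x) / \<eta> powr (1 + 2 * s)))
      else
        frac_const s * (SUP y\<in>sphere 0 1. LBINT \<eta>:{0<..}.
            (\<phi> (x + \<eta> *\<^sub>R y) - \<phi> x) / \<eta> powr (1 + 2 * s))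
      + frac_const s * (INF y\<in>sphere 0 1. LBINT \<eta>:{0<..}.
            (\<phi> (x - \<eta> *\<^sub>R y) - \<phi> x) / \<eta> powr (1 + 2 * s)))"

text \<open>The conditions on \<^term>\<open>\<lambda>y. u (y, t)\<close> say that the operator is defined at \<^term>\<open>x\<close>.\<close>

definition classical_solution ::
    "real \<Rightarrow> ('a::euclidean_space \<Rightarrow> real) \<Rightarrow> ('a \<times> real \<Rightarrow> real) \<Rightarrow> bool" where
  "classical_solution s u\<^sub>0 u \<longleftrightarrow>
     (\<forall>x. \<forall>t>0. bounded (range (\<lambda>y. u (y, t))) \<and> C11_at (\<lambda>y. u (y, t)) x \<and>
        ((\<lambda>\<tau>. u (x, \<tau>)) has_real_derivative inf_frac_laplacian s (\<lambda>y. u (y, t)) x) (at t)) \<and>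
     (\<forall>x. u (x, 0) = u\<^sub>0 x)"

text \<open>The normalisation is the one for which the heat kernel below has total mass 1 and
  the symbol of the one-dimensional fractional Laplacian is \<^term>\<open>\<bar>\<xi>\<bar> powr (2 * s)\<close>.\<close>

definition inverse_fourier :: "(real \<Rightarrow> complex) \<Rightarrow> real \<Rightarrow> complex" where
  "inverse_fourier g x = (LBINT \<xi>. cis (x * \<xi>) * g \<xi>) / (2 * pi)"

text \<open>The inverse Fourier transform is real-valued here, since the transformed function is real and even.\<close>

definition heat_kernel :: "real \<Rightarrow> real \<Rightarrow> real \<Rightarrow> real" where
  "heat_kernel s x t = Re (inverse_fourier (\<lambda>\<xi>. of_real (exp (- (\<bar>\<xi>\<bar> powr (2 * s)) * t))) x)"

end

theory Submission
  imports Defs "HOL-Probability.Probability"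
begin

text \<open>The symbol \<open>exp (- t \<bar>\<xi>\<bar>\<^sup>2\<^sup>s)\<close> is a limit of nonnegative combinations of Gaussians, since \<open>1 - (1 - z)\<^sup>s\<close>
  has nonnegative Taylor coefficients; hence the heat kernel is nonnegative, and Gaussian-regularised
  Fourier inversion shows that it is a probability density with characteristic function equal to
  the symbol. On cosines the generator and the semigroup act by multiplication. Superposing cosines
  and passing to limits gives \<open>S\<^sub>t f - f = \<integral>\<^sub>0\<^sup>t S\<^sub>r (L f) dr\<close> for every bounded \<open>C\<^sup>2\<close> function \<open>f\<close>, without any
  decay estimate for the kernel. The operators \<open>S\<^sub>t\<close> and \<open>L\<close> commute with derivatives and with each other, so
  \<open>(x, t) \<mapsto> S\<^sub>t U (x)\<close> is smooth up to \<open>t = 0\<close>. As \<open>S\<^sub>t U\<close> is again nondecreasing, the infinity fractional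
  Laplacian of \<open>x \<mapsto> S\<^sub>t U (x\<^sub>1)\<close> reduces to \<open>L\<close> also at critical points.\<close>

section \<open>The jump measure\<close>

text \<open>Two obstacles shape the proof. The kernel is given only by an oscillatory integral, from
  which neither sign nor integrability can be read off. Nonnegativity is therefore proved in a class
  of functions closed under just those operations that build the symbol from Gaussians, and
  integrability then follows by monotone convergence. The other obstacle is the datum: a nonconstant
  bounded monotone function is never integrable, so Fourier superposition does not apply to it
  directly. Gaussian cutoff and mollification repair this. The limit is taken in the time-integrated
  equation, because it contains no time derivative and so survives bounded pointwise convergence;
  the only estimate that must be uniform is the one for second differences, which controls the
  generator. Smoothness is never obtained by differentiating the kernel: space derivatives fall on
  the datum and time derivatives become applications of the generator, and both operations preserve
  bounded smooth functions.\<close>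

lemma integrable_pair_bound:
  fixes F :: "'a \<times> 'b \<Rightarrow> real"
  assumes "sigma_finite_measure M" "sigma_finite_measure N"
    and a: "integrable M a" and b: "integrable N b"
    and F[measurable]: "F \<in> borel_measurable (M \<Otimes>\<^sub>M N)"
    and le: "\<And>x y. x \<in> space M \<Longrightarrow> y \<in> space N \<Longrightarrow> \<bar>F (x, y)\<bar> \<le> a x * b y"
  shows "integrable (M \<Otimes>\<^sub>M N) F"
proof -
  interpret M: sigma_finite_measure M by fact
  interpret N: sigma_finite_measure N by fact
  interpret P: pair_sigma_finite M N ..
  have [measurable]: "a \<in> borel_measurable M" "b \<in> borel_measurable N"
    using a b by auto
  have "integrable (M \<Otimes>\<^sub>M N) (\<lambda>p. \<bar>a (fst p)\<bar> * \<bar>b (snd p)\<bar>)"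
    by (rule P.Fubini_integrable) (use a b in \<open>auto simp: abs_mult\<close>)
  then show ?thesis
  proof (rule Bochner_Integration.integrable_bound)
    show "AE p in M \<Otimes>\<^sub>M N. norm (F p) \<le> norm (\<bar>a (fst p)\<bar> * \<bar>b (snd p)\<bar>)"
    proof (rule AE_I2)
      fix p assume p: "p \<in> space (M \<Otimes>\<^sub>M N)"
      then have "\<bar>F (fst p, snd p)\<bar> \<le> a (fst p) * b (snd p)"
        by (intro le) (auto simp: space_pair_measure)
      also have "\<dots> \<le> \<bar>a (fst p)\<bar> * \<bar>b (snd p)\<bar>"
        by (metis abs_ge_self abs_mult)
      finally show "norm (F p) \<le> norm (\<bar>a (fst p)\<bar> * \<bar>b (snd p)\<bar>)" by simp
    qed
  qed simp
qed

text \<open>For a nonnegative integrand, existence of the gauge integral already gives absolute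
  integrability. This transfers improper integrals evaluated through \<open>has_integral\<close> to
  Lebesgue integrals.\<close>

lemma integrable_nonneg_has_integral:
  fixes f :: "real \<Rightarrow> real"
  assumes "(f has_integral I) S" "\<And>x. x \<in> S \<Longrightarrow> 0 \<le> f x" "f \<in> borel_measurable borel" "S \<in> sets borel"
  shows "set_integrable lborel S f" "(LBINT x:S. f x) = I"
proof -
  have "f absolutely_integrable_on S"
    using assms by (intro nonnegative_absolutely_integrable_1) auto
  then have 1: "set_integrable lebesgue S f" .
  show 2: "set_integrable lborel S f"
    using 1 assms(3,4) unfolding set_integrable_def by (subst (asm) integrable_completion) auto
  show "(LBINT x:S. f x) = I"
    using set_borel_integral_eq_integral(2)[OF 2] assms(1) by (simp add: integral_unique)
qed

text \<open>The substitution \<open>x = sqrt (2 * u)\<close> turns the integrand into a multiple of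
  the Gamma integrand with parameter \<open>(p + 1) / 2\<close>.\<close>

lemma gauss_powr_integral:
  fixes p :: real
  assumes "p > -1"
  shows "set_integrable lborel {0<..} (\<lambda>x. x powr p * exp (- x\<^sup>2 / 2))"
    and "(LBINT x:{0<..}. x powr p * exp (- x\<^sup>2 / 2)) = 2 powr ((p - 1) / 2) * Gamma ((p + 1) / 2)"
proof -
  let ?q = "(p + 1) / 2"
  let ?c = "2 powr ((p - 1) / 2)"
  have "((\<lambda>t. t powr (?q - 1) / exp t) has_integral Gamma ?q) {0..}"
    using assms by (intro Gamma_integral_real) auto
  then have "((\<lambda>t. t powr (?q - 1) / exp t) has_integral Gamma ?q) {0<..}"
    by (subst (asm) has_integral_spike_set_eq[where T="{0<..}"]) (auto intro: negligible_subset[of "{0}"])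
  from integrable_nonneg_has_integral[OF this]
  have G: "set_integrable lborel {0<..} (\<lambda>t. t powr (?q - 1) / exp t)"
    "(LBINT t:{0<..}. t powr (?q - 1) / exp t) = Gamma ?q"
    by auto
  have e: "einterval 0 \<infinity> = {0<..}"
    by (auto simp: einterval_def)
  \<comment> \<open>The last factor on the left is the Jacobian of the substitution; it lowers the
    exponent from \<open>p / 2\<close> to \<open>(p - 1) / 2\<close>.\<close>
  have eq: "(sqrt (2 * u)) powr p * exp (- (sqrt (2 * u))\<^sup>2 / 2) * (1 / sqrt (2 * u)) =
      ?c * (u powr (?q - 1) / exp u)" if "u > 0" for u
  proof -
    have "1 / sqrt (2 * u) = (2 * u) powr (- (1 / 2))"
      using that by (simp add: powr_minus_divide powr_half_sqrt)
    moreover have "(sqrt (2 * u)) powr p = (2 * u) powr (p / 2)"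
      using that by (simp add: powr_half_sqrt[symmetric] powr_powr)
    ultimately have "(sqrt (2 * u)) powr p * (1 / sqrt (2 * u)) = (2 * u) powr (p / 2 + - (1 / 2))"
      by (simp only: powr_add)
    also have "p / 2 + - (1 / 2) = (p - 1) / 2" by (simp add: field_simps)
    also have "(2 * u) powr ((p - 1) / 2) = ?c * u powr ((p - 1) / 2)"
      using that by (simp add: powr_mult)
    also have "(p - 1) / 2 = ?q - 1" by (simp add: field_simps)
    finally show ?thesis
      using that by (simp add: exp_minus field_simps)
  qed
  have I: "set_integrable lborel (einterval 0 \<infinity>)
     (\<lambda>u. (sqrt (2 * u)) powr p * exp (- (sqrt (2 * u))\<^sup>2 / 2) * (1 / sqrt (2 * u)))"
  proof -
    have "set_integrable lborel {0<..} (\<lambda>u. ?c * (u powr (?q - 1) / exp u))"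
      using G(1) by (intro set_integrable_mult_right) auto
    then show ?thesis
      unfolding e by (rule set_integrable_cong[THEN iffD1, rotated -1]) (use eq in auto)
  qed
  have lim0: "((ereal \<circ> (\<lambda>u. sqrt (2 * u)) \<circ> real_of_ereal) \<longlongrightarrow> 0) (at_right 0)"
    unfolding zero_ereal_def ereal_tendsto_simps1 ereal_tendsto_simps2
    by (auto intro!: tendsto_eq_intros)
  have lim1: "((ereal \<circ> (\<lambda>u. sqrt (2 * u)) \<circ> real_of_ereal) \<longlongrightarrow> \<infinity>) (at_left \<infinity>)"
  proof -
    have "filterlim (\<lambda>u::real. sqrt (2 * u)) at_top at_top"
      by real_asymp
    then show ?thesis
      by (auto simp: ereal_tendsto_simps tendsto_PInfty_eq_at_top)
  qed
  have d: "((\<lambda>u. sqrt (2 * u)) has_real_derivative 1 / sqrt (2 * x)) (at x)" if "x > 0" for x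
    using that by (auto intro!: derivative_eq_intros simp: field_simps)
  have S: "set_integrable lborel (einterval 0 \<infinity>) (\<lambda>x. x powr p * exp (- x\<^sup>2 / 2))"
     "(LBINT x=0..\<infinity>. x powr p * exp (- x\<^sup>2 / 2)) =
      (LBINT u=0..\<infinity>. (sqrt (2 * u)) powr p * exp (- (sqrt (2 * u))\<^sup>2 / 2) * (1 / sqrt (2 * u)))"
    by (rule interval_integral_substitution_nonneg[where g="\<lambda>u. sqrt (2 * u)" and g'="\<lambda>u. 1 / sqrt (2 * u)"
          and f="\<lambda>x. x powr p * exp (- x\<^sup>2 / 2)" and a=0 and b=\<infinity>, OF _ _ _ _ _ _ lim0 lim1 I];
        use d in \<open>auto intro!: continuous_intros\<close>)+
  show "set_integrable lborel {0<..} (\<lambda>x. x powr p * exp (- x\<^sup>2 / 2))"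
    using S(1) by (simp add: e)
  have "(LBINT x:{0<..}. x powr p * exp (- x\<^sup>2 / 2)) =
     (LBINT u:{0<..}. (sqrt (2 * u)) powr p * exp (- (sqrt (2 * u))\<^sup>2 / 2) * (1 / sqrt (2 * u)))"
    using S(2) by (simp add: interval_lebesgue_integral_def e)
  also have "\<dots> = (LBINT u:{0<..}. ?c * (u powr (?q - 1) / exp u))"
    by (rule set_lebesgue_integral_cong) (use eq in auto)
  also have "\<dots> = ?c * Gamma ?q"
    using G(2) by (simp del: times_divide_eq_right)
  finally show "(LBINT x:{0<..}. x powr p * exp (- x\<^sup>2 / 2)) = ?c * Gamma ?q" .
qed

text \<open>Putting the singular weight into a measure makes Fubini and dominated convergence
  directly applicable. For \<open>0 < s\<close> its mass near 0 is infinite, so integrands have to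
  be small there.\<close>

definition levy_measure :: "real \<Rightarrow> real measure" where
  "levy_measure s = density lborel (\<lambda>\<eta>. ennreal (indicator {0<..} \<eta> / \<eta> powr (1 + 2 * s)))"

lemma sets_levy_measure[simp, measurable_cong]: "sets (levy_measure s) = sets borel"
  by (simp add: levy_measure_def)

lemma space_levy_measure[simp]: "space (levy_measure s) = UNIV"
  by (simp add: levy_measure_def)

lemma sigma_finite_levy_measure: "sigma_finite_measure (levy_measure s)"
  unfolding levy_measure_def
  by (subst sigma_finite_measure.sigma_finite_iff_density_finite[OF lborel.sigma_finite_measure_axioms]) auto

lemma integral_levy_measure:
  assumes "f \<in> borel_measurable borel"
  shows "integral\<^sup>L (levy_measure s) f = (LBINT \<eta>:{0<..}. f \<eta> / \<eta> powr (1 + 2 * s))"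
  unfolding levy_measure_def set_lebesgue_integral_def using assms
  by (subst integral_density) auto

lemma integrable_levy_measure_iff:
  assumes "f \<in> borel_measurable borel"
  shows "integrable (levy_measure s) f \<longleftrightarrow> set_integrable lborel {0<..} (\<lambda>\<eta>. f \<eta> / \<eta> powr (1 + 2 * s))"
  unfolding levy_measure_def set_integrable_def using assms
  by (subst integrable_density) auto

lemma AE_levy_measure: "AE \<eta> in levy_measure s. 0 < \<eta>"
  unfolding levy_measure_def by (subst AE_density) (auto simp: indicator_def)

abbreviation trunc_sq :: "real \<Rightarrow> real" where
  "trunc_sq \<eta> \<equiv> min 1 (\<eta>\<^sup>2)"

text \<open>Near 0 the exponent is \<open>1 - 2 * s > - 1\<close> because \<open>s < 1\<close>, and
  at infinity it is \<open>- (1 + 2 * s) < - 1\<close> because \<open>0 < s\<close>. A multiple of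
  \<open>trunc_sq\<close> is the standard majorant for everything integrated against the jump
  measure.\<close>

lemma integrable_trunc_sq:
  assumes "0 < s" "s < 1"
  shows "integrable (levy_measure s) trunc_sq"
proof -
  have A: "set_integrable lborel {0..1} (\<lambda>\<eta>. \<eta> powr (1 - 2 * s))"
    by (rule integrable_nonneg_has_integral(1)[OF has_integral_powr_from_0]) (use assms in auto)
  have B: "set_integrable lborel {1..} (\<lambda>\<eta>. \<eta> powr (- (1 + 2 * s)))"
    by (rule integrable_nonneg_has_integral(1)[OF has_integral_powr_to_inf]) (use assms in auto)
  have A': "set_integrable lborel {0<..1} (\<lambda>\<eta>. trunc_sq \<eta> / \<eta> powr (1 + 2 * s))"
  proof (rule set_integrable_cong[THEN iffD1, OF refl refl _ set_integrable_subset[OF A]])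
    fix \<eta> :: real assume "\<eta> \<in> {0<..1}"
    then have e: "0 < \<eta>" "\<eta> \<le> 1" by auto
    then have "min 1 (\<eta>\<^sup>2) = \<eta> powr 2"
      by (auto simp: min_def power_le_one_iff) (smt (verit) power_le_one)
    moreover have "\<eta> powr (1 - 2 * s) = \<eta> powr (2 - (1 + 2 * s))"
      by simp
    ultimately show "\<eta> powr (1 - 2 * s) = trunc_sq \<eta> / \<eta> powr (1 + 2 * s)"
      by (simp only: powr_diff)
  qed auto
  have B': "set_integrable lborel {1..} (\<lambda>\<eta>. trunc_sq \<eta> / \<eta> powr (1 + 2 * s))"
  proof (rule set_integrable_cong[THEN iffD1, OF refl refl _ B])
    fix \<eta> :: real assume "\<eta> \<in> {1..}"
    then have "min 1 (\<eta>\<^sup>2) = 1" by (simp add: min_def)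
    then show "\<eta> powr (- (1 + 2 * s)) = trunc_sq \<eta> / \<eta> powr (1 + 2 * s)"
      by (simp only: powr_minus_divide)
  qed
  have "{0<..} = {0<..1::real} \<union> {1..}" by auto
  then have "set_integrable lborel {0<..} (\<lambda>\<eta>. trunc_sq \<eta> / \<eta> powr (1 + 2 * s))"
    using set_integrable_Un[OF A' B'] by simp
  then show ?thesis
    by (subst integrable_levy_measure_iff) auto
qed

lemma integrable_levy_bound:
  assumes "0 < s" "s < 1" "f \<in> borel_measurable borel" "\<And>\<eta>. \<eta> > 0 \<Longrightarrow> \<bar>f \<eta>\<bar> \<le> C * trunc_sq \<eta>"
  shows "integrable (levy_measure s) f"
proof (rule Bochner_Integration.integrable_bound)
  show "integrable (levy_measure s) (\<lambda>\<eta>. C * trunc_sq \<eta>)"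
    using integrable_trunc_sq[OF assms(1,2)] by simp
  show "AE \<eta> in levy_measure s. norm (f \<eta>) \<le> norm (C * trunc_sq \<eta>)"
    using AE_levy_measure by eventually_elim (metis abs_ge_self assms(4) order_trans real_norm_def)
qed (use assms(3) in simp)

lemma one_minus_cos_bounds: "0 \<le> 1 - cos (x::real)" "1 - cos x \<le> 2" "1 - cos x \<le> x\<^sup>2"
proof -
  show "0 \<le> 1 - cos x" by simp
  show "1 - cos x \<le> 2" using cos_ge_minus_one[of x] by linarith
  have "1 - cos x = 2 * (sin (x / 2))\<^sup>2"
    using cos_double_sin[of "x / 2"] by simp
  also have "(sin (x / 2))\<^sup>2 \<le> (x / 2)\<^sup>2"
    using abs_sin_x_le_abs_x[of "x / 2"] by (intro abs_le_square_iff[THEN iffD1])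
  finally show "1 - cos x \<le> x\<^sup>2" by (simp add: power_divide) (smt (verit) zero_le_power2)
qed

text \<open>The quadratic bound serves for small jumps and the bound 2 for large ones. The factor
  \<open>2 + \<xi>\<^sup>2\<close> reappears later as the weight against which a superposition of
  cosines must be integrable.\<close>

lemma one_minus_cos_mult_bound: "\<bar>1 - cos (\<xi> * \<eta>)\<bar> \<le> (2 + \<xi>\<^sup>2) * trunc_sq (\<eta>::real)"
proof (cases "\<eta>\<^sup>2 \<le> 1")
  case True
  have "1 - cos (\<xi> * \<eta>) \<le> \<xi>\<^sup>2 * \<eta>\<^sup>2"
    using one_minus_cos_bounds(3)[of "\<xi> * \<eta>"] by (simp add: power_mult_distrib)
  also have "\<dots> \<le> (2 + \<xi>\<^sup>2) * \<eta>\<^sup>2" by (simp add: distrib_right)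
  finally show ?thesis using True one_minus_cos_bounds(1)[of "\<xi> * \<eta>"] by (simp add: min_def)
next
  case False
  have "1 - cos (\<xi> * \<eta>) \<le> 2 + \<xi>\<^sup>2"
    using one_minus_cos_bounds(2)[of "\<xi> * \<eta>"] by (smt (verit) zero_le_power2)
  then show ?thesis using False one_minus_cos_bounds(1)[of "\<xi> * \<eta>"] by (simp add: min_def)
qed

section \<open>The normalising constant\<close>

text \<open>This is the real part of the characteristic function of the standard normal law.\<close>

lemma integral_std_normal_cos:
  "integrable lborel (\<lambda>x. std_normal_density x * cos (a * x))"
  "(LBINT x. std_normal_density x * cos (a * x)) = exp (- a\<^sup>2 / 2)"
proof -
  interpret N: real_distribution std_normal_distribution by (rule real_dist_normal_dist)
  have i: "integrable std_normal_distribution (\<lambda>x. iexp (a * x))"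
    by (rule N.integrable_iexp) auto
  have "integrable std_normal_distribution (\<lambda>x. Re (iexp (a * x)))"
    using i by (rule integrable_Re)
  then have j: "integrable std_normal_distribution (\<lambda>x. cos (a * x))"
    by (simp add: Re_exp)
  then show "integrable lborel (\<lambda>x. std_normal_density x * cos (a * x))"
    by (subst (asm) integrable_density) auto
  have "(LBINT x. std_normal_density x * cos (a * x)) = (LINT x|std_normal_distribution. cos (a * x))"
    by (subst integral_density) auto
  also have "\<dots> = (LINT x|std_normal_distribution. Re (iexp (a * x)))"
    by (simp add: Re_exp)
  also have "\<dots> = Re (char std_normal_distribution a)"
    unfolding char_def using i by (rule integral_Re)
  also have "\<dots> = exp (- a\<^sup>2 / 2)"
    by (simp add: char_std_normal_distribution)
  finally show "(LBINT x. std_normal_density x * cos (a * x)) = exp (- a\<^sup>2 / 2)" .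
qed

text \<open>Integration by parts: \<open>?F\<close> is the boundary term. It vanishes at 0 since
  \<open>1 - exp (- \<eta>\<^sup>2 / 2)\<close> is of order \<open>\<eta>\<^sup>2\<close> and
  \<open>s < 1\<close>, and at infinity since \<open>0 < s\<close>. What remains is a Gaussian power
  integral with exponent \<open>1 - 2 * s\<close>.\<close>

lemma integral_levy_gauss:
  assumes s: "0 < s" "s < 1"
  shows "integral\<^sup>L (levy_measure s) (\<lambda>\<eta>. 1 - exp (- \<eta>\<^sup>2 / 2)) = 2 powr (- s) * Gamma (1 - s) / (2 * s)"
proof -
  let ?g = "\<lambda>\<eta>::real. (1 - exp (- \<eta>\<^sup>2 / 2)) / \<eta> powr (1 + 2 * s)"
  let ?h = "\<lambda>\<eta>::real. \<eta> powr (1 - 2 * s) * exp (- \<eta>\<^sup>2 / 2)"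
  let ?F = "\<lambda>\<eta>::real. - ((1 - exp (- \<eta>\<^sup>2 / 2)) * \<eta> powr (- 2 * s)) / (2 * s)"
  have b: "\<bar>1 - exp (- \<eta>\<^sup>2 / 2)\<bar> \<le> 1 * trunc_sq \<eta>" for \<eta> :: real
  proof -
    have "1 - exp (- \<eta>\<^sup>2 / 2) \<le> \<eta>\<^sup>2"
      using exp_ge_add_one_self[of "- \<eta>\<^sup>2 / 2"] zero_le_power2[of \<eta>] by linarith
    then show ?thesis by (auto simp: min_def)
  qed
  have "integrable (levy_measure s) (\<lambda>\<eta>. 1 - exp (- \<eta>\<^sup>2 / 2))"
    by (rule integrable_levy_bound[OF s _ b]) auto
  then have Ig: "set_integrable lborel {0<..} ?g"
    by (subst (asm) integrable_levy_measure_iff) auto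
  have e1: "(1 - 2 * s - 1) / 2 = - s" "(1 - 2 * s + 1) / 2 = 1 - s" by (simp_all add: field_simps)
  have Ih: "set_integrable lborel {0<..} ?h" "(LBINT x:{0<..}. ?h x) = 2 powr (- s) * Gamma (1 - s)"
    using gauss_powr_integral[of "1 - 2 * s", unfolded e1] s by auto
  have e: "einterval 0 \<infinity> = {0<..}"
    by (auto simp: einterval_def)
  have d: "(?F has_real_derivative ?g x - ?h x / (2 * s)) (at x)" if "x > 0" for x
  proof -
    have p1: "x powr (- 2 * s - 1) = 1 / x powr (1 + 2 * s)"
    proof -
      have "- 2 * s - 1 = - (1 + 2 * s)" by simp
      then show ?thesis by (simp only: powr_minus_divide)
    qed
    have p2: "x * x powr (- 2 * s) = x powr (1 - 2 * s)"
      using that powr_mult_base[of x "- 2 * s"] by simp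
    have "(?F has_real_derivative - ((x * exp (- x\<^sup>2 / 2)) * x powr (- 2 * s)
        + (- 2 * s) * x powr (- 2 * s - 1) * (1 - exp (- x\<^sup>2 / 2))) / (2 * s)) (at x)"
      using that s by (auto intro!: derivative_eq_intros simp: field_simps)
    also have "- ((x * exp (- x\<^sup>2 / 2)) * x powr (- 2 * s)
        + (- 2 * s) * x powr (- 2 * s - 1) * (1 - exp (- x\<^sup>2 / 2))) / (2 * s)
        = x powr (- 2 * s - 1) * (1 - exp (- x\<^sup>2 / 2))
         - ((x * x powr (- 2 * s)) * exp (- x\<^sup>2 / 2)) / (2 * s)"
    proof -
      have "- (x * E * P + (- 2 * s) * Q * D) / (2 * s) = Q * D - ((x * P) * E) / (2 * s)" for E P Q D
        using s by (simp add: field_simps)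
      then show ?thesis .
    qed
    also have "\<dots> = ?g x - ?h x / (2 * s)"
      unfolding p1 p2 by simp
    finally show ?thesis .
  qed
  have I: "set_integrable lborel (einterval 0 \<infinity>) (\<lambda>x. ?g x - ?h x / (2 * s))"
    unfolding e using Ig Ih(1) by (intro set_integral_diff set_integrable_divide) auto
  have "(LBINT x=0..\<infinity>. ?g x - ?h x / (2 * s)) = 0 - 0"
  proof (rule interval_integral_FTC_integrable[where F="?F", OF _ _ _ I])
    have "(?F \<longlongrightarrow> 0) (at_right 0)" using s by real_asymp
    then show "((?F \<circ> real_of_ereal) \<longlongrightarrow> 0) (at_right 0)"
      unfolding zero_ereal_def ereal_tendsto_simps1 .
    have "(?F \<longlongrightarrow> 0) at_top" using s by real_asymp
    then show "((?F \<circ> real_of_ereal) \<longlongrightarrow> 0) (at_left \<infinity>)"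
      unfolding ereal_tendsto_simps1 .
    show "(?F has_vector_derivative ?g x - ?h x / (2 * s)) (at x)" if "0 < ereal x" for x
      using d that by (simp add: has_real_derivative_iff_has_vector_derivative)
    show "isCont (\<lambda>x. ?g x - ?h x / (2 * s)) x" if "0 < ereal x" for x
      using that s by (auto intro!: continuous_intros)
  qed auto
  then have "(LBINT x:{0<..}. ?g x - ?h x / (2 * s)) = 0"
    by (simp add: interval_lebesgue_integral_def e)
  moreover have "(LBINT x:{0<..}. ?g x - ?h x / (2 * s)) =
      (LBINT x:{0<..}. ?g x) - (LBINT x:{0<..}. ?h x) / (2 * s)"
    using Ig Ih(1) by (subst set_integral_diff) (auto intro!: set_integrable_divide)
  ultimately show ?thesis
    using Ih(2) by (subst integral_levy_measure) auto
qed

text \<open>An absolute moment of the standard normal law; by evenness it is twice a half-line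
  integral with exponent \<open>2 * s\<close>.\<close>

lemma integral_std_normal_powr:
  assumes "0 < s"
  shows "integrable lborel (\<lambda>x. std_normal_density x * \<bar>x\<bar> powr (2 * s))"
    "(LBINT x. std_normal_density x * \<bar>x\<bar> powr (2 * s)) = 2 powr s * Gamma (1/2 + s) / sqrt pi"
proof -
  let ?h = "\<lambda>\<eta>::real. \<eta> powr (2 * s) * exp (- \<eta>\<^sup>2 / 2)"
  let ?c = "1 / sqrt (2 * pi)"
  have h: "set_integrable lborel {0<..} ?h" "(LBINT x:{0<..}. ?h x) = 2 powr (s - 1/2) * Gamma (1/2 + s)"
  proof -
    have e: "(2 * s - 1) / 2 = s - 1/2" "(2 * s + 1) / 2 = 1/2 + s" by (simp_all add: field_simps)
    show "set_integrable lborel {0<..} ?h" "(LBINT x:{0<..}. ?h x) = 2 powr (s - 1/2) * Gamma (1/2 + s)"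
      using gauss_powr_integral[of "2 * s", unfolded e] assms by auto
  qed
  \<comment> \<open>The two half-lines differ in the point 0, where \<open>0 powr (2 * s)\<close> is
    0.\<close>
  have eq: "indicator {0..} x *\<^sub>R (std_normal_density x * \<bar>x\<bar> powr (2 * s)) =
      ?c * (indicator {0<..} x *\<^sub>R ?h x)" for x :: real
    using assms by (auto simp: indicator_def std_normal_density_def)
  have "has_bochner_integral lborel (\<lambda>x. ?c * (indicator {0<..} x *\<^sub>R ?h x))
     (?c * (2 powr (s - 1/2) * Gamma (1/2 + s)))"
    using has_bochner_integral_mult_right[of ?c lborel "\<lambda>x. indicator {0<..} x *\<^sub>R ?h x"] h
    by (simp only: has_bochner_integral_iff set_integrable_def set_lebesgue_integral_def)
  then have "has_bochner_integral lborel (\<lambda>x. std_normal_density x * \<bar>x\<bar> powr (2 * s))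
     (2 *\<^sub>R (?c * (2 powr (s - 1/2) * Gamma (1/2 + s))))"
    by (intro has_bochner_integral_even_function)
      (simp_all only: eq, simp_all add: std_normal_density_def)
  moreover have "2 *\<^sub>R (?c * (2 powr (s - 1/2) * Gamma (1/2 + s))) = 2 powr s * Gamma (1/2 + s) / sqrt pi"
  proof -
    have "2 powr (s - 1/2) = 2 powr s / sqrt 2"
      by (simp add: powr_diff powr_half_sqrt)
    moreover have "2 / (sqrt (2 * pi) * sqrt 2) = 1 / sqrt pi"
    proof -
      have "sqrt (2 * pi) * sqrt 2 = 2 * sqrt pi"
        by (simp add: real_sqrt_mult)
      then show ?thesis by simp
    qed
    moreover have "2 *\<^sub>R (?c * (P / sqrt 2 * G)) = 2 / (sqrt (2 * pi) * sqrt 2) * (P * G)" for P G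
      by (simp add: field_simps)
    ultimately show ?thesis by (simp only:) simp
  qed
  ultimately show "integrable lborel (\<lambda>x. std_normal_density x * \<bar>x\<bar> powr (2 * s))"
    "(LBINT x. std_normal_density x * \<bar>x\<bar> powr (2 * s)) = 2 powr s * Gamma (1/2 + s) / sqrt pi"
    by (auto simp: has_bochner_integral_iff)
qed

text \<open>The substitution \<open>\<eta> = y / \<bar>\<xi>\<bar>\<close> works because the jump
  density is homogeneous of degree \<open>- (1 + 2 * s)\<close>: the density contributes
  \<open>1 + 2 * s\<close> powers of \<open>\<bar>\<xi>\<bar>\<close> and the Jacobian removes
  one.\<close>

lemma integral_levy_cos_scaling:
  fixes \<xi> :: real
  shows "integral\<^sup>L (levy_measure s) (\<lambda>\<eta>. 1 - cos (\<xi> * \<eta>)) =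
    \<bar>\<xi>\<bar> powr (2 * s) * integral\<^sup>L (levy_measure s) (\<lambda>\<eta>. 1 - cos \<eta>)"
proof (cases "\<xi> = 0")
  case False
  define a where "a = \<bar>\<xi>\<bar>"
  have a: "a > 0" using False by (simp add: a_def)
  have c: "cos (\<xi> * \<eta>) = cos (a * \<eta>)" for \<eta>
    by (cases "\<xi> \<ge> 0") (auto simp: a_def)
  have eq: "indicator {0<..} (0 + (1/a) * y) *\<^sub>R ((1 - cos (a * (0 + (1/a) * y))) / (0 + (1/a) * y) powr (1 + 2 * s)) =
     a powr (1 + 2 * s) * (indicator {0<..} y *\<^sub>R ((1 - cos y) / y powr (1 + 2 * s)))" for y
    using a by (auto simp: indicator_def powr_divide zero_less_divide_iff)
  have "integral\<^sup>L (levy_measure s) (\<lambda>\<eta>. 1 - cos (\<xi> * \<eta>)) =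
     (LBINT \<eta>. indicator {0<..} \<eta> *\<^sub>R ((1 - cos (a * \<eta>)) / \<eta> powr (1 + 2 * s)))"
    by (subst integral_levy_measure) (auto simp: set_lebesgue_integral_def c)
  also have "\<dots> = \<bar>1/a\<bar> *\<^sub>R (LBINT y. a powr (1 + 2 * s) * (indicator {0<..} y *\<^sub>R ((1 - cos y) / y powr (1 + 2 * s))))"
    by (subst lborel_integral_real_affine[where t=0 and c="1/a"]) (use a in \<open>simp_all only: eq, simp\<close>)
  also have "\<dots> = (1/a) * a powr (1 + 2 * s) * integral\<^sup>L (levy_measure s) (\<lambda>\<eta>. 1 - cos \<eta>)"
    using a unfolding Bochner_Integration.integral_mult_right_zero
    by (subst integral_levy_measure) (auto simp: set_lebesgue_integral_def)
  also have "(1/a) * a powr (1 + 2 * s) = a powr (2 * s)"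
    using a by (simp add: powr_add)
  finally show ?thesis by (simp add: a_def)
qed simp

text \<open>The constant is found by averaging over a standard normal \<open>\<xi>\<close>, which turns both sides
  into Gamma integrals.\<close>

lemma frac_const_levy_cos:
  assumes s: "0 < s" "s < 1"
  shows "frac_const s * (2 * integral\<^sup>L (levy_measure s) (\<lambda>\<eta>. 1 - cos (\<xi> * \<eta>))) = \<bar>\<xi>\<bar> powr (2 * s)"
proof -
  interpret V: sigma_finite_measure "levy_measure s" by (rule sigma_finite_levy_measure)
  interpret P: pair_sigma_finite lborel "levy_measure s" ..
  define J where "J = integral\<^sup>L (levy_measure s) (\<lambda>\<eta>. 1 - cos \<eta>)"
  let ?n = std_normal_density
  have n2: "integrable lborel (\<lambda>x. ?n x * (2 + x\<^sup>2))"
    using integrable_std_normal_moment[of 2] integrable_std_normal_moment[of 0]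
    by (simp add: distrib_left)
  have int: "integrable (lborel \<Otimes>\<^sub>M levy_measure s) (\<lambda>(x, \<eta>). ?n x * (1 - cos (x * \<eta>)))"
  proof (rule integrable_pair_bound[OF _ _ n2 integrable_trunc_sq[OF s]])
    show "\<bar>(\<lambda>(x, \<eta>). ?n x * (1 - cos (x * \<eta>))) (x, y)\<bar> \<le> ?n x * (2 + x\<^sup>2) * trunc_sq y" for x y
      using mult_left_mono[OF one_minus_cos_mult_bound[of x y] normal_density_nonneg[of 0 1 x]]
      by (simp add: abs_mult mult.assoc)
  qed (auto intro: sigma_finite_levy_measure lborel.sigma_finite_measure_axioms)
  have "J * (LBINT x. ?n x * \<bar>x\<bar> powr (2 * s)) = (LBINT x. (LINT \<eta>|levy_measure s. ?n x * (1 - cos (x * \<eta>))))"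
  proof -
    have "(LINT \<eta>|levy_measure s. ?n x * (1 - cos (x * \<eta>))) = J * (?n x * \<bar>x\<bar> powr (2 * s))" for x
      by (simp add: integral_levy_cos_scaling[where s=s and \<xi>=x] J_def[symmetric] mult.left_commute)
    then show ?thesis by (simp only: Bochner_Integration.integral_mult_right_zero)
  qed
  also have "\<dots> = (LINT \<eta>|levy_measure s. (LBINT x. ?n x * (1 - cos (x * \<eta>))))"
    using P.Fubini_integral[OF int] by simp
  also have "\<dots> = (LINT \<eta>|levy_measure s. 1 - exp (- \<eta>\<^sup>2 / 2))"
  proof (rule Bochner_Integration.integral_cong[OF refl])
    fix \<eta>
    show "(LBINT x. ?n x * (1 - cos (x * \<eta>))) = 1 - exp (- \<eta>\<^sup>2 / 2)"
      using integral_std_normal_cos[of \<eta>] by (simp add: right_diff_distrib mult.commute[of \<eta>])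
  qed
  finally have E: "J * (2 powr s * Gamma (1/2 + s) / sqrt pi) = 2 powr (- s) * Gamma (1 - s) / (2 * s)"
    using integral_std_normal_powr[OF s(1)] integral_levy_gauss[OF s] by simp
  have G: "Gamma (1/2 + s) > 0" "Gamma (1 - s) > 0"
    using s by (auto intro!: Gamma_real_pos)
  have "4 powr s = 2 powr s * 2 powr s"
    using powr_mult[of 2 2 s] by simp
  moreover have "2 powr s * 2 powr (- s) = (1::real)"
    by (simp add: powr_minus)
  ultimately have "frac_const s * (2 * J) = 1"
  proof -
    assume 4: "4 powr s = 2 powr s * 2 powr s" and 1: "2 powr s * 2 powr (- s) = (1::real)"
    have "frac_const s * (2 * J) = 2 powr s * (2 * s) / Gamma (1 - s) * (J * (2 powr s * Gamma (1/2 + s) / sqrt pi))"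
      unfolding frac_const_def 4 by (simp add: field_simps)
    also have "\<dots> = 2 powr s * 2 powr (- s)"
      unfolding E using s G(2)[THEN less_imp_neq] by (simp add: field_simps)
    finally show ?thesis using 1 by simp
  qed
  then show ?thesis
    unfolding integral_levy_cos_scaling[where s=s and \<xi>=\<xi>] J_def[symmetric]
    by (simp add: mult.left_commute[of _ "\<bar>\<xi>\<bar> powr (2 * s)"])
qed

lemma frac_const_pos: "0 < s \<Longrightarrow> s < 1 \<Longrightarrow> frac_const s > 0"
  unfolding frac_const_def by (intro divide_pos_pos mult_pos_pos Gamma_real_pos) auto

section \<open>Positivity of the symbol\<close>

lemma integral_gauss_cos:
  fixes c x :: real
  assumes "c > 0"
  shows "integrable lborel (\<lambda>\<xi>. cos (x * \<xi>) * exp (- c * \<xi>\<^sup>2))"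
    and "(LBINT \<xi>. cos (x * \<xi>) * exp (- c * \<xi>\<^sup>2)) = sqrt (pi / c) * exp (- x\<^sup>2 / (4 * c))"
proof -
  \<comment> \<open>With this scaling \<open>c * (r * y)\<^sup>2 = y\<^sup>2 / 2\<close>, the
    exponent of the standard normal density.\<close>
  define r where "r = 1 / sqrt (2 * c)"
  have r: "r > 0" "r\<^sup>2 = 1 / (2 * c)" using assms by (auto simp: r_def power_divide)
  have eq: "cos (x * (0 + r * y)) * exp (- c * (0 + r * y)\<^sup>2) = sqrt (2 * pi) * (std_normal_density y * cos ((x * r) * y))" for y
    using r assms by (simp add: std_normal_density_def power_mult_distrib mult_ac)
  have "integrable lborel (\<lambda>y. cos (x * (0 + r * y)) * exp (- c * (0 + r * y)\<^sup>2))"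
    unfolding eq using integral_std_normal_cos(1) by auto
  then show "integrable lborel (\<lambda>\<xi>. cos (x * \<xi>) * exp (- c * \<xi>\<^sup>2))"
    by (subst (asm) lborel_integrable_real_affine_iff) (use r in auto)
  have "(LBINT \<xi>. cos (x * \<xi>) * exp (- c * \<xi>\<^sup>2)) = \<bar>r\<bar> *\<^sub>R (LBINT y. cos (x * (0 + r * y)) * exp (- c * (0 + r * y)\<^sup>2))"
    by (rule lborel_integral_real_affine) (use r in auto)
  also have "\<dots> = (r * sqrt (2 * pi)) * exp (- (x * r)\<^sup>2 / 2)"
    unfolding eq using r integral_std_normal_cos(2)[of "x * r"] by simp
  also have "r * sqrt (2 * pi) = sqrt (pi / c)"
    unfolding r_def by (simp add: real_sqrt_divide real_sqrt_mult)
  also have "- (x * r)\<^sup>2 / 2 = - x\<^sup>2 / (4 * c)"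
    using r by (simp add: power_mult_distrib)
  finally show "(LBINT \<xi>. cos (x * \<xi>) * exp (- c * \<xi>\<^sup>2)) = sqrt (pi / c) * exp (- x\<^sup>2 / (4 * c))" .
qed

text \<open>A damped form of positive definiteness: the cosine transform is nonnegative after
  multiplication by any Gaussian. The damping lets bounded functions that are not integrable, such
  as constants, belong to the class, and it supplies the majorant for limits.\<close>

definition cos_positive :: "(real \<Rightarrow> real) \<Rightarrow> bool" where
  "cos_positive f \<longleftrightarrow> f \<in> borel_measurable borel \<and> bounded (range f) \<and>
     (\<forall>x. \<forall>\<delta>>0. 0 \<le> (LBINT \<xi>. cos (x * \<xi>) * (f \<xi> * exp (- \<delta> * \<xi>\<^sup>2))))"

lemma integrable_exp_sq: "\<delta> > 0 \<Longrightarrow> integrable lborel (\<lambda>\<xi>::real. exp (- \<delta> * \<xi>\<^sup>2))"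
  using integral_gauss_cos(1)[of \<delta> 0] by simp

lemma cos_positive_integrable:
  fixes f :: "real \<Rightarrow> real"
  assumes "f \<in> borel_measurable borel" "bounded (range f)" "\<delta> > 0"
  shows "integrable lborel (\<lambda>\<xi>. cos (x * \<xi>) * (f \<xi> * exp (- \<delta> * \<xi>\<^sup>2)))"
proof -
  obtain B where B: "\<And>\<xi>. \<bar>f \<xi>\<bar> \<le> B" using assms(2) by (auto simp: bounded_iff)
  show ?thesis
  proof (rule Bochner_Integration.integrable_bound[where f="\<lambda>\<xi>. B * exp (- \<delta> * \<xi>\<^sup>2)"])
    show "AE \<xi> in lborel. norm (cos (x * \<xi>) * (f \<xi> * exp (- \<delta> * \<xi>\<^sup>2))) \<le> norm (B * exp (- \<delta> * \<xi>\<^sup>2))"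
    proof (rule AE_I2)
      fix \<xi>
      have "\<bar>cos (x * \<xi>)\<bar> * \<bar>f \<xi>\<bar> \<le> 1 * \<bar>B\<bar>"
        using B[of \<xi>] by (intro mult_mono) auto
      then show "norm (cos (x * \<xi>) * (f \<xi> * exp (- \<delta> * \<xi>\<^sup>2))) \<le> norm (B * exp (- \<delta> * \<xi>\<^sup>2))"
        by (simp add: abs_mult flip: mult.assoc)
    qed
  qed (use assms integrable_exp_sq in auto)
qed

lemma cos_positive_exp_sq: "c \<ge> 0 \<Longrightarrow> cos_positive (\<lambda>\<xi>. exp (- c * \<xi>\<^sup>2))"
  unfolding cos_positive_def
proof (intro conjI allI impI)
  fix x \<delta> :: real assume c: "c \<ge> 0" "\<delta> > 0"
  have "exp (- c * \<xi>\<^sup>2) * exp (- \<delta> * \<xi>\<^sup>2) = exp (- (c + \<delta>) * \<xi>\<^sup>2)" for \<xi> :: real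
    by (simp add: algebra_simps flip: exp_add)
  then show "0 \<le> (LBINT \<xi>. cos (x * \<xi>) * (exp (- c * \<xi>\<^sup>2) * exp (- \<delta> * \<xi>\<^sup>2)))"
    using c integral_gauss_cos(2)[of "c + \<delta>" x] by (simp only:) simp
qed (auto intro!: boundedI[where B=1])

lemma cos_positive_cong: "cos_positive f \<Longrightarrow> (\<And>\<xi>. f \<xi> = g \<xi>) \<Longrightarrow> cos_positive g"
  by (metis ext)

text \<open>The extra Gaussian is absorbed into the damping, whose parameter becomes
  \<open>c + \<delta>\<close>. Products of other kinds would lead to convolutions; polynomials in a
  Gaussian only call for this one.\<close>

lemma cos_positive_mult_exp_sq:
  assumes "cos_positive f" "c \<ge> 0"
  shows "cos_positive (\<lambda>\<xi>. f \<xi> * exp (- c * \<xi>\<^sup>2))"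
  unfolding cos_positive_def
proof (intro conjI allI impI)
  obtain B where B: "\<And>\<xi>. \<bar>f \<xi>\<bar> \<le> B" using assms(1) by (auto simp: bounded_iff cos_positive_def)
  have "\<bar>f \<xi>\<bar> * exp (- c * \<xi>\<^sup>2) \<le> B * 1" for \<xi>
    using B[of \<xi>] assms(2) by (intro mult_mono) (auto intro: order_trans[OF abs_ge_zero])
  then show "bounded (range (\<lambda>\<xi>. f \<xi> * exp (- c * \<xi>\<^sup>2)))"
    by (intro boundedI[where B=B]) (auto simp: abs_mult)
  fix x \<delta> :: real assume "\<delta> > 0"
  then have "0 \<le> (LBINT \<xi>. cos (x * \<xi>) * (f \<xi> * exp (- (c + \<delta>) * \<xi>\<^sup>2)))"
    using assms unfolding cos_positive_def by (meson add_nonneg_pos)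
  moreover have "exp (- (c + \<delta>) * \<xi>\<^sup>2) = exp (- c * \<xi>\<^sup>2) * exp (- \<delta> * \<xi>\<^sup>2)" for \<xi> :: real
    by (simp add: algebra_simps flip: exp_add)
  ultimately show "0 \<le> (LBINT \<xi>. cos (x * \<xi>) * (f \<xi> * exp (- c * \<xi>\<^sup>2) * exp (- \<delta> * \<xi>\<^sup>2)))"
    by (simp only: mult.assoc)
qed (use assms in \<open>auto simp: cos_positive_def\<close>)

lemma cos_positive_add:
  assumes f: "cos_positive f" and g: "cos_positive g"
  shows "cos_positive (\<lambda>\<xi>. f \<xi> + g \<xi>)"
  unfolding cos_positive_def
proof (intro conjI allI impI)
  show "bounded (range (\<lambda>\<xi>. f \<xi> + g \<xi>))"
    using assms by (auto simp: cos_positive_def intro: bounded_plus_comp)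
  fix x \<delta> :: real assume d: "\<delta> > 0"
  have "(LBINT \<xi>. cos (x * \<xi>) * ((f \<xi> + g \<xi>) * exp (- \<delta> * \<xi>\<^sup>2))) =
     (LBINT \<xi>. cos (x * \<xi>) * (f \<xi> * exp (- \<delta> * \<xi>\<^sup>2))) + (LBINT \<xi>. cos (x * \<xi>) * (g \<xi> * exp (- \<delta> * \<xi>\<^sup>2)))"
    unfolding distrib_right distrib_left using assms d
    by (intro Bochner_Integration.integral_add cos_positive_integrable) (auto simp: cos_positive_def)
  then show "0 \<le> (LBINT \<xi>. cos (x * \<xi>) * ((f \<xi> + g \<xi>) * exp (- \<delta> * \<xi>\<^sup>2)))"
    using assms d by (auto simp: cos_positive_def)
qed (use assms in \<open>auto simp: cos_positive_def\<close>)

lemma cos_positive_cmult: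
  assumes f: "cos_positive f" and c: "c \<ge> 0"
  shows "cos_positive (\<lambda>\<xi>. c * f \<xi>)"
  unfolding cos_positive_def
proof (intro conjI allI impI)
  have "bounded ((\<lambda>y. c *\<^sub>R y) ` range f)"
    using f by (intro bounded_scaling) (auto simp: cos_positive_def)
  then show "bounded (range (\<lambda>\<xi>. c * f \<xi>))"
    by (simp add: image_image)
  fix x \<delta> :: real assume d: "\<delta> > 0"
  have "(LBINT \<xi>. cos (x * \<xi>) * (c * f \<xi> * exp (- \<delta> * \<xi>\<^sup>2))) =
     c * (LBINT \<xi>. cos (x * \<xi>) * (f \<xi> * exp (- \<delta> * \<xi>\<^sup>2)))"
    by (simp add: mult_ac flip: Bochner_Integration.integral_mult_right_zero)
  then show "0 \<le> (LBINT \<xi>. cos (x * \<xi>) * (c * f \<xi> * exp (- \<delta> * \<xi>\<^sup>2)))"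
    using f d c by (auto simp: cos_positive_def)
qed (use assms in \<open>auto simp: cos_positive_def\<close>)

lemma cos_positive_sum:
  fixes f :: "nat \<Rightarrow> real \<Rightarrow> real"
  assumes "\<And>i. i < n \<Longrightarrow> cos_positive (f i)"
  shows "cos_positive (\<lambda>\<xi>. \<Sum>i<n. f i \<xi>)"
  using assms
proof (induction n)
  case 0
  show ?case by (simp add: cos_positive_def image_constant_conv)
next
  case (Suc n)
  then show ?case by (simp add: cos_positive_add)
qed

text \<open>The exceptional point \<open>0\<close> is where the binomial series of \<open>(1 - z) powr s\<close> is evaluated on
  its circle of convergence.\<close>

lemma cos_positive_limit:
  assumes f: "\<And>i::nat. cos_positive (f i)"
    and lim: "\<And>\<xi>. \<xi> \<noteq> 0 \<Longrightarrow> (\<lambda>i. f i \<xi>) \<longlonglongrightarrow> g \<xi>"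
    and B: "\<And>i \<xi>. \<xi> \<noteq> 0 \<Longrightarrow> \<bar>f i \<xi>\<bar> \<le> B"
    and g: "g \<in> borel_measurable borel"
  shows "cos_positive g"
  unfolding cos_positive_def
proof (intro conjI allI impI)
  have gB: "\<bar>g \<xi>\<bar> \<le> B" if "\<xi> \<noteq> 0" for \<xi>
    using tendsto_rabs[OF lim[OF that]] by (rule LIMSEQ_le_const2) (use B that in auto)
  then have "\<bar>g \<xi>\<bar> \<le> max B \<bar>g 0\<bar>" for \<xi>
    by (cases "\<xi> = 0") (auto simp: le_max_iff_disj)
  then show "bounded (range g)"
    by (intro boundedI) auto
  fix x \<delta> :: real assume d: "\<delta> > 0"
  have [measurable]: "f i \<in> borel_measurable borel" for i
    using f by (simp add: cos_positive_def)
  note g[measurable]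
  have nz: "AE \<xi> in lborel. \<xi> \<noteq> (0::real)"
    by (rule AE_lborel_singleton)
  have "(\<lambda>i. LBINT \<xi>. cos (x * \<xi>) * (f i \<xi> * exp (- \<delta> * \<xi>\<^sup>2))) \<longlonglongrightarrow>
      (LBINT \<xi>. cos (x * \<xi>) * (g \<xi> * exp (- \<delta> * \<xi>\<^sup>2)))"
  proof (rule integral_dominated_convergence[where w="\<lambda>\<xi>. B * exp (- \<delta> * \<xi>\<^sup>2)"])
    show "AE \<xi> in lborel. (\<lambda>i. cos (x * \<xi>) * (f i \<xi> * exp (- \<delta> * \<xi>\<^sup>2))) \<longlonglongrightarrow> cos (x * \<xi>) * (g \<xi> * exp (- \<delta> * \<xi>\<^sup>2))"
      using nz by eventually_elim (intro tendsto_intros lim)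
    show "AE \<xi> in lborel. norm (cos (x * \<xi>) * (f i \<xi> * exp (- \<delta> * \<xi>\<^sup>2))) \<le> B * exp (- \<delta> * \<xi>\<^sup>2)" for i
      using nz
    proof eventually_elim
      case (elim \<xi>)
      have "\<bar>cos (x * \<xi>)\<bar> * \<bar>f i \<xi>\<bar> \<le> 1 * B"
        using B[OF elim, of i] by (intro mult_mono) auto
      then show ?case by (simp add: abs_mult flip: mult.assoc)
    qed
  qed (use f g d integrable_exp_sq in \<open>auto simp: cos_positive_def\<close>)
  then show "0 \<le> (LBINT \<xi>. cos (x * \<xi>) * (g \<xi> * exp (- \<delta> * \<xi>\<^sup>2)))"
    by (rule LIMSEQ_le_const) (use f d in \<open>auto simp: cos_positive_def\<close>)
qed (fact g)

text \<open>Each monomial of the polynomial \<open>q\<close> in the exponent is a Gaussian with a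
  nonnegative coefficient, so multiplication by \<open>q\<close> preserves the class. Hence all
  powers of \<open>q\<close> belong to it, and the exponential series combines them with positive
  coefficients. Its partial sums are nonnegative and stay below the constant
  \<open>exp (\<Sum>k<n. a k)\<close>.\<close>

lemma cos_positive_exp:
  fixes a :: "nat \<Rightarrow> real"
  assumes a: "\<And>k. a k \<ge> 0" and c: "c \<ge> 0"
  shows "cos_positive (\<lambda>\<xi>. exp (\<Sum>k<n. a k * exp (- c * \<xi>\<^sup>2) ^ k))"
proof -
  define q where "q \<xi> = (\<Sum>k<n. a k * exp (- c * \<xi>\<^sup>2) ^ k)" for \<xi> :: real
  have z: "exp (- c * \<xi>\<^sup>2) ^ k = exp (- (real k * c) * \<xi>\<^sup>2)" for k and \<xi> :: real
    by (simp add: exp_of_nat_mult[symmetric])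
  have q0: "0 \<le> q \<xi>" for \<xi> unfolding q_def using a by (intro sum_nonneg) auto
  have qB: "q \<xi> \<le> (\<Sum>k<n. a k)" for \<xi>
    unfolding q_def using a c
    by (intro sum_mono mult_left_le) (auto simp: power_le_one)
  have mult: "cos_positive (\<lambda>\<xi>. f \<xi> * q \<xi>)" if "cos_positive f" for f
  proof -
    have "cos_positive (\<lambda>\<xi>. \<Sum>k<n. a k * (f \<xi> * exp (- (real k * c) * \<xi>\<^sup>2)))"
      using that a c by (intro cos_positive_sum cos_positive_cmult cos_positive_mult_exp_sq) auto
    then show ?thesis
      by (rule cos_positive_cong) (simp only: q_def z sum_distrib_left mult.left_commute)
  qed
  have pow: "cos_positive (\<lambda>\<xi>. q \<xi> ^ j)" for j
  proof (induction j)
    case 0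
    show ?case using cos_positive_exp_sq[of 0] by simp
  next
    case (Suc j)
    from mult[OF Suc] show ?case by (simp only: power_Suc2)
  qed
  have "cos_positive (\<lambda>\<xi>. exp (q \<xi>))"
  proof (rule cos_positive_limit[where f="\<lambda>i \<xi>. \<Sum>j<i. inverse (fact j) * q \<xi> ^ j" and B="exp (\<Sum>k<n. a k)"])
    show "cos_positive (\<lambda>\<xi>. \<Sum>j<i. inverse (fact j) * q \<xi> ^ j)" for i
      using pow by (intro cos_positive_sum cos_positive_cmult) auto
    fix \<xi> :: real
    have sums: "(\<lambda>j. inverse (fact j) * q \<xi> ^ j) sums exp (q \<xi>)"
      using exp_converges[of "q \<xi>"] by simp
    then show "(\<lambda>i. \<Sum>j<i. inverse (fact j) * q \<xi> ^ j) \<longlonglongrightarrow> exp (q \<xi>)"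
      by (simp add: sums_def)
    fix i
    have "(\<Sum>j<i. inverse (fact j) * q \<xi> ^ j) \<le> exp (q \<xi>)"
      using sums q0 by (intro sum_le_suminf[of _ "{..<i}", THEN order_trans])
        (auto simp: sums_iff)
    also have "\<dots> \<le> exp (\<Sum>k<n. a k)" using qB by simp
    finally show "\<bar>\<Sum>j<i. inverse (fact j) * q \<xi> ^ j\<bar> \<le> exp (\<Sum>k<n. a k)"
      using q0 by (subst abs_of_nonneg) (auto intro!: sum_nonneg)
  qed (auto simp: q_def)
  then show ?thesis by (simp add: q_def)
qed

text \<open>The binomial series at \<open>- z\<close>, with the alternating sign absorbed by the
  rising factorial of \<open>- s\<close>. The constant term cancels against 1, which is why
  \<open>a 0\<close> is set to 0.\<close>

lemma one_minus_powr_sums: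
  fixes s z :: real
  assumes "0 < s" "s < 1" "0 \<le> z" "z < 1"
  defines "a \<equiv> \<lambda>k. if k = 0 then 0 else - pochhammer (- s) k / fact k"
  shows "(\<lambda>k. a k * z ^ k) sums (1 - (1 - z) powr s)"
proof -
  have "(\<lambda>k. (s gchoose k) * (- z) ^ k) sums (1 + (- z)) powr s"
    using assms by (intro gen_binomial_real) auto
  moreover have "(s gchoose k) * (- z) ^ k = pochhammer (- s) k / fact k * z ^ k" for k
  proof -
    have "(- z) ^ k = (- 1) ^ k * z ^ k" by (rule power_minus)
    then show ?thesis by (simp add: gbinomial_pochhammer)
  qed
  ultimately have "(\<lambda>k. pochhammer (- s) k / fact k * z ^ k) sums (1 - z) powr s"
    by simp
  from sums_diff[OF sums_single[of 0 "\<lambda>_. 1"] this]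
  show ?thesis
    by (rule sums_cong[THEN iffD1, rotated]) (auto simp: a_def)
qed

text \<open>Since \<open>n * (1 - exp (- \<xi>\<^sup>2 / n))\<close> tends to
  \<open>\<xi>\<^sup>2\<close>, the symbol is the limit of functions in which
  \<open>\<xi>\<^sup>2\<close> is replaced by this expression. These are handled by the binomial
  series with \<open>z = exp (- \<xi>\<^sup>2 / n)\<close>, which is less than 1 exactly for
  \<open>\<xi> \<noteq> 0\<close>. All approximants lie between 0 and 1, so both limits are
  bounded.\<close>

lemma cos_positive_stable:
  assumes s: "0 < s" "s < 1" and t: "t \<ge> 0"
  shows "cos_positive (\<lambda>\<xi>. exp (- (\<bar>\<xi>\<bar> powr (2 * s)) * t))"
proof -
  define a where "a k = (if k = 0 then 0 else - pochhammer (- s) k / fact k)" for k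
  have a: "a k \<ge> 0" for k
  proof (cases k)
    case (Suc m)
    \<comment> \<open>Exactly one factor, \<open>- s\<close>, is negative, because
      \<open>s < 1\<close>; the minus sign in \<open>a\<close> compensates for it.\<close>
    have "pochhammer (- s) (Suc m) = - s * pochhammer (1 - s) m"
      by (simp add: pochhammer_rec)
    moreover have "pochhammer (1 - s) m > 0"
      using s by (intro pochhammer_pos) auto
    ultimately show ?thesis
      using s Suc by (simp add: a_def)
  qed (simp add: a_def)
  have step: "cos_positive (\<lambda>\<xi>. exp (- t * (real n * (1 - exp (- (1 / real n) * \<xi>\<^sup>2))) powr s))" if n: "n > 0" for n
  proof -
    \<comment> \<open>With this \<open>c\<close> the target is \<open>exp (- c)\<close> times the
      exponential of \<open>c * (1 - (1 - z) powr s)\<close>, and the latter exponent has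
      nonnegative coefficients in \<open>z\<close>.\<close>
    define c where "c = t * real n powr s"
    have c: "c \<ge> 0" using t by (simp add: c_def)
    show ?thesis
    proof (rule cos_positive_limit[where B=1 and
          f="\<lambda>K \<xi>. exp (- c) * exp (\<Sum>k<K. c * a k * exp (- (1 / real n) * \<xi>\<^sup>2) ^ k)"])
      show "cos_positive (\<lambda>\<xi>. exp (- c) * exp (\<Sum>k<K. c * a k * exp (- (1 / real n) * \<xi>\<^sup>2) ^ k))" for K
        using a c by (intro cos_positive_cmult cos_positive_exp) auto
      fix \<xi> :: real assume x: "\<xi> \<noteq> 0"
      let ?z = "exp (- (1 / real n) * \<xi>\<^sup>2)"
      have z: "0 \<le> ?z" "?z < 1" using n x by auto
      have sums: "(\<lambda>k. a k * ?z ^ k) sums (1 - (1 - ?z) powr s)"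
        unfolding a_def by (rule one_minus_powr_sums[OF s z])
      have sums': "(\<lambda>k. c * a k * ?z ^ k) sums (c * (1 - (1 - ?z) powr s))"
        using sums_mult[OF sums, of c] by (simp add: mult.assoc)
      have e: "exp (- c) * exp (c * (1 - (1 - ?z) powr s)) = exp (- t * (real n * (1 - ?z)) powr s)"
      proof -
        have "(real n * (1 - ?z)) powr s = real n powr s * (1 - ?z) powr s"
          by (rule powr_mult)
        moreover have "exp (- (t * N)) * exp (t * N * (1 - W)) = exp (- t * (N * W))" for N W
          by (simp add: exp_add[symmetric] algebra_simps)
        ultimately show ?thesis by (simp only: c_def)
      qed
      show "(\<lambda>K. exp (- c) * exp (\<Sum>k<K. c * a k * ?z ^ k)) \<longlonglongrightarrow> exp (- t * (real n * (1 - ?z)) powr s)"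
        unfolding e[symmetric] using sums' by (intro tendsto_intros) (simp add: sums_def)
      fix K
      have "(\<Sum>k<K. c * a k * ?z ^ k) \<le> c * (1 - (1 - ?z) powr s)"
        using sums' a c by (intro sum_le_suminf[of _ "{..<K}", THEN order_trans]) (auto simp: sums_iff)
      also have "\<dots> \<le> c * 1" using c by (intro mult_left_mono) auto
      finally have "exp (- c) * exp (\<Sum>k<K. c * a k * ?z ^ k) \<le> 1"
        by (simp flip: exp_add)
      then show "\<bar>exp (- c) * exp (\<Sum>k<K. c * a k * ?z ^ k)\<bar> \<le> 1" by (simp add: abs_mult)
    qed auto
  qed
  show ?thesis
  proof (rule cos_positive_limit[where B=1 and
        f="\<lambda>n \<xi>. exp (- t * (real (Suc n) * (1 - exp (- (1 / real (Suc n)) * \<xi>\<^sup>2))) powr s)"])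
    fix \<xi> :: real assume x: "\<xi> \<noteq> 0"
    have "(\<lambda>n. real (Suc n) * (1 - exp (- (1 / real (Suc n)) * \<xi>\<^sup>2))) \<longlonglongrightarrow> \<xi>\<^sup>2"
      by real_asymp
    then have "(\<lambda>n. exp (- t * (real (Suc n) * (1 - exp (- (1 / real (Suc n)) * \<xi>\<^sup>2))) powr s)) \<longlonglongrightarrow> exp (- t * \<xi>\<^sup>2 powr s)"
      using x by (intro tendsto_intros) auto
    moreover have "\<xi>\<^sup>2 powr s = \<bar>\<xi>\<bar> powr (2 * s)"
      using x powr_powr[of "\<bar>\<xi>\<bar>" 2 s] by simp
    ultimately show "(\<lambda>n. exp (- t * (real (Suc n) * (1 - exp (- (1 / real (Suc n)) * \<xi>\<^sup>2))) powr s)) \<longlonglongrightarrow> exp (- (\<bar>\<xi>\<bar> powr (2 * s)) * t)"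
      by (simp add: mult.commute)
  qed (rule step, use t in auto)
qed

section \<open>The heat kernel as a probability density\<close>

abbreviation heat_symbol :: "real \<Rightarrow> real \<Rightarrow> real \<Rightarrow> real" where
  "heat_symbol s t \<xi> \<equiv> exp (- (\<bar>\<xi>\<bar> powr (2 * s)) * t)"

text \<open>Here \<open>1/2 < s\<close> enters: it gives
  \<open>\<bar>\<xi>\<bar> \<le> 1 + \<bar>\<xi>\<bar> powr (2 * s)\<close>, so the symbol lies
  below \<open>exp t * exp (- t * \<bar>\<xi>\<bar>)\<close>.\<close>

lemma integrable_heat_symbol:
  assumes "1/2 < s" "t > 0"
  shows "integrable lborel (heat_symbol s t)"
proof -
  have "((\<lambda>x. exp (- t * x)) has_integral exp (- t * 0) / t) {0..}"
    using has_integral_exp_minus_to_infinity[OF assms(2), of 0] by simp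
  from integrable_nonneg_has_integral(1)[OF this]
  have "set_integrable lborel {0..} (\<lambda>x. exp (- t * x))" by auto
  then have "integrable lborel (\<lambda>x. indicator {0..} x *\<^sub>R exp (- t * \<bar>x\<bar>))"
    unfolding set_integrable_def
    by (rule Bochner_Integration.integrable_cong[THEN iffD1, rotated -1]) (auto simp: indicator_def)
  then have "has_bochner_integral lborel (\<lambda>x. exp (- t * \<bar>x\<bar>))
     (2 *\<^sub>R (LBINT x. indicator {0..} x *\<^sub>R exp (- t * \<bar>x\<bar>)))"
    by (intro has_bochner_integral_even_function) (auto simp: has_bochner_integral_iff)
  then have "integrable lborel (\<lambda>x. exp t * exp (- t * \<bar>x\<bar>))"
    by (simp add: has_bochner_integral_iff)
  then show ?thesis
  proof (rule Bochner_Integration.integrable_bound)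
    show "AE \<xi> in lborel. norm (heat_symbol s t \<xi>) \<le> norm (exp t * exp (- t * \<bar>\<xi>\<bar>))"
    proof (rule AE_I2)
      fix \<xi> :: real
      have "\<bar>\<xi>\<bar> \<le> 1 + \<bar>\<xi>\<bar> powr (2 * s)"
      proof (cases "\<bar>\<xi>\<bar> \<le> 1")
        case False
        then have "\<bar>\<xi>\<bar> powr 1 \<le> \<bar>\<xi>\<bar> powr (2 * s)"
          using assms by (intro powr_mono) auto
        then show ?thesis using False by simp
      qed (smt (verit) powr_ge_zero)
      from mult_right_mono[OF this, of t] assms
      have "- (\<bar>\<xi>\<bar> powr (2 * s)) * t \<le> t + - t * \<bar>\<xi>\<bar>"
        by (simp add: algebra_simps)
      then show "norm (heat_symbol s t \<xi>) \<le> norm (exp t * exp (- t * \<bar>\<xi>\<bar>))"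
        by (simp flip: exp_add)
    qed
  qed simp
qed

lemma integrable_bounded_mult:
  fixes f g :: "'a \<Rightarrow> real"
  assumes "integrable M f" "g \<in> borel_measurable M" "\<And>x. \<bar>g x\<bar> \<le> B"
  shows "integrable M (\<lambda>x. g x * f x)"
proof (rule Bochner_Integration.integrable_bound[where f="\<lambda>x. B * f x"])
  have "\<bar>g x\<bar> * \<bar>f x\<bar> \<le> \<bar>B\<bar> * \<bar>f x\<bar>" for x
    using assms(3)[of x] by (intro mult_right_mono) auto
  then show "AE x in M. norm (g x * f x) \<le> norm (B * f x)"
    by (auto simp: abs_mult)
qed (use assms in auto)

lemma heat_kernel_eq:
  assumes "1/2 < s" "t > 0"
  shows "heat_kernel s x t = (LBINT \<xi>. cos (x * \<xi>) * heat_symbol s t \<xi>) / (2 * pi)"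
proof -
  have m: "(\<lambda>\<xi>. cis (x * \<xi>)) \<in> borel_measurable borel"
    by (intro borel_measurable_continuous_onI continuous_intros)
  have i: "integrable lborel (\<lambda>\<xi>. cis (x * \<xi>) * complex_of_real (heat_symbol s t \<xi>))"
    by (rule Bochner_Integration.integrable_bound[OF integrable_heat_symbol[OF assms]])
      (use m in \<open>auto simp: norm_mult\<close>)
  have "heat_kernel s x t = Re (LBINT \<xi>. cis (x * \<xi>) * complex_of_real (heat_symbol s t \<xi>)) / (2 * pi)"
    unfolding heat_kernel_def inverse_fourier_def
    by (metis Re_divide_of_real of_real_mult of_real_numeral)
  also have "Re (LBINT \<xi>. cis (x * \<xi>) * complex_of_real (heat_symbol s t \<xi>)) =
     (LBINT \<xi>. cos (x * \<xi>) * heat_symbol s t \<xi>)"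
    using integral_Re[OF i] by simp
  finally show ?thesis .
qed

text \<open>Measurability in space and time jointly is what later makes the semigroup measurable in
  the time variable. Times at which the defining integral diverges are covered through its default
  value 0.\<close>

lemma measurable_heat_kernel:
  "(\<lambda>p. heat_kernel s (fst p) (snd p)) \<in> borel_measurable (borel \<Otimes>\<^sub>M borel)"
proof -
  have m: "cis \<in> borel_measurable borel"
    by (intro borel_measurable_continuous_onI continuous_intros)
  note [measurable] = measurable_compose[OF _ m]
  show ?thesis
    unfolding heat_kernel_def inverse_fourier_def by measurable
qed

lemma measurable_heat_kernel1[measurable]: "(\<lambda>x. heat_kernel s x t) \<in> borel_measurable borel"
  using measurable_compose[OF _ measurable_heat_kernel, of "\<lambda>x. (x, t)" borel] by simp

text \<open>The Gaussian damping in \<open>cos_positive\<close> is removed by letting its parameter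
  \<open>1 / real (Suc n)\<close> tend to 0; the symbol itself is the majorant.\<close>

lemma heat_kernel_nonneg:
  assumes s: "1/2 < s" "s < 1" and t: "t > 0"
  shows "heat_kernel s x t \<ge> 0"
proof -
  have "(\<lambda>n. LBINT \<xi>. cos (x * \<xi>) * (heat_symbol s t \<xi> * exp (- (1 / real (Suc n)) * \<xi>\<^sup>2))) \<longlonglongrightarrow>
      (LBINT \<xi>. cos (x * \<xi>) * heat_symbol s t \<xi>)"
  proof (rule integral_dominated_convergence[where w="heat_symbol s t"])
    show "AE \<xi> in lborel. (\<lambda>n. cos (x * \<xi>) * (heat_symbol s t \<xi> * exp (- (1 / real (Suc n)) * \<xi>\<^sup>2)))
        \<longlonglongrightarrow> cos (x * \<xi>) * heat_symbol s t \<xi>"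
    proof (rule AE_I2)
      fix \<xi> :: real
      have "(\<lambda>n. exp (- (1 / real (Suc n)) * \<xi>\<^sup>2)) \<longlonglongrightarrow> 1" by real_asymp
      then have "(\<lambda>n. cos (x * \<xi>) * (heat_symbol s t \<xi> * exp (- (1 / real (Suc n)) * \<xi>\<^sup>2)))
          \<longlonglongrightarrow> cos (x * \<xi>) * (heat_symbol s t \<xi> * 1)"
        by (intro tendsto_intros)
      then show "(\<lambda>n. cos (x * \<xi>) * (heat_symbol s t \<xi> * exp (- (1 / real (Suc n)) * \<xi>\<^sup>2)))
        \<longlonglongrightarrow> cos (x * \<xi>) * heat_symbol s t \<xi>" by simp
    qed
    show "AE \<xi> in lborel. norm (cos (x * \<xi>) * (heat_symbol s t \<xi> * exp (- (1 / real (Suc n)) * \<xi>\<^sup>2))) \<le> heat_symbol s t \<xi>" for n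
    proof (rule AE_I2)
      fix \<xi> :: real
      have "\<bar>cos (x * \<xi>)\<bar> * (heat_symbol s t \<xi> * exp (- (1 / real (Suc n)) * \<xi>\<^sup>2)) \<le> 1 * (heat_symbol s t \<xi> * 1)"
        by (intro mult_mono) auto
      then show "norm (cos (x * \<xi>) * (heat_symbol s t \<xi> * exp (- (1 / real (Suc n)) * \<xi>\<^sup>2))) \<le> heat_symbol s t \<xi>"
        by (simp add: abs_mult)
    qed
  qed (use integrable_heat_symbol[OF s(1) t] in auto)
  then have "0 \<le> (LBINT \<xi>. cos (x * \<xi>) * heat_symbol s t \<xi>)"
  proof (rule LIMSEQ_le_const, intro exI allI impI)
    fix n
    show "0 \<le> (LBINT \<xi>. cos (x * \<xi>) * (heat_symbol s t \<xi> * exp (- (1 / real (Suc n)) * \<xi>\<^sup>2)))"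
    proof -
      have "cos_positive (heat_symbol s t)"
        by (rule cos_positive_stable) (use s t in auto)
      moreover have "0 < 1 / real (Suc n)" by simp
      ultimately show ?thesis unfolding cos_positive_def by blast
    qed
  qed
  then show ?thesis by (simp add: heat_kernel_eq[OF s(1) t])
qed

section \<open>Fourier inversion with Gaussian regularisation\<close>

lemma integrable_heat_kernel_gauss:
  assumes "1/2 < s" "t > 0" "\<sigma> > 0"
  shows "integrable (lborel \<Otimes>\<^sub>M lborel)
    (\<lambda>(x, \<xi>). cos (x * \<xi>) * heat_symbol s t \<xi> * (cos (a * x) * exp (- (\<sigma>\<^sup>2 / 2) * x\<^sup>2)))"
proof (rule integrable_pair_bound[OF _ _ integrable_exp_sq integrable_heat_symbol[OF assms(1,2)]])
  show "\<bar>(\<lambda>(x, \<xi>). cos (x * \<xi>) * heat_symbol s t \<xi> * (cos (a * x) * exp (- (\<sigma>\<^sup>2 / 2) * x\<^sup>2))) (x, \<xi>)\<bar>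
      \<le> exp (- (\<sigma>\<^sup>2 / 2) * x\<^sup>2) * heat_symbol s t \<xi>" for x \<xi>
  proof -
    have "\<bar>cos (x * \<xi>)\<bar> * \<bar>cos (a * x)\<bar> \<le> 1 * 1" by (intro mult_mono) auto
    from mult_right_mono[OF this, of "exp (- (\<sigma>\<^sup>2 / 2) * x\<^sup>2) * heat_symbol s t \<xi>"]
    show ?thesis by (simp add: abs_mult mult_ac)
  qed
qed (use assms in \<open>auto intro: lborel.sigma_finite_measure_axioms\<close>)

text \<open>The Gaussian weight in \<open>x\<close> permits Fubini before the kernel is known to be
  integrable. Its cosine transform is a normal density of standard deviation
  \<open>\<sigma>\<close>, and the product formula for cosines centres one copy at \<open>a\<close>
  and one at \<open>- a\<close>; so the left side is the mean of two normal averages of the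
  symbol.\<close>

lemma integral_heat_kernel_gauss:
  assumes s: "1/2 < s" "s < 1" and t: "t > 0" and \<sigma>: "\<sigma> > 0"
  shows "integrable lborel (\<lambda>x. heat_kernel s x t * (cos (a * x) * exp (- (\<sigma>\<^sup>2 / 2) * x\<^sup>2)))"
    and "(LBINT x. heat_kernel s x t * (cos (a * x) * exp (- (\<sigma>\<^sup>2 / 2) * x\<^sup>2))) =
      ((LBINT z. std_normal_density z * heat_symbol s t (a + \<sigma> * z)) +
       (LBINT z. std_normal_density z * heat_symbol s t (- a + \<sigma> * z))) / 2"
proof -
  let ?e = "\<lambda>x::real. exp (- (\<sigma>\<^sup>2 / 2) * x\<^sup>2)"
  let ?\<phi> = "heat_symbol s t"
  let ?F = "\<lambda>x \<xi>. cos (x * \<xi>) * ?\<phi> \<xi> * (cos (a * x) * ?e x)"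
  note int = integrable_heat_kernel_gauss[OF s(1) t \<sigma>, of a]
  have P: "heat_kernel s x t * (cos (a * x) * ?e x) = (LBINT \<xi>. ?F x \<xi>) / (2 * pi)" for x
    by (simp add: heat_kernel_eq[OF s(1) t])
  show "integrable lborel (\<lambda>x. heat_kernel s x t * (cos (a * x) * ?e x))"
    unfolding P using lborel_pair.integrable_fst[OF int] by auto
  \<comment> \<open>The density of \<open>\<sigma>\<close> times a standard normal variable; up to
    the factor \<open>2 * pi\<close> it is the transform of the weight.\<close>
  define N where "N y = std_normal_density (y / \<sigma>) / \<sigma>" for y
  have inner: "(LBINT x. ?F x \<xi>) / (2 * pi) = ?\<phi> \<xi> * (N (\<xi> - a) + N (\<xi> + a)) / 2" for \<xi>
  proof -
    have G: "integrable lborel (\<lambda>x. cos (y * x) * ?e x)"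
      "(LBINT x. cos (y * x) * ?e x) = 2 * pi * N y" for y
    proof -
      show "integrable lborel (\<lambda>x. cos (y * x) * ?e x)"
        using \<sigma> by (intro integral_gauss_cos) auto
      have "(LBINT x. cos (y * x) * ?e x) = sqrt (pi / (\<sigma>\<^sup>2 / 2)) * exp (- y\<^sup>2 / (4 * (\<sigma>\<^sup>2 / 2)))"
        using \<sigma> by (intro integral_gauss_cos) auto
      also have "sqrt (pi / (\<sigma>\<^sup>2 / 2)) = sqrt (2 * pi) / \<sigma>"
        using \<sigma> by (simp add: real_sqrt_divide real_sqrt_mult)
      also have "sqrt (2 * pi) / \<sigma> * exp (- y\<^sup>2 / (4 * (\<sigma>\<^sup>2 / 2))) = 2 * pi * N y"
      proof -
        have "2 * pi / sqrt (2 * pi) = sqrt (2 * pi)" by (simp add: real_div_sqrt)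
        moreover have "2 * pi * N y = (2 * pi / sqrt (2 * pi)) / \<sigma> * exp (- y\<^sup>2 / (4 * (\<sigma>\<^sup>2 / 2)))"
          by (simp add: N_def std_normal_density_def power_divide)
        ultimately show ?thesis by simp
      qed
      finally show "(LBINT x. cos (y * x) * ?e x) = 2 * pi * N y" .
    qed
    have "?F x \<xi> = ?\<phi> \<xi> / 2 * (cos ((\<xi> - a) * x) * ?e x + cos ((\<xi> + a) * x) * ?e x)" for x
    proof -
      have "cos (x * \<xi>) * cos (a * x) = (cos ((\<xi> - a) * x) + cos ((\<xi> + a) * x)) / 2"
        by (simp add: cos_times_cos algebra_simps)
      then have "cos (x * \<xi>) * cos (a * x) * (?\<phi> \<xi> * ?e x) = (cos ((\<xi> - a) * x) + cos ((\<xi> + a) * x)) / 2 * (?\<phi> \<xi> * ?e x)"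
        by (simp only:)
      then show ?thesis by (simp add: algebra_simps add_divide_distrib)
    qed
    then have "(LBINT x. ?F x \<xi>) = ?\<phi> \<xi> / 2 * (2 * pi * N (\<xi> - a) + 2 * pi * N (\<xi> + a))"
      by (simp only: Bochner_Integration.integral_mult_right_zero Bochner_Integration.integral_add G)
    then show ?thesis by (simp add: field_simps)
  qed
  have iN: "integrable lborel (\<lambda>\<xi>. ?\<phi> \<xi> * N (\<xi> - b))"
      "(LBINT \<xi>. ?\<phi> \<xi> * N (\<xi> - b)) = (LBINT z. std_normal_density z * ?\<phi> (b + \<sigma> * z))" for b
  proof -
    have "integrable lborel (\<lambda>z. ?\<phi> (b + \<sigma> * z) * std_normal_density z)"
      by (rule integrable_bounded_mult[where B=1]) (use t in auto)
    moreover have "?\<phi> (b + \<sigma> * z) * N ((b + \<sigma> * z) - b) = ?\<phi> (b + \<sigma> * z) * std_normal_density z / \<sigma>" for z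
      using \<sigma> by (simp add: N_def)
    ultimately have "integrable lborel (\<lambda>z. ?\<phi> (b + \<sigma> * z) * N ((b + \<sigma> * z) - b))"
      by simp
    then show "integrable lborel (\<lambda>\<xi>. ?\<phi> \<xi> * N (\<xi> - b))"
      by (subst (asm) lborel_integrable_real_affine_iff) (use \<sigma> in auto)
    have "(LBINT \<xi>. ?\<phi> \<xi> * N (\<xi> - b)) = \<bar>\<sigma>\<bar> *\<^sub>R (LBINT z. ?\<phi> (b + \<sigma> * z) * N ((b + \<sigma> * z) - b))"
      by (rule lborel_integral_real_affine) (use \<sigma> in auto)
    also have "\<dots> = (LBINT z. std_normal_density z * ?\<phi> (b + \<sigma> * z))"
      using \<sigma> by (simp add: N_def mult.commute)
    finally show "(LBINT \<xi>. ?\<phi> \<xi> * N (\<xi> - b)) = (LBINT z. std_normal_density z * ?\<phi> (b + \<sigma> * z))" .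
  qed
  have "(LBINT x. heat_kernel s x t * (cos (a * x) * ?e x)) = (LBINT x. LBINT \<xi>. ?F x \<xi>) / (2 * pi)"
    unfolding P by simp
  also have "\<dots> = (LBINT \<xi>. (LBINT x. ?F x \<xi>) / (2 * pi))"
    using lborel_pair.Fubini_integral[OF int] by simp
  also have "\<dots> = (LBINT \<xi>. (?\<phi> \<xi> * N (\<xi> - a) + ?\<phi> \<xi> * N (\<xi> - (- a))) / 2)"
    unfolding inner by (simp add: distrib_left)
  also have "\<dots> = ((LBINT z. std_normal_density z * ?\<phi> (a + \<sigma> * z)) + (LBINT z. std_normal_density z * ?\<phi> (- a + \<sigma> * z))) / 2"
    by (simp only: Bochner_Integration.integral_divide_zero Bochner_Integration.integral_add[OF iN(1)[of a] iN(1)[of "-a"]] iN(2))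
  finally show "(LBINT x. heat_kernel s x t * (cos (a * x) * ?e x)) =
      ((LBINT z. std_normal_density z * ?\<phi> (a + \<sigma> * z)) + (LBINT z. std_normal_density z * ?\<phi> (- a + \<sigma> * z))) / 2" .
qed

text \<open>As the standard deviation \<open>1 / real (Suc n)\<close> tends to 0, the normal
  averages concentrate at \<open>a\<close> and \<open>- a\<close>, where the continuous, even symbol
  takes the same value.\<close>

lemma heat_kernel_gauss_tendsto:
  assumes s: "1/2 < s" "s < 1" and t: "t > 0"
  shows "(\<lambda>n. LBINT x. heat_kernel s x t * (cos (a * x) * exp (- ((1 / real (Suc n))\<^sup>2 / 2) * x\<^sup>2)))
     \<longlonglongrightarrow> heat_symbol s t a"
proof -
  have lim: "(\<lambda>n. LBINT z. std_normal_density z * heat_symbol s t (b + 1 / real (Suc n) * z)) \<longlonglongrightarrow> heat_symbol s t b" for b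
  proof -
    have "(\<lambda>n. LBINT z. std_normal_density z * heat_symbol s t (b + 1 / real (Suc n) * z))
       \<longlonglongrightarrow> (LBINT z. std_normal_density z * heat_symbol s t b)"
    proof (rule integral_dominated_convergence[where w=std_normal_density])
      show "AE z in lborel. (\<lambda>n. std_normal_density z * heat_symbol s t (b + 1 / real (Suc n) * z))
         \<longlonglongrightarrow> std_normal_density z * heat_symbol s t b"
      proof (rule AE_I2)
        fix z :: real
        have "(\<lambda>n. b + 1 / real (Suc n) * z) \<longlonglongrightarrow> b" by real_asymp
        then show "(\<lambda>n. std_normal_density z * heat_symbol s t (b + 1 / real (Suc n) * z))
         \<longlonglongrightarrow> std_normal_density z * heat_symbol s t b"
          using s by (intro tendsto_intros tendsto_powr2) auto
      qed
    qed (use t in \<open>auto simp: abs_mult intro!: mult_left_le\<close>)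
    then show ?thesis by simp
  qed
  have "(\<lambda>n. ((LBINT z. std_normal_density z * heat_symbol s t (a + 1 / real (Suc n) * z)) +
       (LBINT z. std_normal_density z * heat_symbol s t (- a + 1 / real (Suc n) * z))) / 2) \<longlonglongrightarrow>
     (heat_symbol s t a + heat_symbol s t (- a)) / 2"
    by (intro tendsto_intros lim) auto
  moreover have "(LBINT x. heat_kernel s x t * (cos (a * x) * exp (- ((1 / real (Suc n))\<^sup>2 / 2) * x\<^sup>2))) =
     ((LBINT z. std_normal_density z * heat_symbol s t (a + 1 / real (Suc n) * z)) +
       (LBINT z. std_normal_density z * heat_symbol s t (- a + 1 / real (Suc n) * z))) / 2" for n
    by (rule integral_heat_kernel_gauss(2)[OF s t]) simp
  ultimately show ?thesis by (simp only:) simp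
qed

text \<open>Integrability is not known beforehand. Nonnegativity makes the regularised integrands
  increase with \<open>n\<close>, so monotone convergence yields integrability and the mass
  together; the mass is the symbol at frequency 0.\<close>

lemma heat_kernel_density:
  assumes s: "1/2 < s" "s < 1" and t: "t > 0"
  shows "integrable lborel (\<lambda>x. heat_kernel s x t)" "(LBINT x. heat_kernel s x t) = 1"
proof -
  have "has_bochner_integral lborel (\<lambda>x. heat_kernel s x t) 1"
  proof (rule has_bochner_integral_monotone_convergence)
    let ?f = "\<lambda>n x. heat_kernel s x t * (cos (0 * x) * exp (- ((1 / real (Suc n))\<^sup>2 / 2) * x\<^sup>2))"
    show "integrable lborel (?f n)" for n
      by (rule integral_heat_kernel_gauss(1)[OF s t]) auto
    show "(\<lambda>n. integral\<^sup>L lborel (?f n)) \<longlonglongrightarrow> 1"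
      using heat_kernel_gauss_tendsto[OF s t, of 0] by simp
    show "AE x in lborel. mono (\<lambda>n. ?f n x)"
    proof (intro AE_I2 monoI)
      fix x and m n :: nat assume "m \<le> n"
      then have "(1 / real (Suc n))\<^sup>2 * x\<^sup>2 \<le> (1 / real (Suc m))\<^sup>2 * x\<^sup>2"
        by (intro mult_right_mono power_mono divide_left_mono) auto
      then show "?f m x \<le> ?f n x"
        using heat_kernel_nonneg[OF s t] by (intro mult_left_mono) auto
    qed
    show "AE x in lborel. (\<lambda>n. ?f n x) \<longlonglongrightarrow> heat_kernel s x t"
    proof (rule AE_I2)
      fix x :: real
      have "(\<lambda>n. exp (- ((1 / real (Suc n))\<^sup>2 / 2) * x\<^sup>2)) \<longlonglongrightarrow> 1" by real_asymp
      from tendsto_mult_left[OF this, of "heat_kernel s x t"]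
      show "(\<lambda>n. ?f n x) \<longlonglongrightarrow> heat_kernel s x t" by simp
    qed
  qed auto
  then show "integrable lborel (\<lambda>x. heat_kernel s x t)" "(LBINT x. heat_kernel s x t) = 1"
    by (auto simp: has_bochner_integral_iff)
qed

lemma heat_kernel_cos:
  assumes s: "1/2 < s" "s < 1" and t: "t > 0"
  shows "(LBINT x. heat_kernel s x t * cos (a * x)) = heat_symbol s t a"
proof (rule LIMSEQ_unique[OF _ heat_kernel_gauss_tendsto[OF s t]])
  show "(\<lambda>n. LBINT x. heat_kernel s x t * (cos (a * x) * exp (- ((1 / real (Suc n))\<^sup>2 / 2) * x\<^sup>2)))
     \<longlonglongrightarrow> (LBINT x. heat_kernel s x t * cos (a * x))"
  proof (rule integral_dominated_convergence[where w="\<lambda>x. heat_kernel s x t"])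
    show "AE x in lborel. (\<lambda>n. heat_kernel s x t * (cos (a * x) * exp (- ((1 / real (Suc n))\<^sup>2 / 2) * x\<^sup>2)))
       \<longlonglongrightarrow> heat_kernel s x t * cos (a * x)"
    proof (rule AE_I2)
      fix x :: real
      have "(\<lambda>n. exp (- ((1 / real (Suc n))\<^sup>2 / 2) * x\<^sup>2)) \<longlonglongrightarrow> 1" by real_asymp
      from tendsto_mult_left[OF this, of "heat_kernel s x t * cos (a * x)"]
      show "(\<lambda>n. heat_kernel s x t * (cos (a * x) * exp (- ((1 / real (Suc n))\<^sup>2 / 2) * x\<^sup>2)))
       \<longlonglongrightarrow> heat_kernel s x t * cos (a * x)" by (simp add: mult.assoc)
    qed
    show "AE x in lborel. norm (heat_kernel s x t * (cos (a * x) * exp (- ((1 / real (Suc n))\<^sup>2 / 2) * x\<^sup>2)))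
        \<le> heat_kernel s x t" for n
    proof (rule AE_I2)
      fix x :: real
      have "\<bar>cos (a * x)\<bar> * exp (- ((1 / real (Suc n))\<^sup>2 / 2) * x\<^sup>2) \<le> 1 * 1"
        by (intro mult_mono) auto
      from mult_left_mono[OF this heat_kernel_nonneg[OF s t, of x]]
      show "norm (heat_kernel s x t * (cos (a * x) * exp (- ((1 / real (Suc n))\<^sup>2 / 2) * x\<^sup>2))) \<le> heat_kernel s x t"
        using heat_kernel_nonneg[OF s t, of x] by (simp add: abs_mult)
    qed
  qed (use heat_kernel_density[OF s t] in auto)
qed

lemma heat_kernel_minus: "1/2 < s \<Longrightarrow> t > 0 \<Longrightarrow> heat_kernel s (- x) t = heat_kernel s x t"
  by (simp add: heat_kernel_eq)

lemma heat_kernel_sin: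
  assumes s: "1/2 < s" "s < 1" and t: "t > 0"
  shows "(LBINT x. heat_kernel s x t * sin (a * x)) = 0"
proof -
  have "(LBINT x. heat_kernel s x t * sin (a * x)) = \<bar>-1\<bar> *\<^sub>R (LBINT x. heat_kernel s (0 + (-1) * x) t * sin (a * (0 + (-1) * x)))"
    by (rule lborel_integral_real_affine) auto
  then show ?thesis using s t by (simp add: heat_kernel_minus)
qed

text \<open>The point mass at time 0 makes the semigroup start at the identity, so that later
  statements hold on the closed half-line of times.\<close>

definition heat_law :: "real \<Rightarrow> real \<Rightarrow> real measure" where
  "heat_law s t = (if t = 0 then return borel 0 else density lborel (\<lambda>x. ennreal (heat_kernel s x t)))"

lemma sets_heat_law[simp, measurable_cong]: "sets (heat_law s t) = sets borel"
  by (simp add: heat_law_def)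

lemma space_heat_law[simp]: "space (heat_law s t) = UNIV"
  by (simp add: heat_law_def)

lemma integral_heat_law:
  assumes "1/2 < s" "s < 1" "t > 0" and [measurable]: "f \<in> borel_measurable borel"
  shows "integral\<^sup>L (heat_law s t) f = (LBINT x. heat_kernel s x t * f x)"
  using assms(1-3) heat_kernel_nonneg[of s t] unfolding heat_law_def
  by (simp add: integral_density)

lemma integral_heat_law_0:
  fixes f :: "real \<Rightarrow> real"
  assumes "f \<in> borel_measurable borel"
  shows "integral\<^sup>L (heat_law s 0) f = f 0"
  using assms unfolding heat_law_def by (simp add: integral_return)

lemma prob_space_heat_law:
  assumes s: "1/2 < s" "s < 1" and t: "t \<ge> 0"
  shows "prob_space (heat_law s t)"
proof (cases "t = 0")
  case True
  then show ?thesis unfolding heat_law_def by (auto intro!: prob_space_return)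
next
  case False
  then have t: "t > 0" using t by simp
  have "(\<integral>\<^sup>+ x. ennreal (heat_kernel s x t) \<partial>lborel) = 1"
    using heat_kernel_density[OF s t] heat_kernel_nonneg[OF s t]
    by (subst nn_integral_eq_integral) auto
  then show ?thesis
    using False unfolding heat_law_def by (auto intro!: prob_spaceI simp: emeasure_density)
qed

text \<open>Cosines are eigenfunctions of the convolution: in the addition formula the sine moment
  vanishes because the kernel is even.\<close>

lemma heat_law_cos:
  assumes s: "1/2 < s" "s < 1" and t: "t \<ge> 0"
  shows "integral\<^sup>L (heat_law s t) (\<lambda>z. cos (\<xi> * (b - z))) = heat_symbol s t \<xi> * cos (\<xi> * b)"
proof (cases "t = 0")
  case True
  then show ?thesis by (simp add: integral_heat_law_0)
next
  case False
  then have t: "t > 0" using t by simp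
  have i: "integrable lborel (\<lambda>x. cos (\<xi> * x) * heat_kernel s x t)" "integrable lborel (\<lambda>x. sin (\<xi> * x) * heat_kernel s x t)"
    using heat_kernel_density[OF s t] by (auto intro!: integrable_bounded_mult[where B=1])
  have "integral\<^sup>L (heat_law s t) (\<lambda>z. cos (\<xi> * (b - z))) =
     (LBINT z. cos (\<xi> * b) * (cos (\<xi> * z) * heat_kernel s z t) + sin (\<xi> * b) * (sin (\<xi> * z) * heat_kernel s z t))"
    by (subst integral_heat_law[OF s t]) (auto simp: right_diff_distrib cos_diff algebra_simps)
  also have "\<dots> = cos (\<xi> * b) * (LBINT z. cos (\<xi> * z) * heat_kernel s z t) + sin (\<xi> * b) * (LBINT z. sin (\<xi> * z) * heat_kernel s z t)"
    using i by simp
  also have "\<dots> = heat_symbol s t \<xi> * cos (\<xi> * b)"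
    using heat_kernel_cos[OF s t, of \<xi>] heat_kernel_sin[OF s t, of \<xi>] by (simp add: mult.commute)
  finally show ?thesis .
qed

section \<open>Generator and semigroup on superpositions of cosines\<close>

text \<open>Minus the one-dimensional fractional Laplacian, with the weight moved into
  \<open>levy_measure\<close>.\<close>

definition frac_gen :: "real \<Rightarrow> (real \<Rightarrow> real) \<Rightarrow> real \<Rightarrow> real" where
  "frac_gen s f x = frac_const s * (LINT \<eta>|levy_measure s. f (x + \<eta>) + f (x - \<eta>) - 2 * f x)"

definition heat_sg :: "real \<Rightarrow> real \<Rightarrow> (real \<Rightarrow> real) \<Rightarrow> real \<Rightarrow> real" where
  "heat_sg s t f x = (LINT z|heat_law s t. f (x - z))"

text \<open>One constant controls the function and two derivatives, because estimates linear in
  \<open>M\<close> are wanted that are uniform along approximating sequences.\<close>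

definition C2_bounded :: "real \<Rightarrow> (real \<Rightarrow> real) \<Rightarrow> bool" where
  "C2_bounded M f \<longleftrightarrow> (\<exists>f' f''. \<forall>x. (f has_real_derivative f' x) (at x) \<and> (f' has_real_derivative f'' x) (at x) \<and>
     \<bar>f x\<bar> \<le> M \<and> \<bar>f' x\<bar> \<le> M \<and> \<bar>f'' x\<bar> \<le> M)"

lemma C2_bounded_measurable:
  assumes "C2_bounded M f" shows "f \<in> borel_measurable borel"
proof -
  have "isCont f x" for x using assms unfolding C2_bounded_def by (meson DERIV_isCont)
  then show ?thesis by (intro borel_measurable_continuous_onI continuous_at_imp_continuous_on) auto
qed

lemma C2_bounded_abs: "C2_bounded M f \<Longrightarrow> \<bar>f x\<bar> \<le> M"
  unfolding C2_bounded_def by blast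

lemma deriv_bounded_lipschitz:
  fixes f f' :: "real \<Rightarrow> real"
  assumes "\<And>x. (f has_real_derivative f' x) (at x)" "\<And>x. \<bar>f' x\<bar> \<le> M"
  shows "\<bar>f x - f y\<bar> \<le> M * \<bar>x - y\<bar>"
  using field_differentiable_bound[of UNIV f f' M x y] assms by simp

text \<open>The mean value theorem on both sides of \<open>x\<close> and the Lipschitz bound for
  \<open>f'\<close> give \<open>2 * M * \<eta>\<^sup>2\<close>, since the two intermediate points
  are at most \<open>2 * \<eta>\<close> apart. For large \<open>\<eta>\<close> the triangle
  inequality gives \<open>4 * M\<close>.\<close>

lemma C2_bounded_second_difference:
  assumes "C2_bounded M f" "\<eta> > 0"
  shows "\<bar>f (x + \<eta>) + f (x - \<eta>) - 2 * f x\<bar> \<le> 4 * M * trunc_sq \<eta>"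
proof -
  obtain f' f'' where f: "\<And>x. (f has_real_derivative f' x) (at x)" "\<And>x. (f' has_real_derivative f'' x) (at x)"
     "\<And>x. \<bar>f x\<bar> \<le> M" "\<And>x. \<bar>f'' x\<bar> \<le> M"
    using assms unfolding C2_bounded_def by metis
  have M: "M \<ge> 0" using f(3)[of 0] by linarith
  obtain a where a: "x < a" "a < x + \<eta>" "f (x + \<eta>) - f x = \<eta> * f' a"
    using MVT2[of x "x + \<eta>" f f'] f(1) assms(2) by auto
  obtain b where b: "x - \<eta> < b" "b < x" "f x - f (x - \<eta>) = \<eta> * f' b"
    using MVT2[of "x - \<eta>" x f f'] f(1) assms(2) by auto
  have "\<bar>f (x + \<eta>) + f (x - \<eta>) - 2 * f x\<bar> = \<eta> * \<bar>f' a - f' b\<bar>"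
  proof -
    have "f (x + \<eta>) + f (x - \<eta>) - 2 * f x = \<eta> * (f' a - f' b)"
      using a(3) b(3) by (simp add: algebra_simps)
    then show ?thesis using assms(2) by (simp add: abs_mult)
  qed
  also have "\<dots> \<le> \<eta> * (M * \<bar>a - b\<bar>)"
    using deriv_bounded_lipschitz[of f' f'' M a b] f assms(2) by (intro mult_left_mono) auto
  also have "\<dots> \<le> \<eta> * (M * (2 * \<eta>))"
    using a b M assms(2) by (intro mult_left_mono) auto
  finally have 1: "\<bar>f (x + \<eta>) + f (x - \<eta>) - 2 * f x\<bar> \<le> 2 * (M * \<eta>\<^sup>2)"
    by (simp add: power2_eq_square mult_ac)
  have 2: "\<bar>f (x + \<eta>) + f (x - \<eta>) - 2 * f x\<bar> \<le> 4 * M"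
    using f(3)[of "x + \<eta>"] f(3)[of "x - \<eta>"] f(3)[of x] by linarith
  have "M * \<eta>\<^sup>2 \<ge> 0" using M by simp
  then show ?thesis using 1 2 by (auto simp: min_def)
qed

lemma frac_gen_measurable[measurable]:
  assumes [measurable]: "f \<in> borel_measurable borel"
  shows "frac_gen s f \<in> borel_measurable borel"
proof -
  interpret V: sigma_finite_measure "levy_measure s" by (rule sigma_finite_levy_measure)
  show ?thesis unfolding frac_gen_def by measurable
qed

text \<open>For positive times the law has a jointly measurable density, so Fubini-type
  measurability applies; the half-open interval leaves out the point mass at time 0.\<close>

lemma heat_sg_measurable_time:
  assumes s: "1/2 < s" "s < 1" and [measurable]: "f \<in> borel_measurable borel"
  shows "(\<lambda>r. indicator {0<..t} r *\<^sub>R heat_sg s r f x) \<in> borel_measurable borel"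
proof -
  have [measurable]: "(\<lambda>p. heat_kernel s (snd p) (fst p)) \<in> borel_measurable (borel \<Otimes>\<^sub>M borel)"
    using measurable_compose[OF _ measurable_heat_kernel, of "\<lambda>p. (snd p, fst p)" "borel \<Otimes>\<^sub>M borel"] by simp
  have "(\<lambda>r. LBINT z. heat_kernel s (snd (r, z)) (fst (r, z)) * f (x - z)) \<in> borel_measurable borel"
    by measurable
  then have "(\<lambda>r. indicator {0<..t} r *\<^sub>R (LBINT z. heat_kernel s z r * f (x - z))) \<in> borel_measurable borel"
    by simp
  also have "(\<lambda>r. indicator {0<..t} r *\<^sub>R (LBINT z. heat_kernel s z r * f (x - z))) =
     (\<lambda>r. indicator {0<..t} r *\<^sub>R heat_sg s r f x)"
    using s by (auto simp: indicator_def heat_sg_def integral_heat_law)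
  finally show ?thesis .
qed

lemma heat_sg_bound:
  assumes s: "1/2 < s" "s < 1" "t \<ge> 0" and B: "\<And>x. \<bar>f x\<bar> \<le> B"
  shows "\<bar>heat_sg s t f x\<bar> \<le> B"
proof -
  interpret prob_space "heat_law s t" by (rule prob_space_heat_law[OF s])
  show ?thesis
  proof (cases "integrable (heat_law s t) (\<lambda>z. f (x - z))")
    case True
    have "\<bar>heat_sg s t f x\<bar> \<le> (LINT z|heat_law s t. \<bar>f (x - z)\<bar>)"
      unfolding heat_sg_def by (rule integral_abs_bound)
    also have "\<dots> \<le> B"
      using B integral_le_const[of "\<lambda>z. \<bar>f (x - z)\<bar>" B] True by auto
    finally show ?thesis .
  next
    case False
    \<comment> \<open>Without integrability the integral has the default value 0, and
      \<open>B[of 0]\<close> supplies \<open>0 \<le> B\<close>.\<close>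
    then show ?thesis using B[of 0] by (simp add: heat_sg_def not_integrable_integral_eq)
  qed
qed

lemma heat_law_integrable:
  fixes f :: "real \<Rightarrow> real"
  assumes s: "1/2 < s" "s < 1" "t \<ge> 0" and [measurable]: "f \<in> borel_measurable borel" and B: "\<And>x. \<bar>f x\<bar> \<le> B"
  shows "integrable (heat_law s t) (\<lambda>z. f (x - z))"
proof -
  interpret prob_space "heat_law s t" by (rule prob_space_heat_law[OF s])
  show ?thesis by (rule integrable_const_bound[where B=B]) (use B in auto)
qed

lemma heat_sg_tendsto:
  fixes f :: "nat \<Rightarrow> real \<Rightarrow> real"
  assumes s: "1/2 < s" "s < 1" "t \<ge> 0"
    and [measurable]: "\<And>n. f n \<in> borel_measurable borel" "g \<in> borel_measurable borel"
    and lim: "\<And>x. (\<lambda>n. f n x) \<longlonglongrightarrow> g x" and B: "\<And>n x. \<bar>f n x\<bar> \<le> B"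
  shows "(\<lambda>n. heat_sg s t (f n) x) \<longlonglongrightarrow> heat_sg s t g x"
proof -
  interpret prob_space "heat_law s t" by (rule prob_space_heat_law[OF s])
  show ?thesis unfolding heat_sg_def
    by (rule integral_dominated_convergence[where w="\<lambda>_. B"]) (use lim B in auto)
qed

definition levy_mass :: "real \<Rightarrow> real" where
  "levy_mass s = frac_const s * (LINT \<eta>|levy_measure s. trunc_sq \<eta>)"

lemma frac_gen_bound:
  assumes s: "0 < s" "s < 1" and [measurable]: "f \<in> borel_measurable borel"
    and B: "\<And>x \<eta>. \<eta> > 0 \<Longrightarrow> \<bar>f (x + \<eta>) + f (x - \<eta>) - 2 * f x\<bar> \<le> B * trunc_sq \<eta>"
  shows "integrable (levy_measure s) (\<lambda>\<eta>. f (x + \<eta>) + f (x - \<eta>) - 2 * f x)"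
    and "\<bar>frac_gen s f x\<bar> \<le> levy_mass s * B"
proof -
  show i: "integrable (levy_measure s) (\<lambda>\<eta>. f (x + \<eta>) + f (x - \<eta>) - 2 * f x)"
    by (rule integrable_levy_bound[OF s _ B]) auto
  have "\<bar>LINT \<eta>|levy_measure s. f (x + \<eta>) + f (x - \<eta>) - 2 * f x\<bar> \<le> (LINT \<eta>|levy_measure s. \<bar>f (x + \<eta>) + f (x - \<eta>) - 2 * f x\<bar>)"
    by (rule integral_abs_bound)
  also have "\<dots> \<le> (LINT \<eta>|levy_measure s. B * trunc_sq \<eta>)"
  proof (rule integral_mono_AE)
    show "AE \<eta> in levy_measure s. \<bar>f (x + \<eta>) + f (x - \<eta>) - 2 * f x\<bar> \<le> B * trunc_sq \<eta>"
      using AE_levy_measure by eventually_elim (rule B)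
  qed (use i integrable_trunc_sq[OF s] in auto)
  also have "\<dots> = B * (LINT \<eta>|levy_measure s. trunc_sq \<eta>)"
    by (rule Bochner_Integration.integral_mult_right_zero)
  finally show "\<bar>frac_gen s f x\<bar> \<le> levy_mass s * B"
    using frac_const_pos[OF s] unfolding frac_gen_def levy_mass_def
    by (simp add: abs_mult mult.assoc mult.commute[of B] mult_left_mono)
qed

lemma frac_gen_tendsto:
  fixes f :: "nat \<Rightarrow> real \<Rightarrow> real"
  assumes s: "0 < s" "s < 1"
    and [measurable]: "\<And>n. f n \<in> borel_measurable borel" "g \<in> borel_measurable borel"
    and lim: "\<And>x. (\<lambda>n. f n x) \<longlonglongrightarrow> g x"
    and B: "\<And>n x \<eta>. \<eta> > 0 \<Longrightarrow> \<bar>f n (x + \<eta>) + f n (x - \<eta>) - 2 * f n x\<bar> \<le> B * trunc_sq \<eta>"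
  shows "(\<lambda>n. frac_gen s (f n) x) \<longlonglongrightarrow> frac_gen s g x"
  unfolding frac_gen_def
proof (intro tendsto_mult_left integral_dominated_convergence[where w="\<lambda>\<eta>. B * trunc_sq \<eta>"])
  show "AE \<eta> in levy_measure s. norm (f n (x + \<eta>) + f n (x - \<eta>) - 2 * f n x) \<le> B * trunc_sq \<eta>" for n
    using AE_levy_measure by eventually_elim (simp add: B)
qed (use integrable_trunc_sq[OF s] in \<open>auto intro!: tendsto_intros lim\<close>)

lemma integral_second_difference:
  fixes a b c :: "'a \<Rightarrow> real"
  assumes "integrable M a" "integrable M b" "integrable M c"
  shows "integral\<^sup>L M a + integral\<^sup>L M b - 2 * integral\<^sup>L M c = (LINT x|M. a x + b x - 2 * c x)"
  using assms by simp

section \<open>Superpositions of cosines\<close>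

lemma measurable_fst_snd_borel[measurable]:
  "(fst :: real \<times> real \<Rightarrow> real) \<in> borel_measurable borel" "(snd :: real \<times> real \<Rightarrow> real) \<in> borel_measurable borel"
  by (auto intro!: borel_measurable_continuous_onI continuous_intros)

text \<open>A point \<open>p\<close> consists of a centre \<open>fst p\<close> and a frequency
  \<open>snd p\<close>. Keeping the centre as a second variable makes everything real-valued and
  avoids forming a Fourier transform of the represented function.\<close>

definition cos_superposition :: "(real \<times> real \<Rightarrow> real) \<Rightarrow> real \<Rightarrow> real" where
  "cos_superposition H x = (LINT p|lborel. H p * cos (snd p * (x - fst p)))"

lemma cos_superposition_measurable[measurable]:
  assumes [measurable]: "H \<in> borel_measurable borel"
  shows "cos_superposition H \<in> borel_measurable borel"
  unfolding cos_superposition_def by measurable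

lemma cos_superposition_integrable:
  fixes H :: "real \<times> real \<Rightarrow> real"
  assumes "integrable lborel H"
  shows "integrable lborel (\<lambda>p. H p * cos (snd p * (x - fst p)))"
proof -
  have "integrable lborel (\<lambda>p. cos (snd p * (x - fst p)) * H p)"
    using assms by (rule integrable_bounded_mult[where B=1]) auto
  then show ?thesis by (simp add: mult.commute)
qed

lemma heat_sg_cos_superposition:
  assumes s: "1/2 < s" "s < 1" "t \<ge> 0" and H: "integrable lborel H"
  shows "heat_sg s t (cos_superposition H) x = cos_superposition (\<lambda>p. H p * heat_symbol s t (snd p)) x"
proof -
  interpret L: prob_space "heat_law s t" by (rule prob_space_heat_law[OF s])
  interpret P: pair_sigma_finite "heat_law s t" "lborel :: (real \<times> real) measure" ..
  have [measurable]: "H \<in> borel_measurable borel" using H by auto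
  have int: "integrable (heat_law s t \<Otimes>\<^sub>M lborel) (\<lambda>(z, p). H p * cos (snd p * (x - z - fst p)))"
  proof (rule integrable_pair_bound[OF _ _ _ integrable_abs[OF H], of _ "\<lambda>_. 1"])
    show "\<bar>(\<lambda>(z, p). H p * cos (snd p * (x - z - fst p))) (z, p)\<bar> \<le> 1 * \<bar>H p\<bar>" for z p
      by (auto simp: abs_mult intro!: mult_left_le)
  qed (auto intro: L.sigma_finite_measure_axioms lborel.sigma_finite_measure_axioms)
  have "heat_sg s t (cos_superposition H) x = (LINT z|heat_law s t. LINT p|lborel. H p * cos (snd p * (x - z - fst p)))"
    by (simp add: heat_sg_def cos_superposition_def)
  also have "\<dots> = (LINT p|lborel. LINT z|heat_law s t. H p * cos (snd p * (x - z - fst p)))"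
    using P.Fubini_integral[OF int] by simp
  also have "\<dots> = (LINT p|lborel. H p * heat_symbol s t (snd p) * cos (snd p * (x - fst p)))"
  proof (rule Bochner_Integration.integral_cong[OF refl])
    fix p :: "real \<times> real"
    have "(LINT z|heat_law s t. cos (snd p * (x - z - fst p))) = heat_symbol s t (snd p) * cos (snd p * (x - fst p))"
      using heat_law_cos[OF s, of "snd p" "x - fst p"] by (simp add: algebra_simps)
    then show "(LINT z|heat_law s t. H p * cos (snd p * (x - z - fst p))) = H p * heat_symbol s t (snd p) * cos (snd p * (x - fst p))"
      by (simp add: mult.assoc)
  qed
  finally show ?thesis by (simp add: cos_superposition_def)
qed

text \<open>The second difference of a cosine is the cosine itself times
  \<open>- 2 * (1 - cos (snd p * \<eta>))\<close>, and its jump integral is known from the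
  computation of the normalising constant. The quadratic moment of \<open>H\<close> in the frequency
  justifies Fubini.\<close>

lemma frac_gen_cos_superposition:
  assumes s: "0 < s" "s < 1" and H: "integrable lborel H" "integrable lborel (\<lambda>p. H p * (2 + (snd p)\<^sup>2))"
  shows "frac_gen s (cos_superposition H) x = cos_superposition (\<lambda>p. - H p * \<bar>snd p\<bar> powr (2 * s)) x"
proof -
  interpret L: sigma_finite_measure "levy_measure s" by (rule sigma_finite_levy_measure)
  interpret P: pair_sigma_finite "levy_measure s" "lborel :: (real \<times> real) measure" ..
  have [measurable]: "H \<in> borel_measurable borel" using H by auto
  let ?c = "\<lambda>p. cos (snd p * (x - fst p)) :: real"
  let ?F = "\<lambda>\<eta> p. - 2 * (1 - cos (snd p * \<eta>)) * (H p * ?c p)"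
  have int: "integrable (levy_measure s \<Otimes>\<^sub>M lborel) (\<lambda>(\<eta>, p). ?F \<eta> p)"
  proof (rule integrable_pair_bound[OF _ _ integrable_trunc_sq[OF s] integrable_mult_right[OF integrable_abs[OF H(2)], of 2]])
    fix \<eta> :: real and p :: "real \<times> real"
    have gen: "\<bar>- 2 * a * (b * c)\<bar> \<le> T * (2 * \<bar>b * G\<bar>)"
      if "\<bar>a\<bar> \<le> G * T" "\<bar>c\<bar> \<le> 1" "G \<ge> 0" "T \<ge> 0" for a b c G T :: real
    proof -
      have "(\<bar>a\<bar> * \<bar>c\<bar>) * (2 * \<bar>b\<bar>) \<le> ((G * T) * 1) * (2 * \<bar>b\<bar>)"
        using that by (intro mult_right_mono mult_mono) auto
      then show ?thesis using that(3) by (simp add: abs_mult mult_ac)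
    qed
    show "\<bar>(\<lambda>(\<eta>, p). ?F \<eta> p) (\<eta>, p)\<bar> \<le> trunc_sq \<eta> * (2 * \<bar>H p * (2 + (snd p)\<^sup>2)\<bar>)"
      unfolding prod.case by (rule gen[OF one_minus_cos_mult_bound]) auto
  qed (auto intro: L.sigma_finite_measure_axioms lborel.sigma_finite_measure_axioms)
  have "cos_superposition H (x + \<eta>) + cos_superposition H (x - \<eta>) - 2 * cos_superposition H x = (LINT p|lborel. ?F \<eta> p)" for \<eta>
  proof -
    have "cos_superposition H (x + \<eta>) + cos_superposition H (x - \<eta>) - 2 * cos_superposition H x =
      (LINT p|lborel. H p * cos (snd p * (x + \<eta> - fst p)) + H p * cos (snd p * (x - \<eta> - fst p)) - 2 * (H p * ?c p))"
      unfolding cos_superposition_def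
      by (intro integral_second_difference cos_superposition_integrable H(1))
    also have "\<dots> = (LINT p|lborel. ?F \<eta> p)"
    proof (rule Bochner_Integration.integral_cong[OF refl])
      fix p :: "real \<times> real"
      have "snd p * (x + \<eta> - fst p) = snd p * (x - fst p) + snd p * \<eta>"
        "snd p * (x - \<eta> - fst p) = snd p * (x - fst p) - snd p * \<eta>"
        by (simp_all add: algebra_simps)
      then show "H p * cos (snd p * (x + \<eta> - fst p)) + H p * cos (snd p * (x - \<eta> - fst p)) - 2 * (H p * ?c p) = ?F \<eta> p"
        by (simp only: cos_add cos_diff) (simp add: algebra_simps)
    qed
    finally show ?thesis .
  qed
  then have "frac_gen s (cos_superposition H) x = frac_const s * (LINT \<eta>|levy_measure s. LINT p|lborel. ?F \<eta> p)"
    by (simp add: frac_gen_def)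
  also have "(LINT \<eta>|levy_measure s. LINT p|lborel. ?F \<eta> p) = (LINT p|lborel. LINT \<eta>|levy_measure s. ?F \<eta> p)"
    using P.Fubini_integral[OF int] by simp
  also have "frac_const s * \<dots> = (LINT p|lborel. frac_const s * (LINT \<eta>|levy_measure s. ?F \<eta> p))"
    by simp
  also have "\<dots> = (LINT p|lborel. - H p * \<bar>snd p\<bar> powr (2 * s) * ?c p)"
  proof (rule Bochner_Integration.integral_cong[OF refl])
    fix p :: "real \<times> real"
    have "(LINT \<eta>|levy_measure s. ?F \<eta> p) = - 2 * (LINT \<eta>|levy_measure s. 1 - cos (snd p * \<eta>)) * (H p * ?c p)"
      by (simp only: Bochner_Integration.integral_mult_left_zero Bochner_Integration.integral_mult_right_zero)
    then have "frac_const s * (LINT \<eta>|levy_measure s. ?F \<eta> p) = - (frac_const s * (2 * (LINT \<eta>|levy_measure s. 1 - cos (snd p * \<eta>)))) * (H p * ?c p)"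
      by (simp only:) (simp only: mult_minus_left mult_minus_right mult.assoc)
    then show "frac_const s * (LINT \<eta>|levy_measure s. ?F \<eta> p) = - H p * \<bar>snd p\<bar> powr (2 * s) * ?c p"
      unfolding frac_const_levy_cos[OF s] by simp
  qed
  finally show ?thesis
    unfolding cos_superposition_def[of "\<lambda>p. - H p * \<bar>snd p\<bar> powr (2 * s)"] .
qed

lemma powr_2s_le:
  fixes \<xi> :: real
  assumes "0 < s" "s < 1"
  shows "\<bar>\<xi>\<bar> powr (2 * s) \<le> 2 + \<xi>\<^sup>2"
proof (cases "\<bar>\<xi>\<bar> \<le> 1")
  case True
  have "\<bar>\<xi>\<bar> powr (2 * s) \<le> 1 powr (2 * s)"
    using True assms by (intro powr_mono2) auto
  then show ?thesis by simp (smt (verit) zero_le_power2)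
next
  case False
  then have "\<bar>\<xi>\<bar> powr (2 * s) \<le> \<bar>\<xi>\<bar> powr 2"
    using assms by (intro powr_mono) auto
  then show ?thesis using False by simp
qed

lemma integral_exp_decay:
  fixes l t :: real
  assumes "t \<ge> 0"
  shows "(LBINT r:{0<..t}. - l * exp (- l * r)) = exp (- l * t) - 1"
proof -
  have "(LBINT r:{0<..t}. - l * exp (- l * r)) = (LBINT r:{0..t}. - l * exp (- l * r))"
    unfolding set_lebesgue_integral_def
  proof (rule integral_cong_AE)
    show "AE r in lborel. indicator {0<..t} r *\<^sub>R (- l * exp (- l * r)) = indicator {0..t} r *\<^sub>R (- l * exp (- l * r))"
      using AE_lborel_singleton[of "0::real"] by eventually_elim (auto simp: indicator_def)
  qed auto
  also have "\<dots> = (LBINT r. (- l * exp (- l * r)) * indicator {0..t} r)"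
    by (simp add: set_lebesgue_integral_def mult.commute)
  also have "\<dots> = exp (- l * t) - exp (- l * 0)"
    by (rule integral_FTC_Icc_real[OF assms]) (auto intro!: derivative_eq_intros)
  finally show ?thesis by simp
qed

text \<open>For a single frequency with \<open>l = \<bar>\<xi>\<bar> powr (2 * s)\<close> the claim
  is the fundamental theorem of calculus for \<open>exp (- l * r)\<close>. Fubini superposes these
  identities; it applies since \<open>H * l\<close> is integrable by the quadratic moment.\<close>

lemma generator_identity_cos:
  assumes s: "1/2 < s" "s < 1" "t \<ge> 0"
    and H: "integrable lborel H" "integrable lborel (\<lambda>p. H p * (2 + (snd p)\<^sup>2))"
  shows "heat_sg s t (cos_superposition H) x - cos_superposition H x =
    (LBINT r:{0<..t}. heat_sg s r (frac_gen s (cos_superposition H)) x)"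
proof -
  have [measurable]: "H \<in> borel_measurable borel" using H by auto
  have s0: "0 < s" using s by simp
  let ?c = "\<lambda>p. cos (snd p * (x - fst p)) :: real"
  let ?l = "\<lambda>p::real \<times> real. \<bar>snd p\<bar> powr (2 * s)"
  have HL: "integrable lborel (\<lambda>p. - H p * ?l p)"
  proof (rule Bochner_Integration.integrable_bound[OF H(2)])
    have "\<bar>H p\<bar> * \<bar>?l p\<bar> \<le> \<bar>H p\<bar> * \<bar>2 + (snd p)\<^sup>2\<bar>" for p :: "real \<times> real"
      using powr_2s_le[OF s0 s(2), of "snd p"] by (intro mult_left_mono) auto
    then show "AE p in lborel. norm (- H p * ?l p) \<le> norm (H p * (2 + (snd p)\<^sup>2))"
      by (auto simp: abs_mult)
  qed auto
  have Hphi: "integrable lborel (\<lambda>p. H p * heat_symbol s t (snd p))"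
  proof -
    have "integrable lborel (\<lambda>p. heat_symbol s t (snd p) * H p)"
      using H(1) by (rule integrable_bounded_mult[where B=1]) (use s(3) in auto)
    then show ?thesis by (simp add: mult.commute)
  qed
  let ?F = "\<lambda>r p. indicator {0<..t} r * ((- ?l p) * exp (- ?l p * r)) * (H p * ?c p)"
  have int: "integrable (lborel \<Otimes>\<^sub>M lborel) (\<lambda>(r, p). ?F r p)"
  proof (rule integrable_pair_bound[OF _ _ _ integrable_abs[OF HL], of _ "\<lambda>r. indicator {0<..t} r"])
    fix r :: real and p :: "real \<times> real"
    show "\<bar>(\<lambda>(r, p). ?F r p) (r, p)\<bar> \<le> indicator {0<..t} r * \<bar>- H p * ?l p\<bar>"
    proof (cases "r \<in> {0<..t}")
      case True
      have "(exp (- ?l p * r) * \<bar>?c p\<bar>) * (\<bar>H p\<bar> * ?l p) \<le> (1 * 1) * (\<bar>H p\<bar> * ?l p)"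
        using True by (intro mult_right_mono mult_mono) auto
      then show ?thesis using True by (simp add: abs_mult mult_ac)
    qed simp
  qed (use s(3) in \<open>auto intro!: integrable_real_indicator emeasure_lborel_Ioc[THEN eq_refl, THEN le_less_trans] lborel.sigma_finite_measure_axioms\<close>)
  have "(LBINT r:{0<..t}. heat_sg s r (frac_gen s (cos_superposition H)) x) =
    (LBINT r. LINT p|lborel. ?F r p)"
    unfolding set_lebesgue_integral_def
  proof (rule Bochner_Integration.integral_cong[OF refl])
    fix r :: real
    show "indicator {0<..t} r *\<^sub>R heat_sg s r (frac_gen s (cos_superposition H)) x = (LINT p|lborel. ?F r p)"
    proof (cases "r \<in> {0<..t}")
      case True
      have "frac_gen s (cos_superposition H) = cos_superposition (\<lambda>p. - H p * ?l p)"
        using frac_gen_cos_superposition[OF s0 s(2) H] by blast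
      then have "heat_sg s r (frac_gen s (cos_superposition H)) x = cos_superposition (\<lambda>p. - H p * ?l p * heat_symbol s r (snd p)) x"
        using heat_sg_cos_superposition[OF s(1,2) _ HL, of r] True by auto
      also have "\<dots> = (LINT p|lborel. ?F r p)"
        unfolding cos_superposition_def using True
        by (intro Bochner_Integration.integral_cong[OF refl]) (simp add: mult_ac)
      finally show ?thesis using True by simp
    qed simp
  qed
  also have "\<dots> = (LINT p|lborel. (LBINT r. ?F r p))"
    using lborel_pair.Fubini_integral[OF int] by simp
  also have "\<dots> = (LINT p|lborel. H p * heat_symbol s t (snd p) * ?c p - H p * ?c p)"
  proof (rule Bochner_Integration.integral_cong[OF refl])
    fix p :: "real \<times> real"
    have "(LBINT r. ?F r p) = (LBINT r:{0<..t}. (- ?l p) * exp (- ?l p * r)) * (H p * ?c p)"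
      unfolding set_lebesgue_integral_def by (simp only: Bochner_Integration.integral_mult_left_zero real_scaleR_def)
    also have "\<dots> = (exp (- ?l p * t) - 1) * (H p * ?c p)"
      using integral_exp_decay[OF s(3), of "?l p"] by simp
    also have "\<dots> = H p * heat_symbol s t (snd p) * ?c p - H p * ?c p"
      by (simp add: left_diff_distrib)
    finally show "(LBINT r. ?F r p) = H p * heat_symbol s t (snd p) * ?c p - H p * ?c p" .
  qed
  also have "\<dots> = cos_superposition (\<lambda>p. H p * heat_symbol s t (snd p)) x - cos_superposition H x"
    unfolding cos_superposition_def
    by (intro Bochner_Integration.integral_diff cos_superposition_integrable Hphi H)
  finally show ?thesis using heat_sg_cos_superposition[OF s H(1)] by simp
qed

text \<open>For positive \<open>\<sigma>\<close> this is convolution with the normal density of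
  standard deviation \<open>\<sigma>\<close>, written over the fixed standard density so that the
  limit \<open>\<sigma> \<rightarrow> 0\<close> is taken under one measure.\<close>

definition mollify :: "real \<Rightarrow> (real \<Rightarrow> real) \<Rightarrow> real \<Rightarrow> real" where
  "mollify \<sigma> h x = (LBINT z. std_normal_density z * h (x - \<sigma> * z))"

lemma mollify_integrable:
  fixes h :: "real \<Rightarrow> real"
  assumes [measurable]: "h \<in> borel_measurable borel" and B: "\<And>x. \<bar>h x\<bar> \<le> B"
  shows "integrable lborel (\<lambda>z. std_normal_density z * h (x - \<sigma> * z))"
proof -
  have "integrable lborel (\<lambda>z. h (x - \<sigma> * z) * std_normal_density z)"
    by (rule integrable_bounded_mult[where B=B]) (use B in auto)
  then show ?thesis by (simp add: mult.commute)
qed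

lemma mollify_abs_bound:
  fixes h :: "real \<Rightarrow> real"
  assumes [measurable]: "h \<in> borel_measurable borel" and B: "\<And>x. \<bar>h x\<bar> \<le> B"
  shows "\<bar>mollify \<sigma> h x\<bar> \<le> B"
proof -
  have "\<bar>mollify \<sigma> h x\<bar> \<le> (LBINT z. \<bar>std_normal_density z * h (x - \<sigma> * z)\<bar>)"
    unfolding mollify_def by (rule integral_abs_bound)
  also have "\<dots> \<le> (LBINT z. std_normal_density z * B)"
    using integrable_abs[OF mollify_integrable[OF assms, of x \<sigma>]] B
    by (intro integral_mono) (auto simp: abs_mult intro!: mult_left_mono)
  finally show ?thesis by simp
qed

lemma mollify_measurable[measurable]:
  assumes [measurable]: "h \<in> borel_measurable borel"
  shows "mollify \<sigma> h \<in> borel_measurable borel"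
  unfolding mollify_def by measurable

text \<open>Mollification is an average of translates, hence commutes with second differences; the
  bound is uniform in \<open>\<sigma>\<close>.\<close>

lemma mollify_second_difference:
  assumes "C2_bounded M h" "\<eta> > 0"
  shows "\<bar>mollify \<sigma> h (x + \<eta>) + mollify \<sigma> h (x - \<eta>) - 2 * mollify \<sigma> h x\<bar> \<le> 4 * M * trunc_sq \<eta>"
proof -
  note [measurable] = C2_bounded_measurable[OF assms(1)]
  let ?D = "\<lambda>y. h (y + \<eta>) + h (y - \<eta>) - 2 * h y"
  note i = mollify_integrable[OF C2_bounded_measurable[OF assms(1)] C2_bounded_abs[OF assms(1)]]
  have "mollify \<sigma> h (x + \<eta>) + mollify \<sigma> h (x - \<eta>) - 2 * mollify \<sigma> h x =
      (LBINT z. std_normal_density z * h (x + \<eta> - \<sigma> * z) + std_normal_density z * h (x - \<eta> - \<sigma> * z)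
        - 2 * (std_normal_density z * h (x - \<sigma> * z)))"
    unfolding mollify_def by (intro integral_second_difference i)
  also have "\<dots> = mollify \<sigma> ?D x"
    unfolding mollify_def by (intro Bochner_Integration.integral_cong) (simp_all add: algebra_simps)
  also have "\<bar>\<dots>\<bar> \<le> 4 * M * trunc_sq \<eta>"
    by (rule mollify_abs_bound) (use C2_bounded_second_difference[OF assms] in auto)
  finally show ?thesis .
qed

text \<open>The Gaussian is itself a superposition of cosines.\<close>

lemma mollify_eq_cos_superposition:
  fixes h :: "real \<Rightarrow> real"
  assumes h: "integrable lborel h" and \<sigma>: "\<sigma> > 0"
  defines "H \<equiv> \<lambda>p. h (fst p) * (exp (- (\<sigma>\<^sup>2 / 2) * (snd p)\<^sup>2) / (2 * pi))"
  shows "integrable lborel H" "integrable lborel (\<lambda>p. H p * (2 + (snd p)\<^sup>2))"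
    "mollify \<sigma> h = cos_superposition H"
proof -
  have [measurable]: "h \<in> borel_measurable borel" using h by auto
  have G0: "integrable lborel (\<lambda>\<xi>::real. exp (- (\<sigma>\<^sup>2 / 2) * \<xi>\<^sup>2))"
    using \<sigma> by (intro integrable_exp_sq) auto
  have G2: "integrable lborel (\<lambda>\<xi>::real. exp (- (\<sigma>\<^sup>2 / 2) * \<xi>\<^sup>2) * \<xi>\<^sup>2)"
  proof -
    have "integrable lborel (\<lambda>z. sqrt (2 * pi) / \<sigma>\<^sup>2 * (std_normal_density (0 + \<sigma> * z) * (0 + \<sigma> * z)\<^sup>2))"
      using integrable_std_normal_moment[of 2] \<sigma>
      by (intro integrable_mult_right lborel_integrable_real_affine) auto
    then show ?thesis
      using \<sigma> by (simp add: std_normal_density_def power_mult_distrib mult_ac)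
  qed
  have G: "integrable lborel (\<lambda>\<xi>::real. exp (- (\<sigma>\<^sup>2 / 2) * \<xi>\<^sup>2) * (2 + \<xi>\<^sup>2))"
    using G0 G2 by (simp add: distrib_left)
  have H2: "integrable (lborel \<Otimes>\<^sub>M lborel) (\<lambda>p. H p * (2 + (snd p)\<^sup>2))"
  proof (rule integrable_pair_bound[OF _ _ integrable_abs[OF h] G])
    fix x \<xi> :: real
    have "1 / (2 * pi) \<le> 1" using pi_ge_two by simp
    then have "(\<bar>h x\<bar> * (exp (- (\<sigma>\<^sup>2 / 2) * \<xi>\<^sup>2) * (2 + \<xi>\<^sup>2))) * (1 / (2 * pi)) \<le> (\<bar>h x\<bar> * (exp (- (\<sigma>\<^sup>2 / 2) * \<xi>\<^sup>2) * (2 + \<xi>\<^sup>2))) * 1"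
      by (intro mult_left_mono) auto
    then show "\<bar>H (x, \<xi>) * (2 + (snd (x, \<xi>))\<^sup>2)\<bar> \<le> \<bar>h x\<bar> * (exp (- (\<sigma>\<^sup>2 / 2) * \<xi>\<^sup>2) * (2 + \<xi>\<^sup>2))"
      by (simp add: H_def abs_mult)
  qed (auto simp: H_def intro: lborel.sigma_finite_measure_axioms)
  then show 2: "integrable lborel (\<lambda>p. H p * (2 + (snd p)\<^sup>2))"
    by (simp add: lborel_prod)
  show 1: "integrable lborel H"
  proof (rule Bochner_Integration.integrable_bound[OF 2])
    have "\<bar>H p\<bar> * 1 \<le> \<bar>H p\<bar> * \<bar>2 + (snd p)\<^sup>2\<bar>" for p
      by (intro mult_left_mono) (auto intro: order_trans[OF _ abs_ge_self])
    then show "AE p in lborel. norm (H p) \<le> norm (H p * (2 + (snd p)\<^sup>2))"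
      by (auto simp: abs_mult)
  qed (auto simp: H_def)
  show "mollify \<sigma> h = cos_superposition H"
  proof
    fix x
    define N where "N y = std_normal_density (y / \<sigma>) / \<sigma>" for y
    have N: "(LBINT \<xi>. exp (- (\<sigma>\<^sup>2 / 2) * \<xi>\<^sup>2) / (2 * pi) * cos (\<xi> * y)) = N y" for y
    proof -
      have "(LBINT \<xi>. exp (- (\<sigma>\<^sup>2 / 2) * \<xi>\<^sup>2) / (2 * pi) * cos (\<xi> * y)) = (LBINT \<xi>. cos (y * \<xi>) * exp (- (\<sigma>\<^sup>2 / 2) * \<xi>\<^sup>2)) / (2 * pi)"
        by (simp add: mult.commute)
      also have "\<dots> = sqrt (pi / (\<sigma>\<^sup>2 / 2)) * exp (- y\<^sup>2 / (4 * (\<sigma>\<^sup>2 / 2))) / (2 * pi)"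
        using \<sigma> by (subst integral_gauss_cos) auto
      also have "sqrt (pi / (\<sigma>\<^sup>2 / 2)) = 2 * pi / sqrt (2 * pi) / \<sigma>"
        using \<sigma> by (simp add: real_sqrt_divide real_div_sqrt mult.commute)
      finally show ?thesis
        by (simp add: N_def std_normal_density_def power_divide)
    qed
    have "cos_superposition H x = (LINT p|(lborel \<Otimes>\<^sub>M lborel). H p * cos (snd p * (x - fst p)))"
      by (simp add: cos_superposition_def lborel_prod)
    also have "\<dots> = (LBINT y. LBINT \<xi>. H (y, \<xi>) * cos (\<xi> * (x - y)))"
    proof -
      have "integrable (lborel \<Otimes>\<^sub>M lborel) (\<lambda>(y, \<xi>). H (y, \<xi>) * cos (\<xi> * (x - y)))"
        using cos_superposition_integrable[OF 1, of x] by (simp add: lborel_prod case_prod_beta')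
      from lborel_pair.integral_fst[OF this] show ?thesis by (simp add: case_prod_beta')
    qed
    also have "\<dots> = (LBINT y. h y * N (x - y))"
    proof (rule Bochner_Integration.integral_cong[OF refl])
      fix y
      have "(LBINT \<xi>. H (y, \<xi>) * cos (\<xi> * (x - y))) = (LBINT \<xi>. h y * (exp (- (\<sigma>\<^sup>2 / 2) * \<xi>\<^sup>2) / (2 * pi) * cos (\<xi> * (x - y))))"
        by (simp add: H_def mult.assoc)
      then show "(LBINT \<xi>. H (y, \<xi>) * cos (\<xi> * (x - y))) = h y * N (x - y)"
        by (simp only: Bochner_Integration.integral_mult_right_zero N)
    qed
    also have "\<dots> = \<bar>- \<sigma>\<bar> *\<^sub>R (LBINT z. h (x + (- \<sigma>) * z) * N (x - (x + (- \<sigma>) * z)))"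
      by (rule lborel_integral_real_affine) (use \<sigma> in auto)
    also have "\<dots> = mollify \<sigma> h x"
      using \<sigma> by (simp add: N_def mollify_def mult.commute)
    finally show "mollify \<sigma> h x = cos_superposition H x" ..
  qed
qed

section \<open>The generator identity and smooth bounded functions\<close>

lemma gauss_cutoff_bounds:
  fixes a :: real
  shows "\<bar>a\<bar> * exp (- a\<^sup>2) \<le> 1" "a\<^sup>2 * exp (- a\<^sup>2) \<le> 1"
proof -
  have e: "1 + a\<^sup>2 \<le> exp (a\<^sup>2)" by (rule exp_ge_add_one_self)
  have "0 \<le> (\<bar>a\<bar> - 1 / 2)\<^sup>2" by simp
  also have "(\<bar>a\<bar> - 1 / 2)\<^sup>2 = a\<^sup>2 - \<bar>a\<bar> + 1 / 4" by (simp add: power2_diff power_divide)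
  finally have "\<bar>a\<bar> \<le> 1 + a\<^sup>2" by linarith
  then have "\<bar>a\<bar> \<le> exp (a\<^sup>2)" using e by linarith
  then show "\<bar>a\<bar> * exp (- a\<^sup>2) \<le> 1" by (simp add: exp_minus field_simps)
  have "a\<^sup>2 \<le> exp (a\<^sup>2)" using e by linarith
  then show "a\<^sup>2 * exp (- a\<^sup>2) \<le> 1" by (simp add: exp_minus field_simps)
qed

text \<open>The constant is \<open>11 = 1 + 2 * 2 + 6\<close>: the Leibniz rule for the second
  derivative, with the cutoff \<open>W\<close> and its derivatives bounded by 1, 2 and 6. The
  condition \<open>k \<le> 1\<close> keeps these bounds uniform as the cutoff widens.\<close>

lemma C2_bounded_gauss_cutoff:
  assumes f: "C2_bounded M f" and k: "0 \<le> k" "k \<le> 1"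
  shows "C2_bounded (11 * M) (\<lambda>y. f y * exp (- (k * y)\<^sup>2))"
proof -
  obtain f' f'' where d: "\<And>x. (f has_real_derivative f' x) (at x)" "\<And>x. (f' has_real_derivative f'' x) (at x)"
     and b: "\<And>x. \<bar>f x\<bar> \<le> M" "\<And>x. \<bar>f' x\<bar> \<le> M" "\<And>x. \<bar>f'' x\<bar> \<le> M"
    using f unfolding C2_bounded_def by metis
  have M: "M \<ge> 0" using b(1)[of 0] by linarith
  define W where "W y = exp (- (k * y)\<^sup>2)" for y
  define W1 where "W1 y = - 2 * k * (k * y) * W y" for y
  define W2 where "W2 y = (4 * k\<^sup>2 * (k * y)\<^sup>2 - 2 * k\<^sup>2) * W y" for y
  have dW: "(W has_real_derivative W1 y) (at y)" for y
    unfolding W_def W1_def by (auto intro!: derivative_eq_intros simp: power2_eq_square algebra_simps)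
  have dW1: "(W1 has_real_derivative W2 y) (at y)" for y
    unfolding W1_def W2_def using dW[of y]
    by (auto intro!: derivative_eq_intros simp: W1_def power2_eq_square algebra_simps)
  have bW: "\<bar>W y\<bar> \<le> 1" for y by (simp add: W_def)
  have k2: "k\<^sup>2 \<le> 1" using k by (simp add: power_le_one)
  have bW1: "\<bar>W1 y\<bar> \<le> 2" for y
  proof -
    have "\<bar>W1 y\<bar> = 2 * (k * (\<bar>k * y\<bar> * exp (- (k * y)\<^sup>2)))"
      using k by (simp add: W1_def W_def abs_mult)
    also have "\<dots> \<le> 2 * (1 * 1)"
      using k gauss_cutoff_bounds(1)[of "k * y"] by (intro mult_left_mono mult_mono) auto
    finally show ?thesis by simp
  qed
  have bW2: "\<bar>W2 y\<bar> \<le> 6" for y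
  proof -
    have "\<bar>W2 y\<bar> \<le> \<bar>4 * (k\<^sup>2 * ((k * y)\<^sup>2 * exp (- (k * y)\<^sup>2)))\<bar> + \<bar>2 * (k\<^sup>2 * exp (- (k * y)\<^sup>2))\<bar>"
      unfolding W2_def W_def by (rule order_trans[OF _ abs_triangle_ineq4]) (simp add: algebra_simps)
    moreover have "\<bar>4 * (k\<^sup>2 * ((k * y)\<^sup>2 * exp (- (k * y)\<^sup>2)))\<bar> = 4 * (k\<^sup>2 * ((k * y)\<^sup>2 * exp (- (k * y)\<^sup>2)))"
      by (simp add: abs_mult)
    moreover have "k\<^sup>2 * ((k * y)\<^sup>2 * exp (- (k * y)\<^sup>2)) \<le> 1 * 1"
      using k2 gauss_cutoff_bounds(2)[of "k * y"] by (intro mult_mono) auto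
    moreover have "k\<^sup>2 * exp (- (k * y)\<^sup>2) \<le> 1 * 1"
      using k2 by (intro mult_mono) auto
    ultimately show ?thesis by (simp add: abs_mult)
  qed
  have m: "\<bar>a * b\<bar> \<le> M * c" if "\<bar>a\<bar> \<le> M" "\<bar>b\<bar> \<le> c" for a b c
    unfolding abs_mult using that by (intro mult_mono) auto
  show ?thesis unfolding C2_bounded_def W_def[symmetric]
  proof (rule exI[of _ "\<lambda>y. f' y * W y + f y * W1 y"], rule exI[of _ "\<lambda>y. f'' y * W y + 2 * (f' y * W1 y) + f y * W2 y"], intro allI conjI)
    fix y
    show "((\<lambda>y. f y * W y) has_real_derivative f' y * W y + f y * W1 y) (at y)"
      using DERIV_mult[OF d(1) dW, of y] by (simp add: algebra_simps)
    show "((\<lambda>y. f' y * W y + f y * W1 y) has_real_derivative f'' y * W y + 2 * (f' y * W1 y) + f y * W2 y) (at y)"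
      using DERIV_add[OF DERIV_mult[OF d(2) dW] DERIV_mult[OF d(1) dW1], of y] by (simp add: algebra_simps)
    show "\<bar>f y * W y\<bar> \<le> 11 * M" using m[OF b(1) bW, of y y] M by simp
    show "\<bar>f' y * W y + f y * W1 y\<bar> \<le> 11 * M"
      using m[OF b(2) bW, of y y] m[OF b(1) bW1, of y y] M by simp
    show "\<bar>f'' y * W y + 2 * (f' y * W1 y) + f y * W2 y\<bar> \<le> 11 * M"
      using m[OF b(3) bW, of y y] m[OF b(2) bW1, of y y] m[OF b(1) bW2, of y y] M by simp
  qed
qed

text \<open>The cutoff makes \<open>f\<close> integrable and the mollification gives rapid decay in
  frequency, so each \<open>g n\<close> is an admissible superposition of cosines. The bounds on
  \<open>g n\<close> and on its second differences are independent of \<open>n\<close>, hence every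
  term of the identity passes to the limit by dominated convergence.\<close>

lemma generator_identity:
  assumes s: "1/2 < s" "s < 1" "t \<ge> 0" and f: "C2_bounded M f"
  shows "heat_sg s t f x - f x = (LBINT r:{0<..t}. heat_sg s r (frac_gen s f) x)"
proof -
  have s0: "0 < s" using s by simp
  note fm[measurable] = C2_bounded_measurable[OF f]
  \<comment> \<open>The same parameter is the inverse width of the cutoff and the scale of the
    mollifier.\<close>
  define k where "k n = 1 / real (Suc n)" for n
  have k: "k n > 0" "k n \<le> 1" for n by (auto simp: k_def)
  define h where "h n y = f y * exp (- (k n * y)\<^sup>2)" for n y
  define g where "g n = mollify (k n) (h n)" for n
  have h: "C2_bounded (11 * M) (h n)" for n
    unfolding h_def[abs_def] by (rule C2_bounded_gauss_cutoff[OF f]) (use k[of n] in auto)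
  note hm[measurable] = C2_bounded_measurable[OF h]
  have hi: "integrable lborel (h n)" for n
  proof -
    have "integrable lborel (\<lambda>y. f y * exp (- ((k n)\<^sup>2) * y\<^sup>2))"
      using C2_bounded_abs[OF f] k[of n] by (intro integrable_bounded_mult[where B=M] integrable_exp_sq) auto
    then show ?thesis by (simp add: h_def[abs_def] power_mult_distrib)
  qed
  have gm[measurable]: "g n \<in> borel_measurable borel" for n unfolding g_def by measurable
  have gB: "\<bar>g n y\<bar> \<le> 11 * M" for n y
    unfolding g_def by (rule mollify_abs_bound[OF hm C2_bounded_abs[OF h]])
  have gD: "\<bar>g n (y + \<eta>) + g n (y - \<eta>) - 2 * g n y\<bar> \<le> 4 * (11 * M) * trunc_sq \<eta>" if "\<eta> > 0" for n y \<eta>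
    unfolding g_def by (rule mollify_second_difference[OF h that])
  have glim: "(\<lambda>n. g n y) \<longlonglongrightarrow> f y" for y
  proof -
    have "(\<lambda>n. LBINT z. std_normal_density z * h n (y - k n * z)) \<longlonglongrightarrow> (LBINT z. std_normal_density z * f y)"
    proof (rule integral_dominated_convergence[where w="\<lambda>z. std_normal_density z * (11 * M)"])
      show "AE z in lborel. (\<lambda>n. std_normal_density z * h n (y - k n * z)) \<longlonglongrightarrow> std_normal_density z * f y"
      proof (rule AE_I2)
        fix z
        have k0: "k \<longlonglongrightarrow> 0" unfolding k_def by real_asymp
        have 1: "(\<lambda>n. y - k n * z) \<longlonglongrightarrow> y"
          using tendsto_diff[OF tendsto_const[of y] tendsto_mult[OF k0 tendsto_const[of z]]] by simp
        have 2: "(\<lambda>n. exp (- (k n * (y - k n * z))\<^sup>2)) \<longlonglongrightarrow> 1"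
          using tendsto_exp[OF tendsto_minus[OF tendsto_power[OF tendsto_mult[OF k0 1], of 2]]] by simp
        have "isCont f y" using f unfolding C2_bounded_def by (meson DERIV_isCont)
        from isCont_tendsto_compose[OF this 1] 2
        have "(\<lambda>n. f (y - k n * z) * exp (- (k n * (y - k n * z))\<^sup>2)) \<longlonglongrightarrow> f y * 1"
          by (intro tendsto_mult)
        then show "(\<lambda>n. std_normal_density z * h n (y - k n * z)) \<longlonglongrightarrow> std_normal_density z * f y"
          unfolding h_def by (intro tendsto_mult_left) simp
      qed
      show "AE z in lborel. norm (std_normal_density z * h n (y - k n * z)) \<le> std_normal_density z * (11 * M)" for n
        using C2_bounded_abs[OF h] by (auto simp: abs_mult intro!: mult_left_mono)
    qed auto
    then show ?thesis by (simp add: g_def mollify_def)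
  qed
  have gid: "heat_sg s t (g n) x - g n x = (LBINT r:{0<..t}. heat_sg s r (frac_gen s (g n)) x)" for n
    unfolding g_def mollify_eq_cos_superposition(3)[OF hi k(1)]
    by (rule generator_identity_cos[OF s mollify_eq_cos_superposition(1,2)[OF hi k(1)]])
  define B where "B = levy_mass s * (4 * (11 * M))"
  have LB: "\<bar>frac_gen s (g n) y\<bar> \<le> B" for n y
    unfolding B_def by (rule frac_gen_bound(2)[OF s0 s(2) gm gD])
  have Llim: "(\<lambda>n. frac_gen s (g n) y) \<longlonglongrightarrow> frac_gen s f y" for y
    by (rule frac_gen_tendsto[OF s0 s(2) gm fm glim gD])
  have "(\<lambda>n. LBINT r:{0<..t}. heat_sg s r (frac_gen s (g n)) x) \<longlonglongrightarrow> (LBINT r:{0<..t}. heat_sg s r (frac_gen s f) x)"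
    unfolding set_lebesgue_integral_def
  proof (rule integral_dominated_convergence[where w="\<lambda>r. indicator {0<..t} r * B"])
    show "integrable lborel (\<lambda>r. indicator {0<..t} r * B)"
      using s(3) by (auto intro!: integrable_real_indicator emeasure_lborel_Ioc[THEN eq_refl, THEN le_less_trans])
    show "AE r in lborel. (\<lambda>n. indicator {0<..t} r *\<^sub>R heat_sg s r (frac_gen s (g n)) x) \<longlonglongrightarrow>
        indicator {0<..t} r *\<^sub>R heat_sg s r (frac_gen s f) x"
      using heat_sg_tendsto[OF s(1,2) _ _ _ Llim LB] by (auto simp: indicator_def)
    show "AE r in lborel. norm (indicator {0<..t} r *\<^sub>R heat_sg s r (frac_gen s (g n)) x) \<le> indicator {0<..t} r * B" for n
      using heat_sg_bound[OF s(1,2) _ LB] by (auto simp: indicator_def)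
  qed (use heat_sg_measurable_time[OF s(1,2)] in auto)
  moreover have "(\<lambda>n. heat_sg s t (g n) x - g n x) \<longlonglongrightarrow> heat_sg s t f x - f x"
    by (intro tendsto_diff heat_sg_tendsto[OF s _ _ glim gB] glim) auto
  ultimately show ?thesis
    unfolding gid by (rule LIMSEQ_unique[rotated])
qed

section \<open>Smooth bounded functions and translation-invariant operators\<close>

text \<open>The mean value inequality is applied to \<open>z \<mapsto> f z - z * f' y\<close>, whose
  derivative \<open>f' z - f' y\<close> is at most \<open>M * \<bar>h\<bar>\<close> on the
  segment.\<close>

lemma taylor_remainder_bound:
  fixes f f' f'' :: "real \<Rightarrow> real"
  assumes f: "\<And>x. (f has_real_derivative f' x) (at x)" "\<And>x. (f' has_real_derivative f'' x) (at x)"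
    and M: "\<And>x. \<bar>f'' x\<bar> \<le> M"
  shows "\<bar>f (y + h) - f y - h * f' y\<bar> \<le> M * h\<^sup>2"
proof -
  have M0: "M \<ge> 0" using M[of 0] by linarith
  have D: "\<bar>f' z - f' y\<bar> \<le> M * \<bar>h\<bar>" if "z \<in> closed_segment y (y + h)" for z
  proof -
    have "\<bar>f' z - f' y\<bar> \<le> M * \<bar>z - y\<bar>"
      by (rule deriv_bounded_lipschitz[OF f(2) M])
    also have "\<dots> \<le> M * \<bar>h\<bar>"
      using that M0 by (intro mult_left_mono) (auto simp: closed_segment_eq_real_ivl split: if_splits)
    finally show ?thesis .
  qed
  have "norm ((f (y + h) - (y + h) * f' y) - (f y - y * f' y)) \<le> (M * \<bar>h\<bar>) * norm ((y + h) - y)"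
  proof (rule field_differentiable_bound[where f="\<lambda>z. f z - z * f' y" and f'="\<lambda>z. f' z - f' y"
        and S="closed_segment y (y + h)"])
    fix z
    show "((\<lambda>z. f z - z * f' y) has_field_derivative f' z - f' y) (at z within closed_segment y (y + h))"
      by (auto intro!: derivative_eq_intros DERIV_subset[OF f(1)])
  qed (use D in auto)
  then show ?thesis by (simp add: algebra_simps power2_eq_square)
qed

text \<open>The real-line counterpart of \<open>C_bdd_inf\<close>, with the whole sequence of
  derivatives as a single witness; an operator that commutes with differentiation can then be
  applied to the sequence term by term.\<close>

definition smooth_bounded :: "(real \<Rightarrow> real) \<Rightarrow> bool" where
  "smooth_bounded f \<longleftrightarrow> (\<exists>F. F 0 = f \<and> (\<forall>n x. (F n has_real_derivative F (Suc n) x) (at x)) \<and>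
     (\<forall>n. bounded (range (F n))))"

lemma smooth_bounded_tail:
  assumes "\<And>n x. (F n has_real_derivative F (Suc n) x) (at x)" "\<And>n. bounded (range (F n))"
  shows "smooth_bounded (F k)"
  unfolding smooth_bounded_def using assms by (intro exI[of _ "\<lambda>n. F (n + k)"]) auto

lemma smooth_bounded_deriv:
  assumes "smooth_bounded f"
  shows "smooth_bounded (deriv f)" "(f has_real_derivative deriv f x) (at x)"
proof -
  obtain F where F: "F 0 = f" "\<And>n x. (F n has_real_derivative F (Suc n) x) (at x)" "\<And>n. bounded (range (F n))"
    using assms unfolding smooth_bounded_def by blast
  have "deriv f = F 1" using F(2)[of 0] F(1) by (auto intro!: DERIV_imp_deriv)
  then show "smooth_bounded (deriv f)" "(f has_real_derivative deriv f x) (at x)"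
    using smooth_bounded_tail[of F 1] F(2)[of 0] F by auto
qed

lemma smooth_bounded_bound:
  assumes "smooth_bounded f" obtains B where "\<And>x. \<bar>f x\<bar> \<le> B"
  using assms unfolding smooth_bounded_def bounded_iff by (metis rangeI real_norm_def)

lemma smooth_bounded_C2:
  assumes "smooth_bounded f" obtains M where "C2_bounded M f"
proof -
  note d = smooth_bounded_deriv[OF assms] 
  note d2 = smooth_bounded_deriv[OF d(1)]
  obtain A0 A1 A2 where "\<And>x. \<bar>f x\<bar> \<le> A0" "\<And>x. \<bar>deriv f x\<bar> \<le> A1" "\<And>x. \<bar>deriv (deriv f) x\<bar> \<le> A2"
    using smooth_bounded_bound assms d d2 by metis
  then have "C2_bounded (max A0 (max A1 A2)) f"
    unfolding C2_bounded_def using d(2) d2(2)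
    by (intro exI[of _ "deriv f"] exI[of _ "deriv (deriv f)"]) (auto simp: le_max_iff_disj)
  then show ?thesis by (rule that)
qed

lemma smooth_bounded_measurable: "smooth_bounded f \<Longrightarrow> f \<in> borel_measurable borel"
  using smooth_bounded_C2 C2_bounded_measurable by metis

lemma smooth_bounded_lincomb:
  assumes "smooth_bounded f" "smooth_bounded g"
  shows "smooth_bounded (\<lambda>x. a * f x + b * g x)"
proof -
  obtain F G where F: "F 0 = f" "\<And>n x. (F n has_real_derivative F (Suc n) x) (at x)" "\<And>n. bounded (range (F n))"
    and G: "G 0 = g" "\<And>n x. (G n has_real_derivative G (Suc n) x) (at x)" "\<And>n. bounded (range (G n))"
    using assms unfolding smooth_bounded_def by metis
  have "bounded (range (\<lambda>x. a * F n x + b * G n x))" for n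
  proof -
    have "bounded ((\<lambda>y. a *\<^sub>R y) ` range (F n))" "bounded ((\<lambda>y. b *\<^sub>R y) ` range (G n))"
      by (intro bounded_scaling F(3) G(3))+
    then show ?thesis by (intro bounded_plus_comp) (simp_all add: image_image)
  qed
  then show ?thesis
    unfolding smooth_bounded_def using F G
    by (intro exI[of _ "\<lambda>n x. a * F n x + b * G n x"]) (auto intro!: derivative_eq_intros)
qed

text \<open>The error \<open>q\<close> of the difference quotient of \<open>f\<close> is small together with two derivatives,
  so a bounded translation-invariant operator can be applied to it.\<close>

lemma translation_invariant_deriv:
  fixes A :: "(real \<Rightarrow> real) \<Rightarrow> real \<Rightarrow> real"
  assumes lin: "\<And>f g a b c h x. smooth_bounded f \<Longrightarrow> smooth_bounded g \<Longrightarrow>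
      A (\<lambda>y. a * f (y + h) + b * f y + c * g y) x = a * A f (x + h) + b * A f x + c * A g x"
    and bound: "\<And>f N x. C2_bounded N f \<Longrightarrow> \<bar>A f x\<bar> \<le> K * N"
    and f: "smooth_bounded f"
  shows "(A f has_real_derivative A (deriv f) x) (at x)"
proof -
  obtain F where F: "F 0 = f" "\<And>n x. (F n has_real_derivative F (Suc n) x) (at x)" "\<And>n. bounded (range (F n))"
    using f unfolding smooth_bounded_def by blast
  have f': "deriv f = F 1" using F(2)[of 0] F(1) by (auto intro!: DERIV_imp_deriv)
  obtain M2 M3 M4 where M: "\<And>x. \<bar>F 2 x\<bar> \<le> M2" "\<And>x. \<bar>F 3 x\<bar> \<le> M3" "\<And>x. \<bar>F 4 x\<bar> \<le> M4"
    using F(3) unfolding bounded_iff by (metis rangeI real_norm_def)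
  define M where "M = max M2 (max M3 M4)"
  have MM: "\<bar>F n x\<bar> \<le> M" if "n \<in> {2,3,4}" for n x
    using that M[of x] by (auto simp: M_def le_max_iff_disj)
  \<comment> \<open>Differentiating in \<open>y\<close> raises \<open>k\<close> by one, so the two
    derivatives of \<open>q h 0\<close> are \<open>q h 1\<close> and \<open>q h 2\<close>. Their
    Taylor remainders involve \<open>F 2\<close>, \<open>F 3\<close> and \<open>F 4\<close>, the
    functions bounded by \<open>M\<close>.\<close>
  define q where "q h k y = (1 / h) * F k (y + h) + (- 1 / h) * F k y + (- 1) * F (Suc k) y" for h k y
  have qd: "(q h k has_real_derivative q h (Suc k) y) (at y)" for h k y
  proof -
    have "((\<lambda>y. F k (y + h)) has_real_derivative F (Suc k) (y + h)) (at y)"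
      using F(2)[of k "y + h"] by (simp add: DERIV_shift)
    from DERIV_add[OF DERIV_add[OF DERIV_cmult[OF this, of "1 / h"] DERIV_cmult[OF F(2)[of k y], of "- 1 / h"]]
        DERIV_cmult[OF F(2)[of "Suc k" y], of "- 1"]]
    show ?thesis unfolding q_def[abs_def] .
  qed
  have qb: "\<bar>q h k y\<bar> \<le> \<bar>h\<bar> * M" if "h \<noteq> 0" "k \<in> {0,1,2}" for h k y
  proof -
    have "\<bar>F k (y + h) - F k y - h * F (Suc k) y\<bar> \<le> M * h\<^sup>2"
      by (rule taylor_remainder_bound[OF F(2) F(2) MM]) (use \<open>k \<in> {0,1,2}\<close> in auto)
    then have "\<bar>F k (y + h) - F k y - h * F (Suc k) y\<bar> \<le> M * \<bar>h\<bar> * \<bar>h\<bar>"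
      by (simp add: power2_eq_square)
    moreover have "q h k y = (F k (y + h) - F k y - h * F (Suc k) y) / h"
      using that by (simp add: q_def field_simps)
    ultimately show ?thesis using that by (simp add: abs_divide divide_le_eq mult_ac)
  qed
  have C: "C2_bounded (\<bar>h\<bar> * M) (q h 0)" if "h \<noteq> 0" for h
    unfolding C2_bounded_def
  proof (rule exI[of _ "q h 1"], rule exI[of _ "q h 2"], intro allI conjI)
    fix y
    show "(q h 0 has_real_derivative q h 1 y) (at y)" "(q h 1 has_real_derivative q h 2 y) (at y)"
      using qd[of h 0 y] qd[of h 1 y] by (simp_all add: numeral_2_eq_2)
    show "\<bar>q h 0 y\<bar> \<le> \<bar>h\<bar> * M" "\<bar>q h 1 y\<bar> \<le> \<bar>h\<bar> * M" "\<bar>q h 2 y\<bar> \<le> \<bar>h\<bar> * M"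
      by (rule qb[OF that]; simp)+
  qed
  have s1: "smooth_bounded (F 1)" by (rule smooth_bounded_tail[of F, OF F(2,3)])
  have Aq: "A (q h 0) x = (A f (x + h) - A f x) / h - A (F 1) x" if "h \<noteq> 0" for h
  proof -
    \<comment> \<open>The three-term form of \<open>lin\<close>, with one translated copy of
      \<open>f\<close>, is tailored to this expression.\<close>
    have "q h 0 = (\<lambda>y. (1 / h) * f (y + h) + (- 1 / h) * f y + (- 1) * F 1 y)"
      by (auto simp: q_def F(1))
    then have "A (q h 0) x = (1 / h) * A f (x + h) + (- 1 / h) * A f x + (- 1) * A (F 1) x"
      by (simp only: lin[OF f s1])
    then show ?thesis by (simp add: diff_divide_distrib)
  qed
  have "((\<lambda>h. (A f (x + h) - A f x) / h - A (F 1) x) \<longlongrightarrow> 0) (at 0)"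
  proof (rule Lim_null_comparison)
    show "\<forall>\<^sub>F h in at 0. norm ((A f (x + h) - A f x) / h - A (F 1) x) \<le> K * (\<bar>h\<bar> * M)"
      unfolding eventually_at_filter
    proof (rule always_eventually, intro allI impI)
      fix h :: real assume h: "h \<noteq> 0"
      show "norm ((A f (x + h) - A f x) / h - A (F 1) x) \<le> K * (\<bar>h\<bar> * M)"
        using bound[OF C[OF h], of x] unfolding Aq[OF h] real_norm_def .
    qed
    show "((\<lambda>h. K * (\<bar>h\<bar> * M)) \<longlongrightarrow> 0) (at 0)"
      by (auto intro!: tendsto_eq_intros)
  qed
  then have "((\<lambda>h. (A f (x + h) - A f x) / h) \<longlongrightarrow> A (F 1) x) (at 0)"
    by (simp add: LIM_zero_iff)
  then show ?thesis unfolding f' DERIV_def .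
qed

lemma translation_invariant_smooth:
  fixes A :: "(real \<Rightarrow> real) \<Rightarrow> real \<Rightarrow> real"
  assumes lin: "\<And>f g a b c h x. smooth_bounded f \<Longrightarrow> smooth_bounded g \<Longrightarrow>
      A (\<lambda>y. a * f (y + h) + b * f y + c * g y) x = a * A f (x + h) + b * A f x + c * A g x"
    and bound: "\<And>f N x. C2_bounded N f \<Longrightarrow> \<bar>A f x\<bar> \<le> K * N"
    and f: "smooth_bounded f"
  shows "smooth_bounded (A f)"
proof -
  obtain F where F: "F 0 = f" "\<And>n x. (F n has_real_derivative F (Suc n) x) (at x)" "\<And>n. bounded (range (F n))"
    using f unfolding smooth_bounded_def by blast
  have sF: "smooth_bounded (F n)" for n by (rule smooth_bounded_tail[of F, OF F(2,3)])
  have dF: "deriv (F n) = F (Suc n)" for n using F(2) by (auto intro!: DERIV_imp_deriv)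
  show ?thesis unfolding smooth_bounded_def
  proof (intro exI[of _ "\<lambda>n. A (F n)"] conjI allI)
    show "(A (F n) has_real_derivative A (F (Suc n)) x) (at x)" for n x
    proof -
      have "(A (F n) has_real_derivative A (deriv (F n)) x) (at x)"
        by (rule translation_invariant_deriv[of A K]) (fact lin bound sF)+
      then show ?thesis by (simp only: dF)
    qed
    show "bounded (range (A (F n)))" for n
    proof -
      obtain M where "C2_bounded M (F n)" using smooth_bounded_C2[OF sF] .
      then show ?thesis using bound by (auto intro!: boundedI)
    qed
  qed (simp add: F)
qed

lemma C2_bounded_diff_bound:
  assumes "C2_bounded M f"
  shows "\<bar>f (y + h) - f y - h * deriv f y\<bar> \<le> M * h\<^sup>2"
proof -
  obtain f' f'' where f: "\<And>x. (f has_real_derivative f' x) (at x)" "\<And>x. (f' has_real_derivative f'' x) (at x)"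
     "\<And>x. \<bar>f'' x\<bar> \<le> M"
    using assms unfolding C2_bounded_def by metis
  then show ?thesis using taylor_remainder_bound[OF f, of y h] DERIV_imp_deriv[OF f(1)] by simp
qed

section \<open>Regularity of the generator and the semigroup\<close>

lemma integral_linear3:
  fixes u v w :: "'a \<Rightarrow> real"
  assumes "integrable M u" "integrable M v" "integrable M w"
  shows "(LINT x|M. a * u x + b * v x + c * w x) = a * integral\<^sup>L M u + b * integral\<^sup>L M v + c * integral\<^sup>L M w"
  using assms by simp

lemma frac_gen_C2_bounded:
  assumes s: "0 < s" "s < 1" and f: "C2_bounded M f"
  shows "integrable (levy_measure s) (\<lambda>\<eta>. f (x + \<eta>) + f (x - \<eta>) - 2 * f x)"
    "\<bar>frac_gen s f x\<bar> \<le> (levy_mass s * 4) * M"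
  using frac_gen_bound[OF s C2_bounded_measurable[OF f] C2_bounded_second_difference[OF f], of x]
  by (simp_all add: mult.assoc)

lemma frac_gen_linear:
  assumes s: "0 < s" "s < 1" and f: "smooth_bounded f" and g: "smooth_bounded g"
  shows "frac_gen s (\<lambda>y. a * f (y + h) + b * f y + c * g y) x = a * frac_gen s f (x + h) + b * frac_gen s f x + c * frac_gen s g x"
proof -
  obtain M N where "C2_bounded M f" "C2_bounded N g" using f g smooth_bounded_C2 by metis
  note i = frac_gen_C2_bounded(1)[OF s this(1)] frac_gen_C2_bounded(1)[OF s this(2)]
  let ?D = "\<lambda>f x \<eta>. f (x + \<eta>) + f (x - \<eta>) - 2 * f x :: real"
  have "(LINT \<eta>|levy_measure s. ?D (\<lambda>y. a * f (y + h) + b * f y + c * g y) x \<eta>) =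
    (LINT \<eta>|levy_measure s. a * ?D f (x + h) \<eta> + b * ?D f x \<eta> + c * ?D g x \<eta>)"
    by (intro Bochner_Integration.integral_cong[OF refl]) (simp add: algebra_simps)
  also have "\<dots> = a * (LINT \<eta>|levy_measure s. ?D f (x + h) \<eta>) + b * (LINT \<eta>|levy_measure s. ?D f x \<eta>) + c * (LINT \<eta>|levy_measure s. ?D g x \<eta>)"
    by (rule integral_linear3[OF i(1) i(1) i(2)])
  finally have *: "(LINT \<eta>|levy_measure s. ?D (\<lambda>y. a * f (y + h) + b * f y + c * g y) x \<eta>) =
    a * (LINT \<eta>|levy_measure s. ?D f (x + h) \<eta>) + b * (LINT \<eta>|levy_measure s. ?D f x \<eta>) + c * (LINT \<eta>|levy_measure s. ?D g x \<eta>)" .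
  show ?thesis unfolding frac_gen_def * by (simp only: distrib_left mult.left_commute)
qed

lemma frac_gen_smooth:
  assumes s: "0 < s" "s < 1" and f: "smooth_bounded f"
  shows "smooth_bounded (frac_gen s f)"
  by (rule translation_invariant_smooth[of "frac_gen s" "levy_mass s * 4", OF frac_gen_linear[OF s] frac_gen_C2_bounded(2)[OF s] f])

lemma heat_sg_linear:
  assumes s: "1/2 < s" "s < 1" "t \<ge> 0" and f: "smooth_bounded f" and g: "smooth_bounded g"
  shows "heat_sg s t (\<lambda>y. a * f (y + h) + b * f y + c * g y) x = a * heat_sg s t f (x + h) + b * heat_sg s t f x + c * heat_sg s t g x"
proof -
  obtain M N where M: "\<And>x. \<bar>f x\<bar> \<le> M" "\<And>x. \<bar>g x\<bar> \<le> N" using f g smooth_bounded_bound by metis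
  note i = heat_law_integrable[OF s smooth_bounded_measurable[OF f] M(1)] heat_law_integrable[OF s smooth_bounded_measurable[OF g] M(2)]
  have "x - z + h = x + h - z" for z by simp
  then show ?thesis
    unfolding heat_sg_def
    using integral_linear3[OF i(1)[of "x + h"] i(1)[of x] i(2)[of x]] by (simp only:)
qed

lemma heat_sg_C2_bound:
  assumes s: "1/2 < s" "s < 1" "t \<ge> 0" and f: "C2_bounded M f"
  shows "\<bar>heat_sg s t f x\<bar> \<le> 1 * M"
  using heat_sg_bound[OF s C2_bounded_abs[OF f]] by simp

lemma heat_sg_smooth:
  assumes s: "1/2 < s" "s < 1" "t \<ge> 0" and f: "smooth_bounded f"
  shows "smooth_bounded (heat_sg s t f)"
  by (rule translation_invariant_smooth[of "heat_sg s t" 1, OF heat_sg_linear[OF s] heat_sg_C2_bound[OF s] f])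

lemma heat_sg_deriv:
  assumes s: "1/2 < s" "s < 1" "t \<ge> 0" and f: "smooth_bounded f"
  shows "(heat_sg s t f has_real_derivative heat_sg s t (deriv f) x) (at x)"
  by (rule translation_invariant_deriv[of "heat_sg s t" 1, OF heat_sg_linear[OF s] heat_sg_C2_bound[OF s] f])

text \<open>Both operators are integrals of translates, so they commute by Fubini, with majorant
  \<open>trunc_sq \<eta> * (4 * M)\<close> on the product of the jump measure and the heat
  law.\<close>

lemma frac_gen_heat_sg:
  assumes s: "1/2 < s" "s < 1" "t \<ge> 0" and f: "C2_bounded M f"
  shows "frac_gen s (heat_sg s t f) x = heat_sg s t (frac_gen s f) x"
proof -
  interpret V: sigma_finite_measure "levy_measure s" by (rule sigma_finite_levy_measure)
  interpret L: prob_space "heat_law s t" by (rule prob_space_heat_law[OF s])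
  interpret P: pair_sigma_finite "levy_measure s" "heat_law s t" ..
  note fm[measurable] = C2_bounded_measurable[OF f]
  note i = heat_law_integrable[OF s fm C2_bounded_abs[OF f]]
  have s0: "0 < s" using s by simp
  let ?D = "\<lambda>\<eta> z. f (x - z + \<eta>) + f (x - z - \<eta>) - 2 * f (x - z)"
  \<comment> \<open>The second-difference estimate is available for positive \<open>\<eta>\<close>
    only, whereas the domination must hold at every point; the jump measure does not see the
    change.\<close>
  let ?D' = "\<lambda>\<eta> z. if \<eta> > 0 then ?D \<eta> z else 0"
  have int: "integrable (levy_measure s \<Otimes>\<^sub>M heat_law s t) (\<lambda>(\<eta>, z). ?D' \<eta> z)"
  proof (rule integrable_pair_bound[OF _ _ integrable_trunc_sq[OF s0 s(2)], where b="\<lambda>_. 4 * M"])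
    have M: "M \<ge> 0" using C2_bounded_abs[OF f, of 0] by linarith
    show "\<bar>(\<lambda>(\<eta>, z). ?D' \<eta> z) (\<eta>, z)\<bar> \<le> trunc_sq \<eta> * (4 * M)" for \<eta> z
      using C2_bounded_second_difference[OF f, of \<eta> "x - z"] M by (simp add: mult.commute)
  qed (use s in \<open>auto intro: V.sigma_finite_measure_axioms L.sigma_finite_measure_axioms\<close>)
  have "heat_sg s t f (x + \<eta>) + heat_sg s t f (x - \<eta>) - 2 * heat_sg s t f x = (LINT z|heat_law s t. ?D \<eta> z)" for \<eta>
  proof -
    have "heat_sg s t f (x + \<eta>) + heat_sg s t f (x - \<eta>) - 2 * heat_sg s t f x =
       (LINT z|heat_law s t. f (x + \<eta> - z) + f (x - \<eta> - z) - 2 * f (x - z))"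
      unfolding heat_sg_def by (intro integral_second_difference i)
    also have "\<dots> = (LINT z|heat_law s t. ?D \<eta> z)"
      by (intro Bochner_Integration.integral_cong[OF refl]) (simp add: algebra_simps)
    finally show ?thesis .
  qed
  then have "frac_gen s (heat_sg s t f) x = frac_const s * (LINT \<eta>|levy_measure s. LINT z|heat_law s t. ?D \<eta> z)"
    by (simp only: frac_gen_def)
  also have "(LINT \<eta>|levy_measure s. LINT z|heat_law s t. ?D \<eta> z) = (LINT \<eta>|levy_measure s. LINT z|heat_law s t. ?D' \<eta> z)"
  proof (rule integral_cong_AE)
    show "AE \<eta> in levy_measure s. (LINT z|heat_law s t. ?D \<eta> z) = (LINT z|heat_law s t. ?D' \<eta> z)"
      using AE_levy_measure[of s] by eventually_elim simp
  qed simp_all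
  also have "\<dots> = (LINT z|heat_law s t. LINT \<eta>|levy_measure s. ?D' \<eta> z)"
    using P.Fubini_integral[OF int] by simp
  also have "\<dots> = (LINT z|heat_law s t. LINT \<eta>|levy_measure s. ?D \<eta> z)"
  proof (rule Bochner_Integration.integral_cong[OF refl], rule integral_cong_AE)
    show "AE \<eta> in levy_measure s. ?D' \<eta> z = ?D \<eta> z" for z
      using AE_levy_measure[of s] by eventually_elim simp
  qed simp_all
  also have "frac_const s * \<dots> = heat_sg s t (frac_gen s f) x"
    unfolding heat_sg_def frac_gen_def by (simp only: Bochner_Integration.integral_mult_right_zero)
  finally show ?thesis .
qed

lemma heat_sg_lipschitz_space:
  assumes s: "1/2 < s" "s < 1" "t \<ge> 0" and f: "smooth_bounded f" and B: "\<And>x. \<bar>deriv f x\<bar> \<le> B"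
  shows "\<bar>heat_sg s t f x - heat_sg s t f y\<bar> \<le> B * \<bar>x - y\<bar>"
  by (rule deriv_bounded_lipschitz[OF heat_sg_deriv[OF s f] heat_sg_bound[OF s B]])

lemma heat_sg_time_integrable:
  assumes s: "1/2 < s" "s < 1" "t \<ge> 0" and f[measurable]: "f \<in> borel_measurable borel" and B: "\<And>x. \<bar>f x\<bar> \<le> B"
  shows "set_integrable lborel {0<..t} (\<lambda>r. heat_sg s r f x)"
  unfolding set_integrable_def
proof (rule Bochner_Integration.integrable_bound[where f="\<lambda>r. indicator {0<..t} r * B"])
  show "integrable lborel (\<lambda>r. indicator {0<..t} r * B)"
    using s(3) by (auto intro!: integrable_real_indicator emeasure_lborel_Ioc[THEN eq_refl, THEN le_less_trans])
  show "AE r in lborel. norm (indicator {0<..t} r *\<^sub>R heat_sg s r f x) \<le> norm (indicator {0<..t} r * B)"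
  proof (rule AE_I2)
    fix r
    have "\<bar>heat_sg s r f x\<bar> \<le> \<bar>B\<bar>" if "0 < r"
      using heat_sg_bound[of s r f B x, OF s(1,2) _ B] that by simp
    then show "norm (indicator {0<..t} r *\<^sub>R heat_sg s r f x) \<le> norm (indicator {0<..t} r * B)"
      by (auto simp: indicator_def)
  qed
qed (use heat_sg_measurable_time[OF s(1,2) f] in simp)

text \<open>Subtracting the generator identity at two times leaves the integral of the semigroup
  applied to \<open>frac_gen s f\<close> over the interval between them, with integrand bounded by
  \<open>B\<close>.\<close>

lemma heat_sg_lipschitz_time:
  assumes s: "1/2 < s" "s < 1" and f: "smooth_bounded f" and B: "\<And>x. \<bar>frac_gen s f x\<bar> \<le> B"
    and t: "0 \<le> t" "0 \<le> r"
  shows "\<bar>heat_sg s t f x - heat_sg s r f x\<bar> \<le> B * \<bar>t - r\<bar>"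
proof -
  obtain M where M: "C2_bounded M f" using smooth_bounded_C2[OF f] .
  have m: "frac_gen s f \<in> borel_measurable borel"
    using C2_bounded_measurable[OF M] by (rule frac_gen_measurable)
  have main: "\<bar>heat_sg s t f x - heat_sg s r f x\<bar> \<le> B * (t - r)" if "0 \<le> r" "r \<le> t" for t r
  proof -
    let ?g = "\<lambda>q. heat_sg s q (frac_gen s f) x"
    have t: "0 \<le> t" using that by simp
    have i: "set_integrable lborel {0<..t} ?g" "set_integrable lborel {0<..r} ?g"
      using heat_sg_time_integrable[OF s _ m B] that by auto
    have i': "set_integrable lborel {r<..t} ?g"
      by (rule set_integrable_subset[OF i(1)]) (use that in auto)
    have un: "{0<..t} = {0<..r} \<union> {r<..t}" "{0<..r} \<inter> {r<..t} = {}" using that by auto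
    have "(LBINT q:{0<..t}. ?g q) = (LBINT q:{0<..r}. ?g q) + (LBINT q:{r<..t}. ?g q)"
      unfolding un(1) by (rule set_integral_Un[OF un(2) i(2) i'])
    then have "heat_sg s t f x - heat_sg s r f x = (LBINT q:{r<..t}. ?g q)"
      using generator_identity[OF s t M, of x] generator_identity[OF s that(1) M, of x] by simp
    also have "\<bar>\<dots>\<bar> \<le> (LBINT q. indicator {r<..t} q * B)"
      unfolding set_lebesgue_integral_def
    proof (rule integral_abs_bound_integral)
      show "integrable lborel (\<lambda>q. indicator {r<..t} q *\<^sub>R ?g q)"
        using i' by (simp add: set_integrable_def)
      show "integrable lborel (\<lambda>q. indicator {r<..t} q * B)"
        using that by (auto intro!: integrable_real_indicator emeasure_lborel_Ioc[THEN eq_refl, THEN le_less_trans])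
      show "\<bar>indicator {r<..t} q *\<^sub>R ?g q\<bar> \<le> indicator {r<..t} q * B" for q
        using heat_sg_bound[OF s _ B] that by (auto simp: indicator_def)
    qed
    also have "\<dots> = B * (t - r)" using that by simp
    finally show ?thesis .
  qed
  show ?thesis
  proof (cases "r \<le> t")
    case True then show ?thesis using main[of r t] t by simp
  next
    case False then show ?thesis using main[of t r] t by (simp add: abs_minus_commute)
  qed
qed

text \<open>Joint continuity follows from the two Lipschitz estimates, because their constants
  depend neither on the time nor on the point.\<close>

lemma heat_sg_continuous:
  assumes s: "1/2 < s" "s < 1" and f: "smooth_bounded f"
  shows "continuous_on (UNIV \<times> {0..}) (\<lambda>(y, t). heat_sg s t f y)"
  unfolding continuous_on_def
proof (rule ballI)
  fix p :: "real \<times> real" assume "p \<in> UNIV \<times> {0..}"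
  then obtain y t where p: "p = (y, t)" "t \<ge> 0" by auto
  obtain A where A: "\<And>x. \<bar>deriv f x\<bar> \<le> A"
    using smooth_bounded_bound[OF smooth_bounded_deriv(1)[OF f]] by blast
  have s0: "0 < s" using s by simp
  obtain B where B: "\<And>x. \<bar>frac_gen s f x\<bar> \<le> B"
    using smooth_bounded_bound[OF frac_gen_smooth[OF s0 s(2) f]] by blast
  have "((\<lambda>q. (case q of (y, t) \<Rightarrow> heat_sg s t f y) - heat_sg s t f y) \<longlongrightarrow> 0) (at p within UNIV \<times> {0..})"
  proof (rule Lim_null_comparison)
    show "\<forall>\<^sub>F q in at p within UNIV \<times> {0..}. norm ((case q of (y, t) \<Rightarrow> heat_sg s t f y) - heat_sg s t f y)
       \<le> A * \<bar>fst q - y\<bar> + B * \<bar>snd q - t\<bar>"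
      unfolding eventually_at_filter
    proof (intro always_eventually allI impI)
      fix q :: "real \<times> real" assume "q \<noteq> p" "q \<in> UNIV \<times> {0..}"
      then have q: "snd q \<ge> 0" by auto
      show "norm ((case q of (y, t) \<Rightarrow> heat_sg s t f y) - heat_sg s t f y) \<le> A * \<bar>fst q - y\<bar> + B * \<bar>snd q - t\<bar>"
        using heat_sg_lipschitz_space[OF s q f A, of "fst q" y] heat_sg_lipschitz_time[OF s f B q p(2), of y]
        by (simp add: case_prod_beta)
    qed
    have "((\<lambda>q. A * \<bar>fst q - y\<bar> + B * \<bar>snd q - t\<bar>) \<longlongrightarrow> A * \<bar>fst p - y\<bar> + B * \<bar>snd p - t\<bar>) (at p within UNIV \<times> {0..})"
      by (intro tendsto_intros)
    then show "((\<lambda>q. A * \<bar>fst q - y\<bar> + B * \<bar>snd q - t\<bar>) \<longlongrightarrow> 0) (at p within UNIV \<times> {0..})"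
      by (simp add: p)
  qed
  then show "((\<lambda>(y, t). heat_sg s t f y) \<longlongrightarrow> (case p of (y, t) \<Rightarrow> heat_sg s t f y)) (at p within UNIV \<times> {0..})"
    by (simp add: p LIM_zero_iff)
qed

text \<open>By the preceding continuity, applied to the smooth function \<open>frac_gen s f\<close>,
  the integrand of the generator identity is continuous up to time 0. The fundamental theorem of
  calculus then gives the derivative, one-sided at 0.\<close>

lemma heat_sg_time_deriv:
  assumes s: "1/2 < s" "s < 1" and t: "t \<ge> 0" and f: "smooth_bounded f"
  shows "((\<lambda>\<tau>. heat_sg s \<tau> f x) has_real_derivative heat_sg s t (frac_gen s f) x) (at t within {0..})"
proof -
  have s0: "0 < s" using s by simp
  obtain M where M: "C2_bounded M f" using smooth_bounded_C2[OF f] .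
  let ?g = "\<lambda>q. heat_sg s q (frac_gen s f) x"
  have sL: "smooth_bounded (frac_gen s f)" by (rule frac_gen_smooth[OF s0 s(2) f])
  obtain B where B: "\<And>x. \<bar>frac_gen s f x\<bar> \<le> B" using smooth_bounded_bound[OF sL] by blast
  have "continuous_on {0..} (\<lambda>t. (\<lambda>(y, t). heat_sg s t (frac_gen s f) y) (x, t))"
    by (rule continuous_on_compose2[OF heat_sg_continuous[OF s sL]]) (auto intro!: continuous_intros)
  \<comment> \<open>The interval extends beyond \<open>t\<close>, so it is a neighbourhood of
    \<open>t\<close> within the half-line.\<close>
  then have c: "continuous_on {0..t + 1} ?g"
    by (auto intro: continuous_on_subset)
  have I: "heat_sg s \<tau> f x = f x + integral {0..\<tau>} ?g" if "\<tau> \<ge> 0" for \<tau>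
  proof -
    have "(LBINT q:{0<..\<tau>}. ?g q) = integral {0<..\<tau>} ?g"
      by (rule set_borel_integral_eq_integral(2)[OF heat_sg_time_integrable[OF s that smooth_bounded_measurable[OF sL] B]])
    also have "\<dots> = integral {0..\<tau>} ?g"
      by (rule integral_spike_set) (auto intro: negligible_subset[of "{0}"])
    finally show ?thesis using generator_identity[OF s that M, of x] by simp
  qed
  have "((\<lambda>\<tau>. integral {0..\<tau>} ?g) has_real_derivative ?g t) (at t within {0..t + 1})"
    by (rule integral_has_real_derivative[OF c]) (use t in auto)
  then have "((\<lambda>\<tau>. f x + integral {0..\<tau>} ?g) has_real_derivative ?g t) (at t within {0..t + 1})"
    by (auto intro!: derivative_eq_intros)
  then have "((\<lambda>\<tau>. heat_sg s \<tau> f x) has_real_derivative ?g t) (at t within {0..t + 1})"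
    by (rule has_field_derivative_transform_within[where d=1]) (use t I in auto)
  moreover have "at t within {0..t + 1} = at t within {0..}"
    by (rule at_within_nhd[of _ "{..<t + 1}"]) auto
  ultimately show ?thesis by simp
qed

text \<open>Averaging translates against a probability measure preserves order; this rests on the
  nonnegativity of the kernel.\<close>

lemma heat_sg_mono:
  assumes s: "1/2 < s" "s < 1" "t \<ge> 0" and f: "smooth_bounded f" and "mono f"
  shows "mono (heat_sg s t f)"
proof (rule monoI)
  fix x y :: real assume "x \<le> y"
  obtain B where B: "\<And>x. \<bar>f x\<bar> \<le> B" using smooth_bounded_bound[OF f] by blast
  show "heat_sg s t f x \<le> heat_sg s t f y" unfolding heat_sg_def
    by (intro integral_mono heat_law_integrable[OF s smooth_bounded_measurable[OF f] B] monoD[OF \<open>mono f\<close>]) (use \<open>x \<le> y\<close> in simp)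
qed

section \<open>Functions of one coordinate\<close>

lemma linear_real_eq_sum_Basis:
  fixes l :: "'a::euclidean_space \<Rightarrow> real"
  assumes "linear l"
  shows "l h = (\<Sum>b\<in>Basis. (h \<bullet> b) * l b)"
proof -
  have "l h = l (\<Sum>b\<in>Basis. (h \<bullet> b) *\<^sub>R b)" by (simp add: euclidean_representation)
  also have "\<dots> = (\<Sum>b\<in>Basis. (h \<bullet> b) * l b)"
    using assms by (simp add: linear_sum linear_scale)
  finally show ?thesis .
qed

lemma C_bdd_imp_0: "C_bdd m S f \<Longrightarrow> C_bdd 0 S f"
  by (cases m) auto

lemma has_real_derivative_iff_mult_right:
  "(f has_real_derivative D) F \<longleftrightarrow> (f has_derivative (\<lambda>h. h * D)) F"
  unfolding has_field_derivative_def by (simp only: mult_commute_abs)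

text \<open>The recursive definition supplies a possibly different derivative for each order
  \<open>m\<close>. Uniqueness of derivatives on the line identifies all of them with
  \<open>deriv f\<close>, so the iterates of \<open>deriv\<close> form the required
  sequence.\<close>

lemma C_bdd_inf_imp_smooth_bounded:
  fixes f :: "real \<Rightarrow> real"
  assumes "f \<in> C_bdd_inf UNIV"
  shows "smooth_bounded f"
proof -
  have step: "deriv f \<in> C_bdd_inf UNIV" "(f has_real_derivative deriv f x) (at x)" "bounded (range f)"
    if "f \<in> C_bdd_inf UNIV" for f :: "real \<Rightarrow> real" and x
  proof -
    have *: "C_bdd m UNIV (deriv f) \<and> (\<forall>x. (f has_real_derivative deriv f x) (at x))" for m
    proof -
      have "C_bdd (Suc m) UNIV f" using that by (auto simp: C_bdd_inf_def)
      then obtain g where g: "\<And>x. (f has_derivative (\<lambda>h. h * g (1::real) x)) (at x)" "C_bdd m UNIV (g 1)"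
        by auto
      have d: "(f has_real_derivative g 1 x) (at x)" for x
        using g(1)[of x] by (simp only: has_real_derivative_iff_mult_right)
      then have "deriv f = g 1" by (auto intro!: DERIV_imp_deriv)
      then show ?thesis using g(2) d by simp
    qed
    then show "deriv f \<in> C_bdd_inf UNIV" "(f has_real_derivative deriv f x) (at x)"
      by (auto simp: C_bdd_inf_def)
    show "bounded (range f)" using that by (auto simp: C_bdd_inf_def dest: spec[of _ 0])
  qed
  have in_C: "(deriv ^^ n) f \<in> C_bdd_inf UNIV" for n
    by (induction n) (use assms step(1) in auto)
  show ?thesis unfolding smooth_bounded_def
    by (intro exI[of _ "\<lambda>n. (deriv ^^ n) f"]) (use step[OF in_C] in auto)
qed

lemma C_bdd_coordinate:
  fixes k :: "'n::finite" and S :: "(real ^ 'n) set"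
  assumes "smooth_bounded f"
  shows "C_bdd m S (\<lambda>x. f (x $ k))"
  using assms
proof (induction m arbitrary: f)
  case (0 f)
  obtain B where B: "\<And>x. \<bar>f x\<bar> \<le> B" using smooth_bounded_bound[OF 0] by blast
  have c: "continuous_on UNIV f"
    using smooth_bounded_deriv(2)[OF 0] by (intro continuous_at_imp_continuous_on) (auto intro: DERIV_isCont)
  have "continuous_on S (\<lambda>x. f (x $ k))"
    by (rule continuous_on_compose2[OF c]) (auto intro!: continuous_intros)
  then show ?case using B by (auto intro!: boundedI)
next
  case (Suc m f)
  obtain B where B: "\<And>x. \<bar>f x\<bar> \<le> B" using smooth_bounded_bound[OF Suc.prems] by blast
  have c: "continuous_on UNIV f"
    using smooth_bounded_deriv(2)[OF Suc.prems] by (intro continuous_at_imp_continuous_on) (auto intro: DERIV_isCont)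
  \<comment> \<open>The vanishing second summand only brings the partial derivative into the shape
    of \<open>smooth_bounded_lincomb\<close>.\<close>
  have sb: "smooth_bounded (\<lambda>y. (b $ k) * deriv f y + 0 * deriv f y)" for b :: "real ^ 'n"
    by (intro smooth_bounded_lincomb smooth_bounded_deriv Suc.prems)
  have d: "((\<lambda>x. f (x $ k)) has_derivative (\<lambda>h. \<Sum>b\<in>Basis. (h \<bullet> b) * ((b $ k) * deriv f (x $ k) + 0 * deriv f (x $ k)))) (at x within S)"
    for x :: "real ^ 'n"
  proof -
    have "(f has_derivative (\<lambda>h. h * deriv f (x $ k))) (at (x $ k))"
      using smooth_bounded_deriv(2)[OF Suc.prems] by (simp only: has_real_derivative_iff_mult_right)
    moreover have "((\<lambda>x. x $ k) has_derivative (\<lambda>h. h $ k)) (at x within S)"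
      by (intro bounded_linear_imp_has_derivative bounded_linear_vec_nth)
    ultimately have 1: "((\<lambda>x. f (x $ k)) has_derivative (\<lambda>h. h $ k * deriv f (x $ k))) (at x within S)"
      by (rule has_derivative_compose[rotated])
    have lin: "linear (\<lambda>h::real^'n. h $ k * deriv f (x $ k))" by (auto intro!: linearI simp: algebra_simps)
    have "(\<lambda>h. h $ k * deriv f (x $ k)) = (\<lambda>h. \<Sum>b\<in>Basis. (h \<bullet> b) * ((b $ k) * deriv f (x $ k) + 0 * deriv f (x $ k)))"
      unfolding mult_zero_left add_0_right by (rule ext, rule linear_real_eq_sum_Basis[OF lin])
    then show ?thesis using 1 by (simp only:)
  qed
  show ?case unfolding C_bdd.simps
  proof (intro conjI exI[of _ "\<lambda>b x. (b $ k) * deriv f (x $ k) + 0 * deriv f (x $ k)"] ballI)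
    show "continuous_on S (\<lambda>x. f (x $ k))"
      by (auto intro!: continuous_on_compose2[OF c] continuous_intros)
    show "bounded ((\<lambda>x. f (x $ k)) ` S)" using B by (auto intro!: boundedI)
    show "C_bdd m S (\<lambda>x. (b $ k) * deriv f (x $ k) + 0 * deriv f (x $ k))" for b
      by (rule Suc.IH[OF sb])
  qed (rule d)
qed

text \<open>A total derivative is assembled from the partial ones. The rule asks for joint
  continuity of one of them, and the time derivative has it, being the semigroup applied to
  \<open>frac_gen s f\<close>.\<close>

lemma heat_sg_has_derivative:
  assumes s: "1/2 < s" "s < 1" and t: "t \<ge> 0" and f: "smooth_bounded f"
  shows "((\<lambda>(y, \<tau>). heat_sg s \<tau> f y) has_derivative
    (\<lambda>(h, r). h * heat_sg s t (deriv f) y + r * heat_sg s t (frac_gen s f) y)) (at (y, t) within UNIV \<times> {0..})"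
proof -
  have s0: "0 < s" using s by simp
  have sL: "smooth_bounded (frac_gen s f)" by (rule frac_gen_smooth[OF s0 s(2) f])
  let ?D = "\<lambda>y t. blinfun_mult_left (heat_sg s t (frac_gen s f) y)"
  have "((\<lambda>(y, \<tau>). heat_sg s \<tau> f y) has_derivative
    (\<lambda>(h, r). (\<lambda>h. h * heat_sg s t (deriv f) y) h + blinfun_apply (?D y t) r)) (at (y, t) within UNIV \<times> {0..})"
  proof (rule has_derivative_partialsI)
    show "((\<lambda>y. heat_sg s t f y) has_derivative (\<lambda>h. h * heat_sg s t (deriv f) y)) (at y within UNIV)"
      using heat_sg_deriv[OF s t f, of y] by (simp only: has_real_derivative_iff_mult_right)
    show "((\<lambda>\<tau>. heat_sg s \<tau> f x) has_derivative blinfun_apply (?D x \<tau>)) (at \<tau> within {0..})" if "\<tau> \<in> {0..}" for x \<tau>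
    proof -
      have "blinfun_apply (?D x \<tau>) = (*) (heat_sg s \<tau> (frac_gen s f) x)" by (auto simp: mult.commute)
      then show ?thesis
        using heat_sg_time_deriv[OF s _ f, of \<tau> x] that by (simp add: has_field_derivative_def)
    qed
    have "continuous_on (UNIV \<times> {0..}) (\<lambda>p. blinfun_mult_left ((\<lambda>(y, t). heat_sg s t (frac_gen s f) y) p))"
      by (rule bounded_linear.continuous_on[OF bounded_linear_blinfun_mult_left heat_sg_continuous[OF s sL]])
    then show "continuous (at (y, t) within UNIV \<times> {0..}) (\<lambda>(y, t). ?D y t)"
      using t by (simp add: continuous_on_eq_continuous_within case_prod_beta')
  qed (use t in auto)
  then show ?thesis by simp
qed

text \<open>The derivative in a direction \<open>b\<close> is again the semigroup, applied to
  \<open>?G b\<close>, a combination of \<open>deriv f\<close> and \<open>frac_gen s f\<close>. The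
  family of functions in question is thus closed under differentiation, and the induction on
  \<open>m\<close> runs with \<open>f\<close> arbitrary.\<close>

lemma C_bdd_heat_sg:
  fixes k :: "'n::finite"
  assumes s: "1/2 < s" "s < 1" and "smooth_bounded f"
  shows "C_bdd m (UNIV \<times> {0..}) (\<lambda>p :: (real ^ 'n) \<times> real. heat_sg s (snd p) f (fst p $ k))"
  using assms(3)
proof (induction m arbitrary: f)
  case (0 f)
  obtain B where B: "\<And>x. \<bar>f x\<bar> \<le> B" using smooth_bounded_bound[OF 0] by blast
  have "continuous_on (UNIV \<times> {0..}) (\<lambda>p :: (real ^ 'n) \<times> real. (\<lambda>(y, t). heat_sg s t f y) (fst p $ k, snd p))"
    by (rule continuous_on_compose2[OF heat_sg_continuous[OF s 0]]) (auto intro!: continuous_intros)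
  then show ?case using heat_sg_bound[of s _ f B, OF s _ B] by (auto intro!: boundedI)
next
  case (Suc m f)
  note f = Suc.prems
  have s0: "0 < s" using s by simp
  let ?G = "\<lambda>b y. (fst b $ k) * deriv f y + snd b * frac_gen s f y"
  have sb: "smooth_bounded (?G b)" for b :: "(real ^ 'n) \<times> real"
    by (intro smooth_bounded_lincomb smooth_bounded_deriv frac_gen_smooth s0 s f)
  have d: "((\<lambda>p :: (real ^ 'n) \<times> real. heat_sg s (snd p) f (fst p $ k)) has_derivative
     (\<lambda>h. \<Sum>b\<in>Basis. (h \<bullet> b) * heat_sg s (snd p) (?G b) (fst p $ k))) (at p within UNIV \<times> {0..})"
    if p: "p \<in> UNIV \<times> {0..}" for p :: "(real ^ 'n) \<times> real"
  proof -
    let ?X = "heat_sg s (snd p) (deriv f) (fst p $ k)" and ?Y = "heat_sg s (snd p) (frac_gen s f) (fst p $ k)"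
    have t: "snd p \<ge> 0" using p by auto
    have "((\<lambda>q. (\<lambda>(y, \<tau>). heat_sg s \<tau> f y) ((\<lambda>q :: (real ^ 'n) \<times> real. (fst q $ k, snd q)) q)) has_derivative
      (\<lambda>h. (\<lambda>(h, r). h * ?X + r * ?Y) (fst h $ k, snd h))) (at p within UNIV \<times> {0..})"
    proof (rule has_derivative_in_compose[where g="\<lambda>(y, \<tau>). heat_sg s \<tau> f y" and g'="\<lambda>(h, r). h * ?X + r * ?Y"])
      show "((\<lambda>q. (fst q $ k, snd q)) has_derivative (\<lambda>h. (fst h $ k, snd h))) (at p within UNIV \<times> {0..})"
        by (intro bounded_linear_imp_has_derivative bounded_linear_Pair bounded_linear_snd
            bounded_linear_compose[OF bounded_linear_vec_nth bounded_linear_fst])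
      show "((\<lambda>(y, \<tau>). heat_sg s \<tau> f y) has_derivative (\<lambda>(h, r). h * ?X + r * ?Y))
         (at (fst p $ k, snd p) within (\<lambda>q. (fst q $ k, snd q)) ` (UNIV \<times> {0..}))"
        by (rule has_derivative_subset[OF heat_sg_has_derivative[OF s t f]]) auto
    qed
    moreover have "fst h $ k * ?X + snd h * ?Y = (\<Sum>b\<in>Basis. (h \<bullet> b) * heat_sg s (snd p) (?G b) (fst p $ k))" for h
    proof -
      have lin: "linear (\<lambda>h :: (real ^ 'n) \<times> real. fst h $ k * ?X + snd h * ?Y)"
        by (auto intro!: linearI simp: algebra_simps)
      \<comment> \<open>Linearity is used with coefficient 0 in front of the translated
        term.\<close>
      have H: "heat_sg s (snd p) (?G b) (fst p $ k) = fst b $ k * ?X + snd b * ?Y" for b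
        using heat_sg_linear[OF s t smooth_bounded_deriv(1)[OF f] frac_gen_smooth[OF s0 s(2) f],
            of 0 0 "fst b $ k" "snd b" "fst p $ k"] by simp
      show ?thesis unfolding H by (rule linear_real_eq_sum_Basis[OF lin])
    qed
    ultimately show ?thesis by simp
  qed
  show ?case unfolding C_bdd.simps
  proof (intro conjI exI[of _ "\<lambda>b p. heat_sg s (snd p) (?G b) (fst p $ k)"] ballI)
    show "C_bdd m (UNIV \<times> {0..}) (\<lambda>p. heat_sg s (snd p) (?G b) (fst p $ k))" for b
      by (rule Suc.IH[OF sb])
  qed (use C_bdd_imp_0[OF Suc.IH[OF f]] d in simp_all)
qed

section \<open>The infinity fractional Laplacian on functions of one coordinate\<close>

lemma grad_coordinate:
  fixes k :: "'n::finite"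
  assumes "(f has_real_derivative D) (at (x $ k))"
  shows "((\<lambda>x :: real ^ 'n. f (x $ k)) has_derivative (\<lambda>h. h $ k * D)) (at x)"
    and "grad (\<lambda>x :: real ^ 'n. f (x $ k)) x = axis k D"
proof -
  have "(f has_derivative (\<lambda>h. h * D)) (at (x $ k))"
    using assms by (simp only: has_real_derivative_iff_mult_right)
  moreover have "((\<lambda>x. x $ k) has_derivative (\<lambda>h. h $ k)) (at x)"
    by (intro bounded_linear_imp_has_derivative bounded_linear_vec_nth)
  ultimately show d: "((\<lambda>x :: real ^ 'n. f (x $ k)) has_derivative (\<lambda>h. h $ k * D)) (at x)"
    by (rule has_derivative_compose[rotated])
  show "grad (\<lambda>x :: real ^ 'n. f (x $ k)) x = axis k D"
    unfolding grad_def
  proof (rule the_equality)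
    show "GDERIV (\<lambda>x :: real ^ 'n. f (x $ k)) x :> axis k D"
      unfolding gderiv_def using d by (simp add: inner_axis)
    fix E assume "GDERIV (\<lambda>x :: real ^ 'n. f (x $ k)) x :> E"
    then have "(\<lambda>h. h \<bullet> E) = (\<lambda>h. h $ k * D)"
      unfolding gderiv_def using d by (rule has_derivative_unique)
    then have "\<forall>h. h \<bullet> E = h \<bullet> axis k D" by (simp add: inner_axis fun_eq_iff)
    then show "E = axis k D" by (rule vector_eq_ldot[THEN iffD1])
  qed
qed

lemma C11_at_coordinate:
  fixes k :: "'n::finite"
  assumes "smooth_bounded f"
  shows "C11_at (\<lambda>x :: real ^ 'n. f (x $ k)) x"
proof -
  obtain M where M: "C2_bounded M f" using smooth_bounded_C2[OF assms] .
  have M0: "M \<ge> 0" using C2_bounded_abs[OF M, of 0] by linarith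
  note g = grad_coordinate[OF smooth_bounded_deriv(2)[OF assms], where x=x and k=k]
  \<comment> \<open>The constant is \<open>M + 1\<close> because \<open>C11_at\<close> requires a
    positive one and \<open>M\<close> may be 0.\<close>
  have "\<bar>f ((x + y) $ k) - f (x $ k) - grad (\<lambda>x. f (x $ k)) x \<bullet> y\<bar> \<le> (M + 1) * (norm y)\<^sup>2" for y
  proof -
    have "\<bar>f ((x + y) $ k) - f (x $ k) - grad (\<lambda>x. f (x $ k)) x \<bullet> y\<bar> \<le> M * (y $ k)\<^sup>2"
      using C2_bounded_diff_bound[OF M, of "x $ k" "y $ k"] by (simp add: g(2) inner_axis' mult.commute)
    also have "\<dots> \<le> (M + 1) * (norm y)\<^sup>2"
      using M0 component_le_norm_cart[of y k] by (intro mult_mono) (auto simp: abs_le_square_iff[symmetric])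
    finally show ?thesis .
  qed
  moreover have "0 < M + 1" using M0 by simp
  ultimately show ?thesis
    unfolding C11_at_def using g(1) by (intro conjI exI[of _ "M + 1"] exI[of _ 1]) (auto simp: differentiable_def)
qed

text \<open>At critical points monotonicity makes the coordinate direction extremal, so that supremum
  and infimum add up to the one-dimensional operator.\<close>

lemma inf_frac_laplacian_coordinate:
  fixes k :: "'n::finite"
  assumes s: "0 < s" "s < 1" and f: "smooth_bounded f" and mono: "mono f"
  shows "inf_frac_laplacian s (\<lambda>x :: real ^ 'n. f (x $ k)) x = frac_gen s f (x $ k)"
proof -
  obtain M where M: "C2_bounded M f" using smooth_bounded_C2[OF f] .
  note [measurable] = C2_bounded_measurable[OF M]
  let ?a = "x $ k" and ?e = "axis k 1 :: real ^ 'n"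
  note g = grad_coordinate(2)[OF smooth_bounded_deriv(2)[OF f], where x=x and k=k]
  have FG: "frac_gen s f ?a = frac_const s * (LBINT \<eta>:{0<..}. (f (?a + \<eta>) + f (?a - \<eta>) - 2 * f ?a) / \<eta> powr (1 + 2 * s))"
    unfolding frac_gen_def by (subst integral_levy_measure) auto
  show ?thesis
  proof (cases "deriv f ?a = 0")
    case False
    let ?D = "deriv f ?a"
    have nz: "grad (\<lambda>x. f (x $ k)) x \<noteq> 0" using False by (simp add: g axis_eq_0_iff)
    have "(axis k ?D :: real ^ 'n) = ?D *\<^sub>R ?e"
      by (simp add: axis_def vec_eq_iff)
    then have "norm (axis k ?D :: real ^ 'n) = \<bar>?D\<bar>"
      by (simp add: norm_axis_1)
    then have z: "(axis k ?D /\<^sub>R norm (axis k ?D :: real ^ 'n)) $ k = sgn ?D"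
      by (simp add: axis_def sgn_real_def divide_inverse[symmetric] mult.commute[of "inverse _"])
    have sg: "sgn ?D = 1 \<or> sgn ?D = - 1" using False by (auto simp: sgn_real_def)
    \<comment> \<open>The symmetric sum is even in the direction, so the sign of the derivative
      drops out.\<close>
    have "f (?a + \<eta> * sgn ?D) + f (?a - \<eta> * sgn ?D) = f (?a + \<eta>) + f (?a - \<eta>)" for \<eta>
      using sg by auto
    then have I: "f ((x + \<eta> *\<^sub>R (axis k ?D /\<^sub>R norm (axis k ?D :: real ^ 'n))) $ k) +
        f ((x - \<eta> *\<^sub>R (axis k ?D /\<^sub>R norm (axis k ?D :: real ^ 'n))) $ k) = f (?a + \<eta>) + f (?a - \<eta>)" for \<eta>
      by (simp only: vector_add_component vector_minus_component vector_scaleR_component[where x="axis k ?D /\<^sub>R _"] z real_scaleR_def)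
    show ?thesis
      unfolding inf_frac_laplacian_def if_P[OF nz] Let_def FG unfolding g I ..
  next
    case True
    have z: "grad (\<lambda>x. f (x $ k)) x = 0" using True by (simp add: g)
    \<comment> \<open>Because the derivative vanishes, each one-sided increment is already quadratic
      near 0 and can be integrated separately.\<close>
    have i: "integrable (levy_measure s) (\<lambda>\<eta>. f (?a + \<eta> * c) - f ?a)" if "\<bar>c\<bar> \<le> 1" for c
    proof (rule integrable_levy_bound[OF s])
      fix \<eta> :: real assume "\<eta> > 0"
      have M0: "M \<ge> 0" using C2_bounded_abs[OF M, of 0] by linarith
      have "\<bar>f (?a + \<eta> * c) - f ?a\<bar> \<le> M * (\<eta> * c)\<^sup>2"
        using C2_bounded_diff_bound[OF M, of ?a "\<eta> * c"] True by simp
      also have "\<dots> \<le> M * \<eta>\<^sup>2"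
        using that M0 \<open>\<eta> > 0\<close> by (intro mult_left_mono) (auto simp: abs_le_square_iff[symmetric] abs_mult mult_left_le)
      finally have 1: "\<bar>f (?a + \<eta> * c) - f ?a\<bar> \<le> M * \<eta>\<^sup>2" .
      have 2: "\<bar>f (?a + \<eta> * c) - f ?a\<bar> \<le> 2 * M"
        using C2_bounded_abs[OF M, of "?a + \<eta> * c"] C2_bounded_abs[OF M, of ?a] by linarith
      have "M * \<eta>\<^sup>2 \<ge> 0" using M0 by simp
      then show "\<bar>f (?a + \<eta> * c) - f ?a\<bar> \<le> 2 * M * trunc_sq \<eta>"
        using 1 2 by (auto simp: min_def)
    qed auto
    \<comment> \<open>The one-sided integral along a direction depends on its \<open>k\<close>-th
      component \<open>c\<close> alone, and \<open>J\<close> is nondecreasing on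
      \<open>[-1, 1]\<close> by monotonicity of \<open>f\<close>.\<close>
    define J where "J c = (LINT \<eta>|levy_measure s. f (?a + \<eta> * c) - f ?a)" for c
    have J: "(LBINT \<eta>:{0<..}. (f (?a + \<eta> * c) - f ?a) / \<eta> powr (1 + 2 * s)) = J c" for c
      unfolding J_def by (subst integral_levy_measure) auto
    have Jm: "J c \<le> J d" if "c \<le> d" "\<bar>c\<bar> \<le> 1" "\<bar>d\<bar> \<le> 1" for c d
      unfolding J_def
    proof (rule integral_mono_AE[OF i i])
      show "AE \<eta> in levy_measure s. f (?a + \<eta> * c) - f ?a \<le> f (?a + \<eta> * d) - f ?a"
        using AE_levy_measure by eventually_elim (use that in \<open>auto intro!: monoD[OF mono] mult_left_mono\<close>)
    qed (use that in auto)
    have c: "\<bar>y $ k\<bar> \<le> 1" if "y \<in> sphere (0 :: real ^ 'n) 1" for y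
      using that component_le_norm_cart[of y k] by simp
    have e: "?e \<in> sphere 0 1" "?e $ k = 1" by (simp_all add: norm_axis_1)
    have sup: "(SUP y\<in>sphere (0 :: real ^ 'n) 1. J (y $ k)) = J 1"
    proof (rule cSup_eq_maximum)
      show "J 1 \<in> (\<lambda>y. J (y $ k)) ` sphere (0 :: real ^ 'n) 1"
        by (rule image_eqI[OF _ e(1)]) (simp add: e(2))
    qed (use c in \<open>force intro!: Jm\<close>)
    \<comment> \<open>The infimum is over steps \<open>- \<eta> *\<^sub>R y\<close>, hence the minus
      sign; it is attained at the same unit vector as the supremum, with value
      \<open>J (- 1)\<close>.\<close>
    have inf: "(INF y\<in>sphere (0 :: real ^ 'n) 1. J (- (y $ k))) = J (- 1)"
    proof (rule cInf_eq_minimum)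
      show "J (- 1) \<in> (\<lambda>y. J (- (y $ k))) ` sphere (0 :: real ^ 'n) 1"
        by (rule image_eqI[OF _ e(1)]) (simp add: e(2))
    qed (use c in \<open>force intro!: Jm\<close>)
    have "inf_frac_laplacian s (\<lambda>x :: real ^ 'n. f (x $ k)) x = frac_const s * J 1 + frac_const s * J (- 1)"
    proof -
      have 1: "(LBINT \<eta>:{0<..}. (f ((x + \<eta> *\<^sub>R y) $ k) - f ?a) / \<eta> powr (1 + 2 * s)) = J (y $ k)" for y
        using J[of "y $ k"] by simp
      have 2: "(LBINT \<eta>:{0<..}. (f ((x - \<eta> *\<^sub>R y) $ k) - f ?a) / \<eta> powr (1 + 2 * s)) = J (- (y $ k))" for y
        using J[of "- (y $ k)"] by simp
      show ?thesis unfolding inf_frac_laplacian_def 1 2 sup inf using z by simp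
    qed
    also have "J 1 + J (- 1) = (LINT \<eta>|levy_measure s. f (?a + \<eta>) + f (?a - \<eta>) - 2 * f ?a)"
      unfolding J_def using Bochner_Integration.integral_add[OF i[of 1] i[of "- 1"]] by (simp add: algebra_simps)
    then have "frac_const s * J 1 + frac_const s * J (- 1) = frac_gen s f ?a"
      unfolding frac_gen_def by (simp only: distrib_left[symmetric])
    finally show ?thesis .
  qed
qed

text \<open>The index type carries no order, so an arbitrary coordinate \<open>k\<close> stands for
  the first one. Integrability is stated along with the convolution formula to exclude that the
  integral there is merely a default value.\<close>

theorem theorem2p12:
  fixes s :: real and U\<^sub>0 :: "real \<Rightarrow> real" and k :: "'n::finite"
    and u\<^sub>0 :: "real ^ 'n \<Rightarrow> real"
  assumes "CARD('n) \<ge> 2" and "1/2 < s" and "s < 1"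
    and "U\<^sub>0 \<in> C_bdd_inf UNIV" and "mono U\<^sub>0"
    and "u\<^sub>0 = (\<lambda>x. U\<^sub>0 (x $ k))"
  shows "u\<^sub>0 \<in> C_bdd_inf UNIV \<and>
    (\<exists>u :: (real ^ 'n) \<times> real \<Rightarrow> real.
      u \<in> C_bdd_inf (UNIV \<times> {0..}) \<and>
      classical_solution s u\<^sub>0 u \<and>
      (\<forall>x. \<forall>t>0.
        integrable lborel (\<lambda>\<sigma>. heat_kernel s (x $ k - \<sigma>) t * U\<^sub>0 \<sigma>) \<and>
        u (x, t) = (LBINT \<sigma>. heat_kernel s (x $ k - \<sigma>) t * U\<^sub>0 \<sigma>)))"
proof -
  note s = assms(2,3)
  have s0: "0 < s" using s by simp
  have U: "smooth_bounded U\<^sub>0" by (rule C_bdd_inf_imp_smooth_bounded[OF assms(4)])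
  obtain M where M: "C2_bounded M U\<^sub>0" using smooth_bounded_C2[OF U] .
  note Um[measurable] = C2_bounded_measurable[OF M]
  define u :: "(real ^ 'n) \<times> real \<Rightarrow> real" where "u p = heat_sg s (snd p) U\<^sub>0 (fst p $ k)" for p
  have 1: "u\<^sub>0 \<in> C_bdd_inf UNIV"
    unfolding assms(6) C_bdd_inf_def using C_bdd_coordinate[OF U] by blast
  have 2: "u \<in> C_bdd_inf (UNIV \<times> {0..})"
    unfolding u_def C_bdd_inf_def using C_bdd_heat_sg[OF s U] by blast
  have 3: "classical_solution s u\<^sub>0 u"
    unfolding classical_solution_def
  proof (intro conjI allI impI)
    fix x :: "real ^ 'n" and t :: real assume t: "t > 0"
    then have t0: "t \<ge> 0" by simp
    have sm: "smooth_bounded (heat_sg s t U\<^sub>0)" by (rule heat_sg_smooth[OF s t0 U])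
    show "bounded (range (\<lambda>y. u (y, t)))"
      using heat_sg_C2_bound[OF s t0 M] by (auto simp: u_def intro!: boundedI)
    show "C11_at (\<lambda>y. u (y, t)) x"
      unfolding u_def fst_conv snd_conv by (rule C11_at_coordinate[OF sm])
    have "inf_frac_laplacian s (\<lambda>y. u (y, t)) x = frac_gen s (heat_sg s t U\<^sub>0) (x $ k)"
      unfolding u_def fst_conv snd_conv
      by (rule inf_frac_laplacian_coordinate[OF s0 s(2) sm heat_sg_mono[OF s t0 U assms(5)]])
    also have "\<dots> = heat_sg s t (frac_gen s U\<^sub>0) (x $ k)"
      by (rule frac_gen_heat_sg[OF s t0 M])
    finally have eq: "inf_frac_laplacian s (\<lambda>y. u (y, t)) x = heat_sg s t (frac_gen s U\<^sub>0) (x $ k)" .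
    have "at t within {0..} = at t"
      using t by (intro at_within_interior) (simp add: interior_Ici)
    then show "((\<lambda>\<tau>. u (x, \<tau>)) has_real_derivative inf_frac_laplacian s (\<lambda>y. u (y, t)) x) (at t)"
      unfolding eq using heat_sg_time_deriv[OF s t0 U, of "x $ k"] by (simp add: u_def)
  next
    fix x :: "real ^ 'n"
    show "u (x, 0) = u\<^sub>0 x"
      unfolding u_def heat_sg_def fst_conv snd_conv by (subst integral_heat_law_0) (simp_all add: assms(6))
  qed
  have 4: "integrable lborel (\<lambda>\<sigma>. heat_kernel s (y - \<sigma>) t * U\<^sub>0 \<sigma>) \<and>
        heat_sg s t U\<^sub>0 y = (LBINT \<sigma>. heat_kernel s (y - \<sigma>) t * U\<^sub>0 \<sigma>)" if t: "t > 0" for y t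
  proof -
    let ?F = "\<lambda>z. heat_kernel s z t * U\<^sub>0 (y - z)"
    have "integrable lborel (\<lambda>z. U\<^sub>0 (y - z) * heat_kernel s z t)"
      by (rule integrable_bounded_mult[where B=M]) (use heat_kernel_density(1)[OF s t] C2_bounded_abs[OF M] in auto)
    then have i: "integrable lborel ?F" by (simp add: mult.commute)
    have "heat_sg s t U\<^sub>0 y = (LBINT z. ?F z)"
      unfolding heat_sg_def by (rule integral_heat_law[OF s t]) simp
    \<comment> \<open>The reflection \<open>z = y - \<sigma>\<close> moves the translation from the
      datum to the kernel.\<close>
    also have "\<dots> = \<bar>- 1\<bar> *\<^sub>R (LBINT \<sigma>. ?F (y + (- 1) * \<sigma>))"
      by (rule lborel_integral_real_affine) simp
    finally show ?thesis
      using lborel_integrable_real_affine[OF i, of "- 1" y] by simp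
  qed
  show ?thesis
    using 1 2 3 4 by (auto intro!: exI[of _ u] simp: u_def)
qed

end
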